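(* Let $F$ be a free group of finite rank with fixed basis $A$ and let $H$ be a finitely generated subgroup of $F$. If $\Gamma(H)$ has $n$ vertices, then one can compute $\Gamma(H_{\mathsf{mal}})$ (from $\Gamma(H)$) in time $O(n^3\log n)$, where $H_{\mathsf{mal}}$ is the malnormal closure of $H$ in $F$.
   Context: Words: $F$ is a free group with finite basis $A$; $\bar A=\{\bar a: a\in A\}$ is a disjoint copy of $A$ and $\tilde A=A\cup\bar A$, with $\bar{\bar a}=a$. Elements of $F$ are identified with reduced words over $\tilde A$ (no factor $a\bar a$, $a\in\tilde A$). Stallings graph: each finitely generated $H\le F$ has a unique representation $\mathcal{A}(H)=(\Gamma(H),1)$, where $\Gamma(H)$ is a finite connected directed graph with edges labeled by $A$ and $1$ is a designated vertex, such that (i) for each $a\in A$ every vertex is the source of at most one and the target of at most one $a$-labeled edge; (ii) every vertex except possibly $1$ has degree (in-degree plus out-degree) at least $2$; (iii) a reduced word is in $H$ iff it labels a loop at $1$. Here an edge $(p,a,q)$, $a\in A$, is read as $p\xrightarrow{a}q$ and $q\xrightarrow{\bar a}p$. Malnormality: a subgroup $K$ of $F$ is malnormal if $K^g\cap K=1$ for each $g\in F\setminus K$, where $K^g=g^{-1}Kg$. It is known that every finitely generated $H\le F$ has a least malnormal extension (the smallest malnormal subgroup of $F$ containing $H$), called its malnormal closure $H_{\mathsf{mal}}$, and that $H_{\mathsf{mal}}$ is finitely generated. Complexity: $F$ and $A$ are fixed, so constants may depend on $|A|$; time is counted in the usual unit-cost model, as a function of $n$. *)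

theory Defs
  imports
    "HOL-Algebra.Generated_Groups"
    "HOL-Library.Landau_Symbols"
    "Graph_Theory.Digraph_Component"
begin

section \<open>The free group on a set, as the group of reduced words\<close>

text \<open>
  The symmetrised alphabet is the disjoint sum \<open>A <+> A\<close>: \<open>Inl a\<close> is the letter \<open>a\<close> and
  \<open>Inr a\<close> is its formal inverse.
\<close>

type_synonym 'a word = "('a + 'a) list"

fun bar :: "'a + 'a \<Rightarrow> 'a + 'a" where
  "bar (Inl a) = Inr a"
| "bar (Inr a) = Inl a"

definition reduced :: "'a word \<Rightarrow> bool" where
  "reduced w \<longleftrightarrow> successively (\<lambda>x y. y \<noteq> bar x) w"

fun push :: "'a + 'a \<Rightarrow> 'a word \<Rightarrow> 'a word" where
  "push x [] = [x]"
| "push x (y # w) = (if y = bar x then w else x # y # w)"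

text \<open>Free reduction, processing the word from right to left.\<close>

definition reduce :: "'a word \<Rightarrow> 'a word" where
  "reduce w = foldr push w []"

definition free_group :: "'a set \<Rightarrow> 'a word monoid" where
  "free_group A =
     \<lparr> carrier = {w. reduced w \<and> set w \<subseteq> A <+> A},
       monoid.mult = (\<lambda>u v. reduce (u @ v)),
       one = [] \<rparr>"

lemma bar_bar [simp]: "bar (bar x) = x"
  by (cases x) auto

lemma bar_in_iff [simp]: "bar x \<in> A <+> A \<longleftrightarrow> x \<in> A <+> A"
  by (cases x) auto

lemma reduced_Nil [simp]: "reduced []"
  by (simp add: reduced_def)

lemma reduced_Cons: "reduced (x # w) \<longleftrightarrow> (w = [] \<or> hd w \<noteq> bar x) \<and> reduced w"
  by (auto simp: reduced_def successively_Cons)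

lemma reduced_push: "reduced w \<Longrightarrow> reduced (push x w)"
  by (cases w) (auto simp: reduced_Cons)

lemma push_bar_push: "reduced w \<Longrightarrow> push (bar x) (push x w) = w"
  by (cases w rule: list.exhaust; cases "tl w") (auto simp: reduced_Cons)

lemma reduced_foldr_push: "reduced w \<Longrightarrow> reduced (foldr push u w)"
  by (induction u) (auto intro: reduced_push)

lemma reduce_reduced: "reduced w \<Longrightarrow> reduce w = w"
proof (induction w)
  case (Cons x w)
  then have "reduce w = w" "reduced (x # w)"
    by (auto simp: reduced_Cons)
  then show ?case
    by (cases w) (auto simp: reduce_def reduced_Cons)
qed (simp add: reduce_def)

lemma foldr_push_push:
  assumes "reduced w"
  shows "foldr push (push x r) w = push x (foldr push r w)"
proof (cases r)
  case (Cons y v)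
  have "push x (push (bar x) (foldr push v w)) = foldr push v w"
    using push_bar_push[OF reduced_foldr_push[OF assms], of "bar x" v] by simp
  with Cons show ?thesis by auto
qed simp

lemma foldr_push_reduce:
  "reduced w \<Longrightarrow> foldr push (reduce u) w = foldr push u w"
  by (induction u) (auto simp: reduce_def foldr_push_push)

lemma set_push: "set (push x w) \<subseteq> insert x (set w)"
  by (cases w) auto

lemma set_reduce: "set (reduce w) \<subseteq> set w"
proof (induction w)
  case (Cons x w)
  then show ?case
    using set_push[of x "reduce w"] by (auto simp: reduce_def)
qed (simp add: reduce_def)

lemma reduce_bar_rev: "reduced w \<Longrightarrow> foldr push (map bar (rev u)) (foldr push u w) = w"
  by (induction u) (auto simp: push_bar_push reduced_foldr_push)

lemma group_free_group: "group (free_group A)"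
proof (rule groupI)
  fix u v w assume *: "u \<in> carrier (free_group A)" "v \<in> carrier (free_group A)"
    "w \<in> carrier (free_group A)"
  have red: "reduced (reduce x)" for x :: "'a word"
    by (simp add: reduce_def reduced_foldr_push)
  have app: "reduce (x @ y) = foldr push x (reduce y)" for x y :: "'a word"
    by (simp add: reduce_def)
  show "u \<otimes>\<^bsub>free_group A\<^esub> v \<in> carrier (free_group A)"
    using * set_reduce[of "u @ v"] red by (fastforce simp: free_group_def)
  show "(u \<otimes>\<^bsub>free_group A\<^esub> v) \<otimes>\<^bsub>free_group A\<^esub> w =
        u \<otimes>\<^bsub>free_group A\<^esub> (v \<otimes>\<^bsub>free_group A\<^esub> w)"
    using foldr_push_reduce[OF red[of w], of "u @ v"] reduce_reduced[OF red[of "v @ w"]]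
    by (simp add: free_group_def app)
next
  fix u assume u: "u \<in> carrier (free_group A)"
  then show "\<one>\<^bsub>free_group A\<^esub> \<otimes>\<^bsub>free_group A\<^esub> u = u"
    by (simp add: free_group_def reduce_reduced)
  define v where "v = reduce (map bar (rev u))"
  have "set (map bar (rev u)) \<subseteq> A <+> A"
    using u by (auto simp: free_group_def simp del: Plus_def)
  with set_reduce have "v \<in> carrier (free_group A)"
    by (fastforce simp: free_group_def v_def reduce_def reduced_foldr_push)
  moreover have "v \<otimes>\<^bsub>free_group A\<^esub> u = \<one>\<^bsub>free_group A\<^esub>"
    using u reduce_bar_rev[of "[]" u]
    by (simp add: free_group_def v_def reduce_def[of "_ @ _"] foldr_push_reduce
          reduced_foldr_push)
  ultimately show "\<exists>v\<in>carrier (free_group A). v \<otimes>\<^bsub>free_group A\<^esub> u = \<one>\<^bsub>free_group A\<^esub>"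
    by blast
qed (simp add: free_group_def)


section \<open>Finitely generated and malnormal subgroups\<close>

definition finitely_generated_subgroup :: "('g, 'm) monoid_scheme \<Rightarrow> 'g set \<Rightarrow> bool" where
  "finitely_generated_subgroup G H \<longleftrightarrow>
     (\<exists>S. finite S \<and> S \<subseteq> carrier G \<and> H = generate G S)"

definition conjugate :: "('g, 'm) monoid_scheme \<Rightarrow> 'g set \<Rightarrow> 'g \<Rightarrow> 'g set" where
  "conjugate G K g = (\<lambda>k. inv\<^bsub>G\<^esub> g \<otimes>\<^bsub>G\<^esub> k \<otimes>\<^bsub>G\<^esub> g) ` K"

definition malnormal :: "('g, 'm) monoid_scheme \<Rightarrow> 'g set \<Rightarrow> bool" where
  "malnormal G K \<longleftrightarrow>
     subgroup K G \<and> (\<forall>g \<in> carrier G - K. conjugate G K g \<inter> K = {\<one>\<^bsub>G\<^esub>})"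

text \<open>\<^const>\<open>Least\<close> refers to the inclusion order on sets.\<close>

definition malnormal_closure :: "('g, 'm) monoid_scheme \<Rightarrow> 'g set \<Rightarrow> 'g set" where
  "malnormal_closure G H = (LEAST K. malnormal G K \<and> H \<subseteq> K)"


section \<open>Stallings graphs\<close>

text \<open>An edge \<open>(p, a, q)\<close> leads from \<open>p\<close> to \<open>q\<close> and is labelled \<open>a\<close>.\<close>

record ('v, 'a) pointed_graph =
  vertices :: "'v set"
  edges :: "('v \<times> 'a \<times> 'v) set"
  base :: 'v

definition underlying :: "('v, 'a) pointed_graph \<Rightarrow> ('v, 'v \<times> 'a \<times> 'v) pre_digraph" where
  "underlying \<Gamma> =
     \<lparr> verts = vertices \<Gamma>, arcs = edges \<Gamma>, tail = (\<lambda>(p, a, q). p), head = (\<lambda>(p, a, q). q) \<rparr>"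

fun traverses :: "('v, 'a) pointed_graph \<Rightarrow> 'v \<Rightarrow> 'a + 'a \<Rightarrow> 'v \<Rightarrow> bool" where
  "traverses \<Gamma> p (Inl a) q \<longleftrightarrow> (p, a, q) \<in> edges \<Gamma>"
| "traverses \<Gamma> p (Inr a) q \<longleftrightarrow> (q, a, p) \<in> edges \<Gamma>"

fun labels_path :: "('v, 'a) pointed_graph \<Rightarrow> 'v \<Rightarrow> 'a word \<Rightarrow> 'v \<Rightarrow> bool" where
  "labels_path \<Gamma> p [] q \<longleftrightarrow> p = q"
| "labels_path \<Gamma> p (x # w) q \<longleftrightarrow> (\<exists>r. traverses \<Gamma> p x r \<and> labels_path \<Gamma> r w q)"

text \<open>
  \<open>stallings_graph A H \<Gamma>\<close> says that \<open>\<Gamma>\<close> is (a copy of) the Stallings graph of the subgroup \<open>H\<close>;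
  it determines \<open>\<Gamma>\<close> up to isomorphism.  A loop contributes 2 to the degree of its vertex.
  \<^const>\<open>connected\<close> is weak connectedness.
\<close>

definition stallings_graph :: "'a set \<Rightarrow> 'a word set \<Rightarrow> ('v, 'a) pointed_graph \<Rightarrow> bool" where
  "stallings_graph A H \<Gamma> \<longleftrightarrow>
     fin_digraph (underlying \<Gamma>) \<and> connected (underlying \<Gamma>) \<and>
     base \<Gamma> \<in> vertices \<Gamma> \<and> (\<forall>(p, a, q) \<in> edges \<Gamma>. a \<in> A) \<and>
     (\<forall>a p q q'. (p, a, q) \<in> edges \<Gamma> \<longrightarrow> (p, a, q') \<in> edges \<Gamma> \<longrightarrow> q = q') \<and>
     (\<forall>a p p' q. (p, a, q) \<in> edges \<Gamma> \<longrightarrow> (p', a, q) \<in> edges \<Gamma> \<longrightarrow> p = p') \<and>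
     (\<forall>p \<in> vertices \<Gamma> - {base \<Gamma>}.
        2 \<le> in_degree (underlying \<Gamma>) p + out_degree (underlying \<Gamma>) p) \<and>
     (\<forall>w \<in> carrier (free_group A). w \<in> H \<longleftrightarrow> labels_path \<Gamma> (base \<Gamma>) w (base \<Gamma>))"

text \<open>
  Machine representation of a graph with vertex set \<open>{..<n}\<close>: the number \<open>n\<close>, the base vertex, and
  then the transition table, one row of length \<open>length as\<close> for each vertex \<open>0, \<dots>, n - 1\<close>.  The
  list \<open>as\<close> fixes the order of the letters in a row.  The entry for \<open>p\<close> and \<open>a\<close> is \<open>q + 1\<close> if
  there is an edge \<open>(p, a, q)\<close>, and \<open>0\<close> if no \<open>a\<close>-labelled edge starts at \<open>p\<close>.
\<close>

definition table_entry :: "(nat, 'a) pointed_graph \<Rightarrow> nat \<Rightarrow> 'a \<Rightarrow> nat" where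
  "table_entry \<Gamma> p a =
     (if \<exists>q. (p, a, q) \<in> edges \<Gamma> then Suc (THE q. (p, a, q) \<in> edges \<Gamma>) else 0)"

definition encode_graph :: "'a list \<Rightarrow> (nat, 'a) pointed_graph \<Rightarrow> nat list" where
  "encode_graph as \<Gamma> =
     (let n = card (vertices \<Gamma>)
      in n # base \<Gamma> # concat (map (\<lambda>p. map (table_entry \<Gamma> p) as) [0..<n]))"


section \<open>Unit-cost random access machines\<close>

text \<open>
  A program is a finite list of instructions, acting on registers and on a random access memory,
  both holding natural numbers.  (A program mentions only finitely many registers.)  The only
  arithmetic is addition and truncated subtraction; in particular there is no unit-cost
  multiplication, which would make the unit-cost measure unrealistic.  Every instruction takes one
  unit of time, and the machine halts when the program counter leaves the program.
\<close>

datatype instr =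
    SetConst nat nat  \<comment> \<open>\<open>r\<^sub>i := c\<close>\<close>
  | Add nat nat nat   \<comment> \<open>\<open>r\<^sub>i := r\<^sub>j + r\<^sub>k\<close>\<close>
  | Sub nat nat nat   \<comment> \<open>\<open>r\<^sub>i := r\<^sub>j - r\<^sub>k\<close>, truncated at \<open>0\<close>\<close>
  | Load nat nat      \<comment> \<open>\<open>r\<^sub>i := mem[r\<^sub>j]\<close>\<close>
  | Store nat nat     \<comment> \<open>\<open>mem[r\<^sub>i] := r\<^sub>j\<close>\<close>
  | JumpZero nat nat  \<comment> \<open>if \<open>r\<^sub>i = 0\<close> then continue at instruction \<open>l\<close>\<close>

record config =
  pc :: nat
  reg :: "nat \<Rightarrow> nat"
  mem :: "nat \<Rightarrow> nat"

fun exec :: "instr \<Rightarrow> config \<Rightarrow> config" where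
  "exec (SetConst i c) s = s\<lparr>pc := Suc (pc s), reg := (reg s)(i := c)\<rparr>"
| "exec (Add i j k) s = s\<lparr>pc := Suc (pc s), reg := (reg s)(i := reg s j + reg s k)\<rparr>"
| "exec (Sub i j k) s = s\<lparr>pc := Suc (pc s), reg := (reg s)(i := reg s j - reg s k)\<rparr>"
| "exec (Load i j) s = s\<lparr>pc := Suc (pc s), reg := (reg s)(i := mem s (reg s j))\<rparr>"
| "exec (Store i j) s = s\<lparr>pc := Suc (pc s), mem := (mem s)(reg s i := reg s j)\<rparr>"
| "exec (JumpZero i l) s = s\<lparr>pc := (if reg s i = 0 then l else Suc (pc s))\<rparr>"

definition halted :: "instr list \<Rightarrow> config \<Rightarrow> bool" where
  "halted P s \<longleftrightarrow> length P \<le> pc s"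

definition step :: "instr list \<Rightarrow> config \<Rightarrow> config" where
  "step P s = (if halted P s then s else exec (P ! pc s) s)"

definition initial :: "nat list \<Rightarrow> config" where
  "initial xs =
     \<lparr> pc = 0, reg = (\<lambda>_. 0), mem = (\<lambda>i. if i < length xs then xs ! i else 0) \<rparr>"

text \<open>
  The output is found at the start of the memory; output formats have to be self-delimiting, as
  \<^const>\<open>encode_graph\<close> is.
\<close>

definition computes_within :: "instr list \<Rightarrow> nat \<Rightarrow> nat list \<Rightarrow> nat list \<Rightarrow> bool" where
  "computes_within P t xs ys \<longleftrightarrow>
     (\<exists>k \<le> t. let s = (step P ^^ k) (initial xs)
              in halted P s \<and> (\<forall>i < length ys. mem s i = ys ! i))"

end

theory Submission
  imports Defs
begin

text \<open>
  If two distinct vertices \<open>p, q\<close> of a graph for \<open>K\<close> carry a common loop label \<open>w \<noteq> 1\<close>, and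
  \<open>s, t\<close> label paths from the base vertex to \<open>p\<close> and \<open>q\<close>, then \<open>s w s\<^sup>-\<^sup>1\<close> and its conjugate
  \<open>t w t\<^sup>-\<^sup>1\<close> lie in \<open>K\<close>, so \<open>s t\<^sup>-\<^sup>1\<close> lies in every malnormal extension of \<open>K\<close>: the vertices
  have to be identified, and so do the targets of equally labelled edges leaving identified
  vertices.  Conversely, the subgroup of a folded graph without such a pair is malnormal.  Pairs
  with a common loop exist iff the off-diagonal part of the product of the graph with itself is not
  a forest, that is, iff something remains after its leaves have been stripped.  A round builds
  the quotient by the current partition of the vertices, strips the product (on at most \<open>n\<^sup>2\<close>
  vertices) in linear time, and merges one pair of classes; so there are at most \<open>n\<close> rounds, and
  the total time is even \<open>O(n\<^sup>3)\<close>.  Degrees do not drop in folded quotients, hence the result needs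
  no trimming.
\<close>

section \<open>Words up to free reduction\<close>

text \<open>Soundness rests on one semantic relation on the vertices of the original graph.
  \<open>forced\<close> speaks of all malnormal \<open>M\<close> above
  \<open>lang A \<Gamma>\<close>, so it does not change from round to round, and the order of the
  merges is immaterial. A loop read in a quotient still counts, because every jump between
  identified vertices contributes an element of \<open>M\<close>. The last quotient is malnormal and
  lies in every such \<open>M\<close>, so it is the least one. As \<open>n\<close> rounds may cost
  \<open>n * n\<close> each, the table is rebuilt from the input every time and a merge simply
  relabels all vertices, in place of incremental folding or union-find. The other obstacle is to
  count steps on a machine with neither multiplication nor structured control. A while language with
  exact step counts is compiled to it, multiples of \<open>n\<close> and division by
  \<open>n\<close> are tabulated once, and loops over letters are unrolled into the program, whose
  length depends only on the alphabet.\<close>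

definition winv :: "'a word \<Rightarrow> 'a word" where
  "winv w = map bar (rev w)"

lemma winv_simps [simp]:
  "winv [] = []" "winv (x # w) = winv w @ [bar x]" "winv (u @ v) = winv v @ winv u"
  "winv (winv w) = w"
  by (simp_all add: winv_def rev_map comp_def)

lemma bar_eq_iff [simp]: "bar x = bar y \<longleftrightarrow> x = y"
  by (metis bar_bar)

lemma bar_neq [simp]: "bar x \<noteq> x" "x \<noteq> bar x"
  by (cases x; simp)+

lemma set_winv [simp]: "set (winv w) \<subseteq> A <+> A \<longleftrightarrow> set w \<subseteq> A <+> A"
  unfolding winv_def by (simp add: image_subset_iff subset_eq del: Plus_def)

lemma reduced_reduce [simp]: "reduced (reduce w)"
  by (simp add: reduce_def reduced_foldr_push)

lemma reduce_append: "reduce (u @ v) = foldr push u (reduce v)"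
  by (simp add: reduce_def)

lemma reduce_append_reduce_left [simp]: "reduce (reduce u @ v) = reduce (u @ v)"
  by (simp add: reduce_append foldr_push_reduce)

lemma reduce_append_reduce_right [simp]: "reduce (u @ reduce v) = reduce (u @ v)"
  by (simp add: reduce_append reduce_reduced)

lemma reduce_reduce [simp]: "reduce (reduce u) = reduce u"
  by (simp add: reduce_reduced)

lemma reduce_Nil [simp]: "reduce [] = []"
  by (simp add: reduce_def)

lemma reduce_cong:
  assumes "reduce u = reduce u'"
  shows "reduce (a @ u @ b) = reduce (a @ u' @ b)"
  using assms by (metis reduce_append_reduce_left reduce_append_reduce_right)

lemma reduce_winv_left [simp]: "reduce (winv u @ u @ v) = reduce v"
  using reduce_bar_rev[OF reduced_reduce, of u v]
  by (simp add: reduce_append winv_def)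

lemma reduce_winv_right [simp]: "reduce (u @ winv u @ v) = reduce v"
  using reduce_winv_left[of "winv u" v] by simp

lemma reduce_cancel_left [simp]: "reduce (a @ winv u @ u @ b) = reduce (a @ b)"
  using reduce_winv_left reduce_append by metis

lemma reduce_cancel_right [simp]: "reduce (a @ u @ winv u @ b) = reduce (a @ b)"
  using reduce_cancel_left[of a "winv u" b] by simp

lemma reduce_cancel_letter [simp]:
  "reduce (a @ bar c # c # b) = reduce (a @ b)" "reduce (a @ c # bar c # b) = reduce (a @ b)"
  "reduce (bar c # c # b) = reduce b" "reduce (c # bar c # b) = reduce b"
  using reduce_cancel_left[of a "[c]" b] reduce_cancel_right[of a "[c]" b]
    reduce_cancel_left[of "[]" "[c]" b] reduce_cancel_right[of "[]" "[c]" b] by simp_all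

lemma reduce_winv_self [simp]: "reduce (u @ winv u) = []" "reduce (winv u @ u) = []"
  using reduce_winv_left[of u "[]"] reduce_winv_right[of u "[]"] by simp_all

text \<open>The factor \<open>u @ winv u\<close> is inserted on the right; its \<open>u\<close> may
  be replaced by \<open>reduce u\<close>, which then cancels against
  \<open>winv (reduce u)\<close>.\<close>

lemma reduce_winv_reduce [simp]: "reduce (winv (reduce u)) = reduce (winv u)"
proof -
  have "reduce (winv (reduce u)) = reduce (winv (reduce u) @ u @ winv u)"
    using reduce_cancel_right[of "winv (reduce u)" u "[]"] by simp
  also have "\<dots> = reduce (winv (reduce u) @ reduce u @ winv u)"
    by (rule reduce_cong) simp
  finally show ?thesis by simp
qed

lemma reduced_append:
  "reduced (u @ v) \<longleftrightarrow> reduced u \<and> reduced v \<and> (u = [] \<or> v = [] \<or> hd v \<noteq> bar (last u))"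
  by (auto simp: reduced_def successively_append_iff)

text \<open>Here and below, \<open>reduced (w @ w)\<close> encodes that \<open>w\<close> is
  cyclically reduced. A rotation has the same cyclically adjacent pairs of letters.\<close>

lemma reduced_rotate: "reduced ((u @ v) @ (u @ v)) \<Longrightarrow> reduced ((v @ u) @ (v @ u))"
  by (cases "u = []"; cases "v = []") (auto simp: reduced_append)

lemma reduced_winv: "reduced w \<Longrightarrow> reduced (winv w)"
proof (induction w)
  case (Cons x w)
  then have "reduced (winv w)" "w \<noteq> [] \<Longrightarrow> hd w \<noteq> bar x"
    by (auto simp: reduced_Cons)
  then show ?case
    by (cases w) (auto simp: reduced_append reduced_Cons)
qed simp

text \<open>As long as the first and the last letter are mutually inverse, both are peeled off. The
  core cannot become empty: a reduced word is not \<open>[a, bar a]\<close>, and no letter is its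
  own inverse.\<close>

lemma cyclic_decomposition:
  assumes "reduced w" "w \<noteq> []"
  shows "\<exists>x u. w = x @ u @ winv x \<and> u \<noteq> [] \<and> reduced (u @ u)"
  using assms
proof (induction w rule: length_induct)
  case (1 w)
  show ?case
  proof (cases "reduced (w @ w)")
    case True
    then show ?thesis using 1 by (intro exI[of _ "[]"] exI[of _ w]) simp
  next
    case False
    with 1 have hl: "hd w = bar (last w)" by (simp add: reduced_append)
    then have "length w \<noteq> 1" by (auto simp: length_Suc_conv)
    with \<open>w \<noteq> []\<close> obtain a v where w: "w = a # v" and v: "v \<noteq> []" by (cases w) auto
    define v' where "v' = butlast v"
    have v2: "v = v' @ [bar a]" using hl v w by (simp add: v'_def)
    have "v' \<noteq> []" using 1 w v2 by (auto simp: reduced_Cons)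
    moreover have "reduced v'" using 1 w v2 by (auto simp: reduced_Cons reduced_append)
    ultimately obtain x u where "v' = x @ u @ winv x" "u \<noteq> []" "reduced (u @ u)"
      using 1(1) w v2 by (metis length_append_singleton length_Cons lessI less_SucI)
    then show ?thesis using w v2 by (intro exI[of _ "a # x"] exI[of _ u]) simp
  qed
qed

section \<open>Subgroups and malnormality in terms of words\<close>

lemma carrier_free_group: "w \<in> carrier (free_group A) \<longleftrightarrow> reduced w \<and> set w \<subseteq> A <+> A"
  by (simp add: free_group_def)

lemma mult_free_group [simp]: "u \<otimes>\<^bsub>free_group A\<^esub> v = reduce (u @ v)"
  by (simp add: free_group_def)

lemma one_free_group [simp]: "\<one>\<^bsub>free_group A\<^esub> = []"
  by (simp add: free_group_def)

lemma reduce_in_carrier: "set w \<subseteq> A <+> A \<Longrightarrow> reduce w \<in> carrier (free_group A)"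
  using set_reduce[of w] by (auto simp: carrier_free_group simp del: Plus_def)

lemma inv_free_group:
  assumes "u \<in> carrier (free_group A)"
  shows "inv\<^bsub>free_group A\<^esub> u = reduce (winv u)"
proof -
  interpret group "free_group A" by (rule group_free_group)
  have "reduce (winv u) \<in> carrier (free_group A)"
    using assms by (intro reduce_in_carrier) (simp add: carrier_free_group)
  then show ?thesis using assms by (intro inv_equality) simp_all
qed

context
  fixes A :: "'a set" and M :: "'a word set"
  assumes M: "subgroup M (free_group A)"
begin

text \<open>Membership is stated through \<open>reduce\<close>, so that products can be formed by
  plain concatenation of words that need not be reduced.\<close>

lemma reduce_append_mem:
  assumes "reduce u \<in> M" "reduce v \<in> M"
  shows "reduce (u @ v) \<in> M"
  using subgroup.m_closed[OF M assms] by simp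

lemma reduce_winv_mem:
  assumes "reduce u \<in> M"
  shows "reduce (winv u) \<in> M"
  using subgroup.m_inv_closed[OF M assms] subgroup.mem_carrier[OF M assms]
  by (simp add: inv_free_group)

lemma Nil_mem: "[] \<in> M"
  using subgroup.one_closed[OF M] by simp

end

lemma malnormal_subgroup: "malnormal G M \<Longrightarrow> subgroup M G"
  by (simp add: malnormal_def)

text \<open>Were \<open>reduce g\<close> outside \<open>M\<close>, malnormality would make the
  conjugate of \<open>h\<close> trivial, and conjugating back would make \<open>h\<close>
  trivial.\<close>

lemma malnormal_conjugate:
  assumes "malnormal (free_group A) M" "set g \<subseteq> A <+> A"
    and "reduce h \<in> M" "reduce h \<noteq> []" "reduce (winv g @ h @ g) \<in> M"
  shows "reduce g \<in> M"
proof (rule ccontr)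
  assume "reduce g \<notin> M"
  let ?g = "reduce g"
  have g: "?g \<in> carrier (free_group A)" by (rule reduce_in_carrier) fact
  have M: "subgroup M (free_group A)" using assms by (simp add: malnormal_def)
  have "reduce (winv g @ h @ g) = inv\<^bsub>free_group A\<^esub> ?g \<otimes>\<^bsub>free_group A\<^esub> reduce h \<otimes>\<^bsub>free_group A\<^esub> ?g"
    using reduce_append_reduce_left[of "winv g" "reduce h @ reduce g"]
    by (simp add: inv_free_group[OF g])
  then have "reduce (winv g @ h @ g) \<in> conjugate (free_group A) M ?g"
    unfolding conjugate_def using assms(3) by (rule image_eqI)
  with assms \<open>?g \<notin> M\<close> g have "reduce (winv g @ h @ g) = []"
    by (auto simp: malnormal_def)
  then have "reduce (g @ (winv g @ h @ g) @ winv g) = reduce (g @ [] @ winv g)"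
    by (intro reduce_cong) simp
  moreover have "reduce (g @ (winv g @ h @ g) @ winv g) = reduce h"
    using reduce_cancel_right[of h g "[]"] by simp
  ultimately show False using assms(4) by simp
qed

lemma malnormalI:
  assumes M: "subgroup M (free_group A)"
    and "\<And>g h. g \<in> carrier (free_group A) \<Longrightarrow> h \<in> M \<Longrightarrow> h \<noteq> [] \<Longrightarrow>
      reduce (winv g @ h @ g) \<in> M \<Longrightarrow> g \<in> M"
  shows "malnormal (free_group A) M"
  unfolding malnormal_def
proof (intro conjI M ballI)
  fix g assume g: "g \<in> carrier (free_group A) - M"
  have *: "inv\<^bsub>free_group A\<^esub> g \<otimes>\<^bsub>free_group A\<^esub> h \<otimes>\<^bsub>free_group A\<^esub> g = reduce (winv g @ h @ g)" for h
    using g by (simp add: inv_free_group)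
  have "reduce (winv g @ h @ g) = []" if "h \<in> M" "reduce (winv g @ h @ g) \<in> M" for h
    using assms(2)[of g h] that g by (cases "h = []") auto
  moreover have "[] \<in> conjugate (free_group A) M g"
    unfolding conjugate_def * using Nil_mem[OF M] by force
  ultimately show "conjugate (free_group A) M g \<inter> M = {\<one>\<^bsub>free_group A\<^esub>}"
    using Nil_mem[OF M] unfolding conjugate_def * by auto
qed


section \<open>Folded graphs and their languages\<close>

text \<open>\<open>traverses\<close> is symmetric under \<open>bar\<close>, so letting
  \<open>x\<close> range over both signs covers uniqueness of outgoing and of incoming edges at
  once.\<close>

definition folded :: "('v, 'a) pointed_graph \<Rightarrow> bool" where
  "folded \<Gamma> \<longleftrightarrow> (\<forall>p x q q'. traverses \<Gamma> p x q \<longrightarrow> traverses \<Gamma> p x q' \<longrightarrow> q = q')"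

definition labelled :: "'a set \<Rightarrow> ('v, 'a) pointed_graph \<Rightarrow> bool" where
  "labelled A \<Gamma> \<longleftrightarrow> (\<forall>p x q. traverses \<Gamma> p x q \<longrightarrow> x \<in> A <+> A)"

definition lang :: "'a set \<Rightarrow> ('v, 'a) pointed_graph \<Rightarrow> 'a word set" where
  "lang A \<Gamma> = {w \<in> carrier (free_group A). labels_path \<Gamma> (base \<Gamma>) w (base \<Gamma>)}"

text \<open>The common loop is required to be cyclically reduced, not merely nontrivial: such a loop
  can be rotated, so the pairs that it passes through are core pairs too.\<close>

definition core_pair :: "('v, 'a) pointed_graph \<Rightarrow> 'v \<Rightarrow> 'v \<Rightarrow> bool" where
  "core_pair \<Gamma> p q \<longleftrightarrow> p \<noteq> q \<and>
     (\<exists>u. u \<noteq> [] \<and> reduced (u @ u) \<and> labels_path \<Gamma> p u p \<and> labels_path \<Gamma> q u q)"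

lemma traverses_bar [simp]: "traverses \<Gamma> p (bar x) q \<longleftrightarrow> traverses \<Gamma> q x p"
  by (cases x) auto

lemma labels_path_append [simp]:
  "labels_path \<Gamma> p (u @ v) q \<longleftrightarrow> (\<exists>r. labels_path \<Gamma> p u r \<and> labels_path \<Gamma> r v q)"
  by (induction u arbitrary: p) auto

lemma labels_path_winv [simp]: "labels_path \<Gamma> p (winv w) q \<longleftrightarrow> labels_path \<Gamma> q w p"
  by (induction w arbitrary: q) auto

lemma labels_path_labels:
  assumes "labelled A \<Gamma>" "labels_path \<Gamma> p w q"
  shows "set w \<subseteq> A <+> A"
  using assms(2)
proof (induction w arbitrary: p)
  case (Cons x w)
  then show ?case using assms(1) unfolding labelled_def labels_path.simps set_simps by blast
qed simp

context
  fixes \<Gamma> :: "('v, 'a) pointed_graph"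
  assumes folded: "folded \<Gamma>"
begin

lemma labels_path_unique:
  "labels_path \<Gamma> p w q \<Longrightarrow> labels_path \<Gamma> p w q' \<Longrightarrow> q = q'"
proof (induction w arbitrary: p)
  case (Cons x w)
  then show ?case using folded unfolding folded_def labels_path.simps by metis
qed simp

text \<open>If \<open>x\<close> cancels with the first letter of \<open>w\<close>, folding shows
  that reading \<open>x\<close> and then \<open>bar x\<close> leads back to
  \<open>p\<close>.\<close>

lemma labels_path_push:
  assumes "traverses \<Gamma> p x r" "labels_path \<Gamma> r w q"
  shows "labels_path \<Gamma> p (push x w) q"
proof (cases w)
  case (Cons y v)
  show ?thesis
  proof (cases "y = bar x")
    case True
    then obtain r' where "traverses \<Gamma> r' x r" "labels_path \<Gamma> r' v q"
      using assms Cons by auto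
    moreover have "r' = p"
      using assms(1) \<open>traverses \<Gamma> r' x r\<close> folded unfolding folded_def by (metis traverses_bar)
    ultimately show ?thesis using Cons True by simp
  next
    case False
    then show ?thesis using assms Cons by auto
  qed
qed (use assms in auto)

lemma labels_path_reduce: "labels_path \<Gamma> p w q \<Longrightarrow> labels_path \<Gamma> p (reduce w) q"
proof (induction w arbitrary: p)
  case (Cons x w)
  then show ?case using labels_path_push by (fastforce simp: reduce_def)
qed simp

text \<open>The common loop is rotated by its first letter. The two ends stay distinct because
  folding also applies to the inverse letter.\<close>

lemma core_pair_first:
  assumes "p \<noteq> q" "reduced ((x # u) @ (x # u))" "labels_path \<Gamma> p (x # u) p" "labels_path \<Gamma> q (x # u) q"
  shows "\<exists>r s. traverses \<Gamma> p x r \<and> traverses \<Gamma> q x s \<and> core_pair \<Gamma> r s"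
proof -
  obtain r s where rs: "traverses \<Gamma> p x r" "labels_path \<Gamma> r u p" "traverses \<Gamma> q x s" "labels_path \<Gamma> s u q"
    using assms(3,4) by auto
  have "r \<noteq> s" using rs assms(1) folded unfolding folded_def by (metis traverses_bar)
  moreover have "reduced ((u @ [x]) @ (u @ [x]))" using reduced_rotate[of "[x]" u] assms(2) by simp
  moreover have "labels_path \<Gamma> r (u @ [x]) r" "labels_path \<Gamma> s (u @ [x]) s" using rs by auto
  ultimately have "core_pair \<Gamma> r s" unfolding core_pair_def by blast
  then show ?thesis using rs by blast
qed

text \<open>The two directions are the first letter of the loop and the inverse of its last letter,
  which differ because the label is cyclically reduced. Thus core pairs have degree at least two
  among themselves and survive the stripping of leaves.\<close>

lemma core_pair_step:
  assumes "core_pair \<Gamma> p q"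
  shows "\<exists>x y r s r' s'. x \<noteq> y \<and> traverses \<Gamma> p x r \<and> traverses \<Gamma> q x s \<and> core_pair \<Gamma> r s \<and>
    traverses \<Gamma> p y r' \<and> traverses \<Gamma> q y s' \<and> core_pair \<Gamma> r' s'"
proof -
  obtain u where u: "p \<noteq> q" "u \<noteq> []" "reduced (u @ u)" "labels_path \<Gamma> p u p" "labels_path \<Gamma> q u q"
    using assms unfolding core_pair_def by blast
  obtain x v where v: "u = x # v" using u(2) by (cases u) auto
  obtain y v' where v': "winv u = y # v'" using u(2) by (cases "winv u") (auto simp: winv_def)
  have "reduced (winv u @ winv u)" using reduced_winv[OF u(3)] by simp
  then have "\<exists>r s. traverses \<Gamma> p y r \<and> traverses \<Gamma> q y s \<and> core_pair \<Gamma> r s"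
    using core_pair_first[of p q y v'] u v' by (metis labels_path_winv)
  moreover have "\<exists>r s. traverses \<Gamma> p x r \<and> traverses \<Gamma> q x s \<and> core_pair \<Gamma> r s"
    using core_pair_first[of p q x v] u v by simp
  moreover have "x \<noteq> y"
  proof -
    have "y = bar (last u)" using v' u(2) by (metis hd_map hd_rev list.sel(1) rev_is_Nil_conv winv_def)
    moreover have "hd u \<noteq> bar (last u)" using u(2,3) unfolding reduced_append by blast
    ultimately show ?thesis using v by auto
  qed
  ultimately show ?thesis by blast
qed

context
  fixes A :: "'a set"
  assumes labelled: "labelled A \<Gamma>"
begin

lemma reduce_mem_lang:
  assumes "labels_path \<Gamma> (base \<Gamma>) w (base \<Gamma>)"
  shows "reduce w \<in> lang A \<Gamma>"
  using assms labels_path_reduce reduce_in_carrier[OF labels_path_labels[OF labelled assms]]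
  by (simp add: lang_def)

lemma subgroup_lang: "subgroup (lang A \<Gamma>) (free_group A)"
proof
  show "lang A \<Gamma> \<subseteq> carrier (free_group A)" by (auto simp: lang_def)
next
  fix x y assume "x \<in> lang A \<Gamma>" "y \<in> lang A \<Gamma>"
  then have "labels_path \<Gamma> (base \<Gamma>) (x @ y) (base \<Gamma>)" by (auto simp: lang_def)
  then show "x \<otimes>\<^bsub>free_group A\<^esub> y \<in> lang A \<Gamma>" by (simp only: mult_free_group reduce_mem_lang)
next
  show "\<one>\<^bsub>free_group A\<^esub> \<in> lang A \<Gamma>" by (simp add: lang_def carrier_free_group)
next
  fix x assume x: "x \<in> lang A \<Gamma>"
  then have "labels_path \<Gamma> (base \<Gamma>) (winv x) (base \<Gamma>)" by (auto simp: lang_def)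
  then have "reduce (winv x) \<in> lang A \<Gamma>" by (rule reduce_mem_lang)
  with x show "inv\<^bsub>free_group A\<^esub> x \<in> lang A \<Gamma>" by (simp add: lang_def inv_free_group)
qed

text \<open>
  The loop \<open>z u z\<^sup>-\<^sup>1\<close> need not stay inside the graph.  As long as its reduction
  cancels, \<open>u\<close> can be rotated and \<open>z\<close> shortened.
\<close>

lemma cyclic_word_read_in_graph:
  assumes "u \<noteq> []" "reduced (u @ u)" "reduced z" "reduce (z @ u @ winv z) \<in> lang A \<Gamma>"
  shows "\<exists>q s. labels_path \<Gamma> (base \<Gamma>) s q \<and> labels_path \<Gamma> q u q \<and> reduce (s @ winv z) \<in> lang A \<Gamma>"
  using assms
proof (induction z arbitrary: u rule: rev_induct)
  case Nil
  then have "reduce u = u" by (simp add: reduced_append reduce_reduced)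
  then have "labels_path \<Gamma> (base \<Gamma>) u (base \<Gamma>)" using Nil by (simp add: lang_def)
  then show ?case
    using reduce_mem_lang[of "[]"] by (intro exI[of _ "base \<Gamma>"] exI[of _ "[]"]) simp
next
  case (snoc c z)
  have red: "reduced z" using snoc.prems by (simp add: reduced_append)
  consider (first) "hd u = bar c" | (last) "last u = c" | (none) "hd u \<noteq> bar c" "last u \<noteq> c"
    by blast
  then show ?case
  proof cases
    \<comment> \<open>\<open>z c (c^-1 v) c^-1 z^-1\<close> equals \<open>z (v c^-1) z^-1\<close>:
      the rotated word is conjugated by the shorter \<open>z\<close>.\<close>
    case first
    then obtain v where u: "u = bar c # v" using \<open>u \<noteq> []\<close> by (cases u) auto
    have "reduced ((v @ [bar c]) @ (v @ [bar c]))"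
      using snoc.prems(2) u reduced_rotate[of "[bar c]" v] by simp
    moreover have "reduce (z @ (v @ [bar c]) @ winv z) \<in> lang A \<Gamma>"
      using snoc.prems(4) u by simp
    ultimately obtain q s where "labels_path \<Gamma> (base \<Gamma>) s q" "labels_path \<Gamma> q (v @ [bar c]) q"
      "reduce (s @ winv z) \<in> lang A \<Gamma>"
      using snoc.IH[of "v @ [bar c]"] red by blast
    then obtain p where p: "labels_path \<Gamma> q v p" "traverses \<Gamma> q c p"
      "labels_path \<Gamma> (base \<Gamma>) s q" by auto
    then have "labels_path \<Gamma> (base \<Gamma>) (s @ [c]) p" "labels_path \<Gamma> p u p" by (auto simp: u)
    moreover have "reduce ((s @ [c]) @ winv (z @ [c])) \<in> lang A \<Gamma>"
      using \<open>reduce (s @ winv z) \<in> lang A \<Gamma>\<close> by simp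
    ultimately show ?thesis by blast
  next
    case last
    define v where "v = butlast u"
    have u: "u = v @ [c]" using last \<open>u \<noteq> []\<close> by (auto simp: v_def)
    have "reduced ((c # v) @ (c # v))"
      using snoc.prems(2) u reduced_rotate[of v "[c]"] by simp
    moreover have "reduce (z @ (c # v) @ winv z) \<in> lang A \<Gamma>"
      using snoc.prems(4) u reduce_cancel_letter(2)[of "z @ c # v" c "winv z"] by simp
    ultimately obtain q s where "labels_path \<Gamma> (base \<Gamma>) s q" "labels_path \<Gamma> q (c # v) q"
      "reduce (s @ winv z) \<in> lang A \<Gamma>"
      using snoc.IH[of "c # v"] red by blast
    then obtain p where p: "labels_path \<Gamma> p v q" "traverses \<Gamma> q c p"
      "labels_path \<Gamma> (base \<Gamma>) s q" by auto
    then have "labels_path \<Gamma> (base \<Gamma>) (s @ [c]) p" "labels_path \<Gamma> p u p" by (auto simp: u)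
    moreover have "reduce ((s @ [c]) @ winv (z @ [c])) \<in> lang A \<Gamma>"
      using \<open>reduce (s @ winv z) \<in> lang A \<Gamma>\<close> by simp
    ultimately show ?thesis by blast
  next
    \<comment> \<open>Nothing cancels, so the whole word is read as it stands. By folding, the
      prefix \<open>z @ [c]\<close> and the reversed suffix end at the same vertex, and
      \<open>u\<close> is a loop there.\<close>
    case none
    let ?z = "z @ [c]"
    have "reduced (Z @ u @ winv Z)" if "reduced Z" "Z \<noteq> []" "last Z = c" for Z
      using that snoc.prems(1,2) none reduced_winv[of Z]
      by (auto simp: reduced_append winv_def hd_map hd_rev)
    then have "reduced (?z @ u @ winv ?z)" using snoc.prems(3) by (metis last_snoc snoc_eq_iff_butlast)
    then have "labels_path \<Gamma> (base \<Gamma>) (?z @ u @ winv ?z) (base \<Gamma>)"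
      using snoc.prems(4) by (simp only: reduce_reduced lang_def mem_Collect_eq)
    then obtain p p' where p: "labels_path \<Gamma> (base \<Gamma>) ?z p" "labels_path \<Gamma> p u p'"
      "labels_path \<Gamma> p' (winv ?z) (base \<Gamma>)"
      unfolding labels_path_append by blast
    then have "p' = p" using labels_path_unique[of "base \<Gamma>" ?z] by (simp only: labels_path_winv)
    then show ?thesis
      using p reduce_mem_lang[of "[]"]
      by (intro exI[of _ p] exI[of _ ?z]) (simp only: reduce_winv_self, simp)
  qed
qed

text \<open>Write \<open>h\<close> as \<open>x u x^-1\<close>, so that \<open>u\<close> is a loop at
  the end \<open>p\<close> of \<open>x\<close>. With \<open>z = g^-1 x\<close>, the conjugate of
  \<open>h\<close> is \<open>z u z^-1\<close>, which yields a loop \<open>u\<close> at some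
  \<open>q\<close> reached by \<open>s\<close>. Without core pairs \<open>p = q\<close>, and
  \<open>g\<close> is the product of \<open>x s^-1\<close> and \<open>s z^-1\<close>, both in the
  language.\<close>

lemma malnormal_lang:
  assumes "\<And>p q. \<not> core_pair \<Gamma> p q"
  shows "malnormal (free_group A) (lang A \<Gamma>)"
proof (rule malnormalI[OF subgroup_lang])
  fix g h
  assume g: "g \<in> carrier (free_group A)" and h: "h \<in> lang A \<Gamma>" "h \<noteq> []"
    and hg: "reduce (winv g @ h @ g) \<in> lang A \<Gamma>"
  obtain x u where xu: "h = x @ u @ winv x" "u \<noteq> []" "reduced (u @ u)"
    using cyclic_decomposition[of h] h by (auto simp: lang_def carrier_free_group)
  obtain p p' where p: "labels_path \<Gamma> (base \<Gamma>) x p" "labels_path \<Gamma> p u p'"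
    "labels_path \<Gamma> (base \<Gamma>) x p'"
    using h xu by (auto simp: lang_def)
  then have "p' = p" using labels_path_unique by blast
  define z where "z = reduce (winv g @ x)"
  have "reduce (z @ u @ winv z) = reduce (winv g @ h @ g)"
  proof -
    have "reduce (z @ u @ winv z) = reduce (((winv g @ x) @ u) @ winv z)"
      by (simp add: z_def)
    also have "\<dots> = reduce (((winv g @ x) @ u) @ reduce (winv z))"
      by (rule reduce_append_reduce_right[symmetric])
    also have "reduce (winv z) = reduce (winv (winv g @ x))"
      unfolding z_def by (rule reduce_winv_reduce)
    also have "reduce (((winv g @ x) @ u) @ reduce (winv (winv g @ x))) =
        reduce (((winv g @ x) @ u) @ winv (winv g @ x))"
      by (rule reduce_append_reduce_right)
    finally show ?thesis by (simp add: xu)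
  qed
  with hg obtain q s where q: "labels_path \<Gamma> (base \<Gamma>) s q" "labels_path \<Gamma> q u q"
    "reduce (s @ winv z) \<in> lang A \<Gamma>"
    using cyclic_word_read_in_graph[of u z] xu by (auto simp: z_def)
  have "p = q"
    using assms[of p q] q p \<open>p' = p\<close> xu unfolding core_pair_def by blast
  then have "reduce (x @ winv s) \<in> lang A \<Gamma>"
    using p q by (intro reduce_mem_lang) auto
  then have "reduce ((x @ winv s) @ (s @ winv z)) \<in> lang A \<Gamma>"
    using q(3) by (rule reduce_append_mem[OF subgroup_lang])
  moreover have "reduce ((x @ winv s) @ (s @ winv z)) = reduce (x @ reduce (winv z))"
    by simp
  moreover have "reduce (winv z) = reduce (winv (winv g @ x))"
    unfolding z_def by (rule reduce_winv_reduce)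
  ultimately have "reduce g \<in> lang A \<Gamma>" by simp
  then show "g \<in> lang A \<Gamma>" using g by (simp add: carrier_free_group reduce_reduced)
qed

end

end


section \<open>Common loops from minimum degree two\<close>

text \<open>Of two differently labelled exits, one avoids any given letter. The forbidden first
  letter \<open>y\<close> is generalised in the induction so that the step after \<open>x\<close>
  can exclude \<open>bar x\<close>.\<close>

lemma long_reduced_walk:
  assumes core: "\<And>v. v \<in> S \<Longrightarrow> \<exists>x y v1 v2. x \<noteq> y \<and> v1 \<in> S \<and> v2 \<in> S \<and> R v x v1 \<and> R v y v2"
    and "v \<in> S"
  shows "\<exists>w vs. length w = m \<and> reduced w \<and> (w = [] \<or> hd w \<noteq> y) \<and> vs 0 = v \<and>
    (\<forall>i \<le> m. vs i \<in> S) \<and> (\<forall>i < m. R (vs i) (w ! i) (vs (Suc i)))"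
  using assms(2)
proof (induction m arbitrary: v y)
  case 0
  then show ?case by (intro exI[of _ "[]"] exI[of _ "\<lambda>_. v"]) simp
next
  case (Suc m)
  obtain x v1 where x: "x \<noteq> y" "v1 \<in> S" "R v x v1" using core[OF Suc.prems] by metis
  obtain w vs where w: "length w = m" "reduced w" "w = [] \<or> hd w \<noteq> bar x" "vs 0 = v1"
    "\<forall>i \<le> m. vs i \<in> S" "\<forall>i < m. R (vs i) (w ! i) (vs (Suc i))"
    using Suc.IH[OF x(2), of "bar x"] by blast
  show ?case
    using w x Suc.prems
    by (intro exI[of _ "x # w"] exI[of _ "case_nat v vs"])
      (auto simp: reduced_Cons nth_Cons split: nat.splits)
qed

lemma labels_path_take:
  assumes "\<And>i. i < length w \<Longrightarrow> traverses \<Gamma> (vs i) (w ! i) (vs (Suc i))" "j \<le> length w"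
  shows "labels_path \<Gamma> (vs 0) (take j w) (vs j)"
  using assms(2)
proof (induction j)
  case (Suc j)
  then show ?case using assms(1)[of j] by (auto simp: take_Suc_conv_app_nth)
qed simp

text \<open>A reduced walk of \<open>card S\<close> letters visits \<open>card S + 1\<close> pairs,
  so it visits some pair twice.\<close>

lemma common_loop:
  assumes fin: "finite S" and v: "(p, q) \<in> S"
    and core: "\<And>p q. (p, q) \<in> S \<Longrightarrow> \<exists>x y p1 q1 p2 q2. x \<noteq> y \<and> (p1, q1) \<in> S \<and> (p2, q2) \<in> S \<and>
      traverses \<Gamma> p x p1 \<and> traverses \<Gamma> q x q1 \<and> traverses \<Gamma> p y p2 \<and> traverses \<Gamma> q y q2"
  shows "\<exists>w. reduce w \<noteq> [] \<and> labels_path \<Gamma> p w p \<and> labels_path \<Gamma> q w q"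
proof -
  define R where "R = (\<lambda>v x v'. traverses \<Gamma> (fst v) x (fst v') \<and> traverses \<Gamma> (snd v) x (snd v'))"
  have R: "\<exists>x y v1 v2. x \<noteq> y \<and> v1 \<in> S \<and> v2 \<in> S \<and> R v x v1 \<and> R v y v2" if "v \<in> S" for v
  proof -
    have "(fst v, snd v) \<in> S" using that by simp
    from core[OF this] obtain x y p1 q1 p2 q2 where "x \<noteq> y" "(p1, q1) \<in> S" "(p2, q2) \<in> S"
      "R v x (p1, q1)" "R v y (p2, q2)"
      unfolding R_def fst_conv snd_conv by blast
    then show ?thesis by blast
  qed
  obtain w vs where w: "length w = card S" "reduced w" "vs 0 = (p, q)"
    "\<forall>i \<le> card S. vs i \<in> S" "\<forall>i < card S. R (vs i) (w ! i) (vs (Suc i))"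
    using long_reduced_walk[of S R "(p, q)" "card S", OF R v] by blast
  have "\<not> inj_on vs {..card S}"
  proof
    assume "inj_on vs {..card S}"
    moreover have "vs ` {..card S} \<subseteq> S" using w by auto
    ultimately show False using card_inj_on_le[OF _ _ fin] by fastforce
  qed
  then obtain i j where ij: "i < j" "j \<le> card S" "vs i = vs j"
    by (metis atMost_iff inj_onI linorder_neqE_nat)
  have path: "labels_path \<Gamma> p (take l w) (fst (vs l))" "labels_path \<Gamma> q (take l w) (snd (vs l))"
    if "l \<le> card S" for l
    using labels_path_take[of w \<Gamma> "fst \<circ> vs" l] labels_path_take[of w \<Gamma> "snd \<circ> vs" l] w that
    by (simp_all add: R_def)
  \<comment> \<open>The walk runs to the second visit and comes back along the path to the first, so
    the loop is based at \<open>(p, q)\<close> and not at the repeated pair.\<close>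
  define c where "c = take j w @ winv (take i w)"
  have "labels_path \<Gamma> p c p" "labels_path \<Gamma> q c q"
    using path[of i] path[of j] ij unfolding c_def by auto
  \<comment> \<open>Otherwise two prefixes of the reduced word \<open>w\<close> would represent the
    same element; being reduced, they would be equal, yet their lengths \<open>i < j\<close>
    differ.\<close>
  moreover have "reduce c \<noteq> []"
  proof
    assume "reduce c = []"
    then have "reduce ([] @ c @ take i w) = reduce ([] @ [] @ take i w)" by (intro reduce_cong) simp
    then have "reduce (take j w) = reduce (take i w)"
      using reduce_cancel_left[of "take j w" "take i w" "[]"] by (simp add: c_def)
    moreover have "reduced (take l w)" for l
      using w(2) by (metis append_take_drop_id reduced_append)
    ultimately have "take j w = take i w" by (simp add: reduce_reduced)
    then have "length (take j w) = length (take i w)" by simp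
    then show False using ij w(1) by simp
  qed
  ultimately show ?thesis by blast
qed


section \<open>Forced identifications\<close>

text \<open>Quotients are taken as images: \<open>f\<close> names the class of a vertex. As edges
  are a set of triples, edges that become parallel with equal labels merge by themselves.\<close>

definition map_graph :: "('v \<Rightarrow> 'w) \<Rightarrow> ('v, 'a) pointed_graph \<Rightarrow> ('w, 'a) pointed_graph" where
  "map_graph f \<Gamma> = \<lparr> vertices = f ` vertices \<Gamma>,
     edges = (\<lambda>(p, a, q). (f p, a, f q)) ` edges \<Gamma>, base = f (base \<Gamma>) \<rparr>"

lemma map_graph_simps [simp]:
  "vertices (map_graph f \<Gamma>) = f ` vertices \<Gamma>" "base (map_graph f \<Gamma>) = f (base \<Gamma>)"
  by (simp_all add: map_graph_def)

lemma edges_map_graph: "(P, a, Q) \<in> edges (map_graph f \<Gamma>) \<longleftrightarrow> (\<exists>p q. (p, a, q) \<in> edges \<Gamma> \<and> f p = P \<and> f q = Q)"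
  by (force simp: map_graph_def)

lemma traverses_map_graph:
  "traverses (map_graph f \<Gamma>) P x Q \<longleftrightarrow> (\<exists>p q. traverses \<Gamma> p x q \<and> f p = P \<and> f q = Q)"
  by (cases x) (auto simp: edges_map_graph)

lemma labels_path_map_graph: "labels_path \<Gamma> p w q \<Longrightarrow> labels_path (map_graph f \<Gamma>) (f p) w (f q)"
  by (induction w arbitrary: p) (auto simp: traverses_map_graph)

lemma labelled_map_graph: "labelled A \<Gamma> \<Longrightarrow> labelled A (map_graph f \<Gamma>)"
  unfolding labelled_def traverses_map_graph by blast

text \<open>The cosets \<open>M s\<close> and \<open>M t\<close> agree for every malnormal
  \<open>M\<close> above the language. Quantifying over all access words makes the relation
  independent of a choice of them.\<close>

definition forced :: "'a set \<Rightarrow> ('v, 'a) pointed_graph \<Rightarrow> 'v \<Rightarrow> 'v \<Rightarrow> bool" where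
  "forced A \<Gamma> p q \<longleftrightarrow> (\<forall>M s t. malnormal (free_group A) M \<and> lang A \<Gamma> \<subseteq> M \<and>
     labels_path \<Gamma> (base \<Gamma>) s p \<and> labels_path \<Gamma> (base \<Gamma>) t q \<longrightarrow> reduce (s @ winv t) \<in> M)"

context
  fixes A :: "'a set" and \<Gamma> :: "('v, 'a) pointed_graph"
  assumes folded: "folded \<Gamma>" and labelled: "labelled A \<Gamma>"
    and traverses_vertices: "\<And>p x q. traverses \<Gamma> p x q \<Longrightarrow> p \<in> vertices \<Gamma>"
    and reachable: "\<And>p. p \<in> vertices \<Gamma> \<Longrightarrow> \<exists>s. labels_path \<Gamma> (base \<Gamma>) s p"
begin

lemma forced_refl: "forced A \<Gamma> p p"
  unfolding forced_def
proof (intro allI impI, elim conjE)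
  fix M s t assume "lang A \<Gamma> \<subseteq> M" "labels_path \<Gamma> (base \<Gamma>) s p" "labels_path \<Gamma> (base \<Gamma>) t p"
  moreover from this have "labels_path \<Gamma> (base \<Gamma>) (s @ winv t) (base \<Gamma>)" by auto
  ultimately show "reduce (s @ winv t) \<in> M"
    using reduce_mem_lang[OF folded labelled] by blast
qed

lemma forced_sym:
  assumes "forced A \<Gamma> p q"
  shows "forced A \<Gamma> q p"
  unfolding forced_def
proof (intro allI impI, elim conjE)
  fix M s t assume *: "malnormal (free_group A) M" "lang A \<Gamma> \<subseteq> M"
    "labels_path \<Gamma> (base \<Gamma>) s q" "labels_path \<Gamma> (base \<Gamma>) t p"
  then have "reduce (t @ winv s) \<in> M" using assms by (auto simp: forced_def)
  then have "reduce (winv (t @ winv s)) \<in> M"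
    by (intro reduce_winv_mem[OF malnormal_subgroup[OF *(1)]])
  then show "reduce (s @ winv t) \<in> M" by simp
qed

text \<open>The product of \<open>s u^-1\<close> and \<open>u t^-1\<close> requires an access word
  \<open>u\<close> of the middle vertex.\<close>

lemma forced_trans:
  assumes "forced A \<Gamma> p q" "forced A \<Gamma> q r" "q \<in> vertices \<Gamma>"
  shows "forced A \<Gamma> p r"
  unfolding forced_def
proof (intro allI impI, elim conjE)
  fix M s t assume *: "malnormal (free_group A) M" "lang A \<Gamma> \<subseteq> M"
    "labels_path \<Gamma> (base \<Gamma>) s p" "labels_path \<Gamma> (base \<Gamma>) t r"
  obtain u where "labels_path \<Gamma> (base \<Gamma>) u q" using reachable assms(3) by blast
  then have "reduce (s @ winv u) \<in> M" "reduce (u @ winv t) \<in> M"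
    using assms * by (auto simp: forced_def)
  then have "reduce ((s @ winv u) @ (u @ winv t)) \<in> M"
    by (rule reduce_append_mem[OF malnormal_subgroup[OF *(1)]])
  then show "reduce (s @ winv t) \<in> M" by simp
qed

text \<open>Access words of the targets, continued by \<open>bar x\<close>, are access words of the
  sources; the added letters cancel in the product.\<close>

lemma forced_traverses:
  assumes "traverses \<Gamma> p x q" "traverses \<Gamma> p' x q'" "forced A \<Gamma> p p'"
  shows "forced A \<Gamma> q q'"
  unfolding forced_def
proof (intro allI impI, elim conjE)
  fix M s t assume *: "malnormal (free_group A) M" "lang A \<Gamma> \<subseteq> M"
    "labels_path \<Gamma> (base \<Gamma>) s q" "labels_path \<Gamma> (base \<Gamma>) t q'"
  then have "labels_path \<Gamma> (base \<Gamma>) (s @ [bar x]) p" "labels_path \<Gamma> (base \<Gamma>) (t @ [bar x]) p'"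
    using assms by auto
  then have "reduce ((s @ [bar x]) @ winv (t @ [bar x])) \<in> M"
    using * assms(3) unfolding forced_def by blast
  then show "reduce (s @ winv t) \<in> M" by simp
qed

context
  fixes f :: "'v \<Rightarrow> 'w"
  assumes kernel: "\<And>p q. p \<in> vertices \<Gamma> \<Longrightarrow> q \<in> vertices \<Gamma> \<Longrightarrow> f p = f q \<Longrightarrow> forced A \<Gamma> p q"
begin

text \<open>A path in the quotient is a chain of edges of \<open>\<Gamma>\<close> with jumps inside
  classes. A jump from \<open>p\<close> to \<open>p1\<close> is accounted for by
  \<open>s s1^-1\<close>, which lies in \<open>M\<close> because the two vertices are forced
  together.\<close>

lemma labels_path_map_graph_mem:
  assumes M: "malnormal (free_group A) M" "lang A \<Gamma> \<subseteq> M"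
    and "labels_path (map_graph f \<Gamma>) (f p) w (f q)" "p \<in> vertices \<Gamma>" "q \<in> vertices \<Gamma>"
    and "labels_path \<Gamma> (base \<Gamma>) s p" "labels_path \<Gamma> (base \<Gamma>) t q"
  shows "reduce (s @ w @ winv t) \<in> M"
  using assms(3-)
proof (induction w arbitrary: p s)
  case Nil
  then have "forced A \<Gamma> p q" using kernel by simp
  then show ?case using Nil M unfolding forced_def by auto
next
  case (Cons x w)
  then obtain p1 r1 where 1: "traverses \<Gamma> p1 x r1" "f p1 = f p" 
    "labels_path (map_graph f \<Gamma>) (f r1) w (f q)"
    by (auto simp: traverses_map_graph)
  have "p1 \<in> vertices \<Gamma>" "r1 \<in> vertices \<Gamma>"
    using traverses_vertices[of p1 x] traverses_vertices[of r1 "bar x"] 1 by auto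
  obtain s1 where s1: "labels_path \<Gamma> (base \<Gamma>) s1 p1" using reachable \<open>p1 \<in> vertices \<Gamma>\<close> by blast
  have "reduce ((s1 @ [x]) @ w @ winv t) \<in> M"
    using 1 s1 Cons.prems \<open>r1 \<in> vertices \<Gamma>\<close> by (intro Cons.IH[of r1]) auto
  moreover have "reduce (s @ winv s1) \<in> M"
    using kernel[of p p1] 1 s1 Cons.prems \<open>p1 \<in> vertices \<Gamma>\<close> M unfolding forced_def by auto
  ultimately have "reduce ((s @ winv s1) @ ((s1 @ [x]) @ w @ winv t)) \<in> M"
    by (intro reduce_append_mem[OF malnormal_subgroup[OF M(1)], of "s @ winv s1"])
  then show ?case by simp
qed

text \<open>Conjugating \<open>s w s^-1\<close> by \<open>s t^-1\<close> gives
  \<open>t w t^-1\<close>. Both lie in \<open>M\<close> and the first is nontrivial, so malnormality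
  puts \<open>s t^-1\<close> into \<open>M\<close>. The loop is read in the quotient, whereas
  \<open>s\<close> and \<open>t\<close> are read in \<open>\<Gamma>\<close>.\<close>

lemma forced_common_loop:
  assumes "p \<in> vertices \<Gamma>" "q \<in> vertices \<Gamma>" "reduce w \<noteq> []"
    and "labels_path (map_graph f \<Gamma>) (f p) w (f p)" "labels_path (map_graph f \<Gamma>) (f q) w (f q)"
  shows "forced A \<Gamma> p q"
  unfolding forced_def
proof (intro allI impI, elim conjE)
  fix M s t assume *: "malnormal (free_group A) M" "lang A \<Gamma> \<subseteq> M"
    "labels_path \<Gamma> (base \<Gamma>) s p" "labels_path \<Gamma> (base \<Gamma>) t q"
  have "reduce (s @ w @ winv s) \<in> M" "reduce (t @ w @ winv t) \<in> M"
    using labels_path_map_graph_mem[OF *(1,2)] * assms by auto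
  moreover have "set (s @ winv t) \<subseteq> A <+> A"
    using labels_path_labels[OF labelled *(3)] labels_path_labels[OF labelled *(4)] 
    by (simp only: set_append Un_subset_iff set_winv)
  moreover have "reduce (s @ w @ winv s) \<noteq> []"
  proof
    assume "reduce (s @ w @ winv s) = []"
    then have "reduce (winv s @ (s @ w @ winv s) @ s) = reduce (winv s @ [] @ s)"
      by (intro reduce_cong) simp
    then show False using assms(3) reduce_cancel_left[of w s "[]"] by simp
  qed
  moreover have "reduce (winv (s @ winv t) @ (s @ w @ winv s) @ (s @ winv t)) =
      reduce (t @ w @ winv t)"
    by simp (metis append_assoc reduce_cancel_left)
  ultimately show "reduce (s @ winv t) \<in> M"
    using * by (intro malnormal_conjugate[of A M "s @ winv t" "s @ w @ winv s"]) simp_all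
qed

text \<open>Leastness is the path lemma with empty access words: a loop at the base of the quotient
  lies in every malnormal extension.\<close>

lemma malnormal_closure_eq_lang_map_graph:
  assumes "malnormal (free_group A) (lang A (map_graph f \<Gamma>))" "base \<Gamma> \<in> vertices \<Gamma>"
  shows "malnormal_closure (free_group A) (lang A \<Gamma>) = lang A (map_graph f \<Gamma>)"
  unfolding malnormal_closure_def
proof (rule Least_equality)
  show "malnormal (free_group A) (lang A (map_graph f \<Gamma>)) \<and> lang A \<Gamma> \<subseteq> lang A (map_graph f \<Gamma>)"
    using assms by (auto simp: lang_def intro: labels_path_map_graph)
next
  fix M assume M: "malnormal (free_group A) M \<and> lang A \<Gamma> \<subseteq> M"
  show "lang A (map_graph f \<Gamma>) \<le> M"
  proof
    fix w assume "w \<in> lang A (map_graph f \<Gamma>)"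
    then have "reduced w" "labels_path (map_graph f \<Gamma>) (f (base \<Gamma>)) w (f (base \<Gamma>))"
      by (auto simp: lang_def carrier_free_group)
    then show "w \<in> M"
      using labels_path_map_graph_mem[of M "base \<Gamma>" w "base \<Gamma>" "[]" "[]"] M assms
      by (simp add: reduce_reduced)
  qed
qed

end

end

section \<open>Quotients of Stallings graphs\<close>

lemma underlying_simps [simp]:
  "verts (underlying \<Gamma>) = vertices \<Gamma>" "arcs (underlying \<Gamma>) = edges \<Gamma>"
  "tail (underlying \<Gamma>) e = fst e" "head (underlying \<Gamma>) e = snd (snd e)"
  by (simp_all add: underlying_def split_def)

lemma folded_iff:
  "folded \<Gamma> \<longleftrightarrow>
    (\<forall>a p q q'. (p, a, q) \<in> edges \<Gamma> \<longrightarrow> (p, a, q') \<in> edges \<Gamma> \<longrightarrow> q = q') \<and>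
    (\<forall>a p p' q. (p, a, q) \<in> edges \<Gamma> \<longrightarrow> (p', a, q) \<in> edges \<Gamma> \<longrightarrow> p = p')"
  unfolding folded_def by (simp add: split_sum_all) blast

lemma labelled_iff: "labelled A \<Gamma> \<longleftrightarrow> (\<forall>(p, a, q) \<in> edges \<Gamma>. a \<in> A)"
proof
  assume "labelled A \<Gamma>"
  then have "traverses \<Gamma> p (Inl a) q \<Longrightarrow> Inl a \<in> A <+> A" for p a q
    unfolding labelled_def by blast
  then show "\<forall>(p, a, q) \<in> edges \<Gamma>. a \<in> A" by auto
qed (auto simp: labelled_def split_sum_all)

lemma symcl_arcs_ends_underlying:
  "(p, q) \<in> symcl (arcs_ends (underlying \<Gamma>)) \<longleftrightarrow> (\<exists>x. traverses \<Gamma> p x q)"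
  unfolding symcl_def arcs_ends_def arc_to_ends_def by (force simp: split_sum_ex)

lemma wf_digraph_traverses:
  assumes "wf_digraph (underlying \<Gamma>)" "traverses \<Gamma> p x q"
  shows "p \<in> vertices \<Gamma>"
  using assms wf_digraph.tail_in_verts[OF assms(1)] wf_digraph.head_in_verts[OF assms(1)]
  by (cases x) fastforce+

lemma connected_underlying:
  assumes "wf_digraph (underlying \<Gamma>)"
  shows "connected (underlying \<Gamma>) \<longleftrightarrow> vertices \<Gamma> \<noteq> {} \<and>
    (\<forall>p \<in> vertices \<Gamma>. \<forall>q \<in> vertices \<Gamma>. \<exists>w. labels_path \<Gamma> p w q)"
proof -
  have "(p, q) \<in> rtrancl_on (vertices \<Gamma>) (symcl (arcs_ends (underlying \<Gamma>)))"
    if "labels_path \<Gamma> p w q" "q \<in> vertices \<Gamma>" for p w q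
    using that
  proof (induction w arbitrary: p)
    case (Cons x w)
    then obtain r where "traverses \<Gamma> p x r" "labels_path \<Gamma> r w q" by auto
    then show ?case
      using Cons wf_digraph_traverses[OF assms] symcl_arcs_ends_underlying
      by (metis converse_rtrancl_on_into_rtrancl_on)
  qed auto
  moreover have "\<exists>w. labels_path \<Gamma> p w q"
    if "(p, q) \<in> rtrancl_on (vertices \<Gamma>) (symcl (arcs_ends (underlying \<Gamma>)))" for p q
    using that
  proof (induction rule: rtrancl_on_induct)
    case base
    show ?case by (intro exI[of _ "[]"]) simp
  next
    case (step y z)
    then obtain w x where "labels_path \<Gamma> p w y" "traverses \<Gamma> y x z"
      by (auto simp: symcl_arcs_ends_underlying)
    then show ?case by (intro exI[of _ "w @ [x]"]) auto
  qed
  ultimately show ?thesis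
    unfolding connected_conv underlying_simps by blast
qed

context
  fixes A :: "'a set" and H :: "'a word set" and \<Gamma> :: "('v, 'a) pointed_graph"
  assumes st: "stallings_graph A H \<Gamma>"
begin

lemma stallings_wf: "wf_digraph (underlying \<Gamma>)"
  using st by (simp add: stallings_graph_def fin_digraph_def)

lemma stallings_finite: "finite (vertices \<Gamma>)" "finite (edges \<Gamma>)"
  using st fin_digraph.finite_verts fin_digraph.finite_arcs
  by (fastforce simp: stallings_graph_def)+

lemma stallings_folded: "folded \<Gamma>"
  using st by (simp add: stallings_graph_def folded_iff)

lemma stallings_labelled: "labelled A \<Gamma>"
  using st by (simp add: stallings_graph_def labelled_iff)

lemma stallings_traverses: "traverses \<Gamma> p x q \<Longrightarrow> p \<in> vertices \<Gamma>"
  by (rule wf_digraph_traverses[OF stallings_wf])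

lemma stallings_base: "base \<Gamma> \<in> vertices \<Gamma>"
  using st by (simp add: stallings_graph_def)

lemma stallings_path: "p \<in> vertices \<Gamma> \<Longrightarrow> q \<in> vertices \<Gamma> \<Longrightarrow> \<exists>w. labels_path \<Gamma> p w q"
  using st connected_underlying[OF stallings_wf] by (simp add: stallings_graph_def)

lemma stallings_reachable: "p \<in> vertices \<Gamma> \<Longrightarrow> \<exists>s. labels_path \<Gamma> (base \<Gamma>) s p"
  using stallings_path stallings_base by blast

lemma stallings_lang: "H \<subseteq> carrier (free_group A) \<Longrightarrow> lang A \<Gamma> = H"
  using st by (auto simp: stallings_graph_def lang_def)

lemma stallings_degree:
  "p \<in> vertices \<Gamma> \<Longrightarrow> p \<noteq> base \<Gamma> \<Longrightarrow>
    2 \<le> in_degree (underlying \<Gamma>) p + out_degree (underlying \<Gamma>) p"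
  using st by (simp add: stallings_graph_def)

lemma stallings_map_graph:
  assumes "folded (map_graph f \<Gamma>)"
  shows "stallings_graph A (lang A (map_graph f \<Gamma>)) (map_graph f \<Gamma>)"
proof -
  let ?\<Delta> = "map_graph f \<Gamma>"
  have fin: "finite (edges ?\<Delta>)" using stallings_finite by (simp add: map_graph_def)
  have ends: "p \<in> vertices \<Gamma> \<and> q \<in> vertices \<Gamma>" if "(p, a, q) \<in> edges \<Gamma>" for p a q
    using stallings_traverses[of p "Inl a" q] stallings_traverses[of q "Inr a" p] that by simp
  have wf: "wf_digraph (underlying ?\<Delta>)"
    by unfold_locales (auto simp: edges_map_graph dest!: ends)
  have "fin_digraph (underlying ?\<Delta>)"
    using wf fin stallings_finite by (simp add: fin_digraph_def fin_digraph_axioms_def)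
  moreover have "\<exists>w. labels_path ?\<Delta> (f p) w (f q)" if "p \<in> vertices \<Gamma>" "q \<in> vertices \<Gamma>" for p q
    using stallings_path[OF that] labels_path_map_graph by metis
  then have "connected (underlying ?\<Delta>)"
    unfolding connected_underlying[OF wf] using stallings_base by auto
  moreover have "2 \<le> in_degree (underlying ?\<Delta>) P + out_degree (underlying ?\<Delta>) P"
    if P: "P \<in> vertices ?\<Delta> - {base ?\<Delta>}" for P
  proof -
    obtain p where p: "p \<in> vertices \<Gamma>" "p \<noteq> base \<Gamma>" "P = f p" using P by auto
    let ?g = "\<lambda>(p, a, q). (f p, a, f q)"
    have det: "(p, a, q) \<in> edges \<Gamma> \<Longrightarrow> (p, a, q') \<in> edges \<Gamma> \<Longrightarrow> q = q'"
      "(q, a, p) \<in> edges \<Gamma> \<Longrightarrow> (q', a, p) \<in> edges \<Gamma> \<Longrightarrow> q = q'" for a q q'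
      using stallings_folded by (auto simp: folded_iff)
    \<comment> \<open>Edges at \<open>p\<close> with the same image carry the same label, so they
      coincide because \<open>\<Gamma>\<close> is folded. Hence the edges at \<open>p\<close> inject
      into those at \<open>P\<close>.\<close>
    have "card (in_arcs (underlying \<Gamma>) p) \<le> card (in_arcs (underlying ?\<Delta>) P)"
      using fin det(2) by (intro card_inj_on_le[where f = ?g])
        (auto simp: inj_on_def in_arcs_def p, auto simp: edges_map_graph)
    moreover have "card (out_arcs (underlying \<Gamma>) p) \<le> card (out_arcs (underlying ?\<Delta>) P)"
      using fin det(1) by (intro card_inj_on_le[where f = ?g])
        (auto simp: inj_on_def out_arcs_def p, auto simp: edges_map_graph)
    ultimately show ?thesis
      using stallings_degree[OF p(1,2)] unfolding in_degree_def out_degree_def by linarith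
  qed
  ultimately show ?thesis
    using assms stallings_base labelled_map_graph[OF stallings_labelled, of f]
    unfolding stallings_graph_def folded_iff labelled_iff by (auto simp: lang_def)
qed

end

section \<open>A structured language on top of the random access machine\<close>

datatype exp =
    ENum nat
  | EVar nat
  | ESum exp exp  (infixl \<open>[+]\<close> 65)
  | EDiff exp exp  (infixl \<open>[-]\<close> 65)
  | EArr nat exp

datatype com =
    Skip
  | Assign nat exp
  | SetArr nat exp exp
  | Read nat exp
  | Write exp exp
  | Seq com com  (infixr \<open>;;\<close> 60)
  | Cond exp com com
  | While exp com

record store =
  var :: "nat \<Rightarrow> nat"
  arr :: "nat \<Rightarrow> nat \<Rightarrow> nat"
  inp :: "nat \<Rightarrow> nat"

fun val :: "exp \<Rightarrow> store \<Rightarrow> nat" where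
  "val (ENum n) s = n"
| "val (EVar x) s = var s x"
| "val (e [+] e') s = val e s + val e' s"
| "val (e [-] e') s = val e s - val e' s"
| "val (EArr j e) s = arr s j (val e s)"

text \<open>
  Layout: register \<open>0\<close> holds the length \<open>L\<close> of the input area, variables occupy the other even
  registers and temporaries the odd ones.  Entry \<open>i\<close> of array \<open>j < M\<close> is at address
  \<open>L + M * i + j\<close>, so that unboundedly long arrays are interleaved above the input area.
\<close>

definition caddr :: "nat \<Rightarrow> nat \<Rightarrow> nat \<Rightarrow> instr list" where
  "caddr M j t = SetConst (2*t+3) j # replicate M (Add (2*t+3) (2*t+3) (2*t+1)) @ [Add (2*t+3) (2*t+3) 0]"

text \<open>Temporaries form a stack: at depth \<open>t\<close> the value ends in register
  \<open>2*t+1\<close>, and only odd registers from there on are overwritten. A variable is copied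
  by adding it to 0, as there is no move instruction.\<close>

fun cexp :: "nat \<Rightarrow> exp \<Rightarrow> nat \<Rightarrow> instr list" where
  "cexp M (ENum n) t = [SetConst (2*t+1) n]"
| "cexp M (EVar x) t = [SetConst (2*t+1) 0, Add (2*t+1) (2*t+1) (2*x+2)]"
| "cexp M (e [+] e') t = cexp M e t @ cexp M e' (Suc t) @ [Add (2*t+1) (2*t+1) (2*t+3)]"
| "cexp M (e [-] e') t = cexp M e t @ cexp M e' (Suc t) @ [Sub (2*t+1) (2*t+1) (2*t+3)]"
| "cexp M (EArr j e) t = cexp M e t @ caddr M j t @ [Load (2*t+1) (2*t+3)]"

fun elen :: "nat \<Rightarrow> exp \<Rightarrow> nat" where
  "elen M (ENum n) = 1"
| "elen M (EVar x) = 2"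
| "elen M (e [+] e') = elen M e + elen M e' + 1"
| "elen M (e [-] e') = elen M e + elen M e' + 1"
| "elen M (EArr j e) = elen M e + M + 3"

fun clen :: "nat \<Rightarrow> com \<Rightarrow> nat" where
  "clen M Skip = 0"
| "clen M (Assign x e) = elen M e + 2"
| "clen M (SetArr j e e') = elen M e' + elen M e + M + 3"
| "clen M (Read x e) = elen M e + 1"
| "clen M (Write e e') = elen M e' + elen M e + 1"
| "clen M (c ;; d) = clen M c + clen M d"
| "clen M (Cond e c d) = elen M e + clen M c + clen M d + 3"
| "clen M (While e c) = elen M e + clen M c + 3"

text \<open>Jump targets are absolute, so the start address \<open>a\<close> is passed along. An
  unconditional jump is \<open>SetConst 1 0\<close> followed by \<open>JumpZero 1\<close>. For
  stores, the value waits in register 1 while the address is computed in higher ones.\<close>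

fun ccom :: "nat \<Rightarrow> com \<Rightarrow> nat \<Rightarrow> instr list" where
  "ccom M Skip a = []"
| "ccom M (Assign x e) a = cexp M e 0 @ [SetConst (2*x+2) 0, Add (2*x+2) (2*x+2) 1]"
| "ccom M (SetArr j e e') a = cexp M e' 0 @ cexp M e 1 @ caddr M j 1 @ [Store 5 1]"
| "ccom M (Read x e) a = cexp M e 0 @ [Load (2*x+2) 1]"
| "ccom M (Write e e') a = cexp M e' 0 @ cexp M e 1 @ [Store 3 1]"
| "ccom M (c ;; d) a = ccom M c a @ ccom M d (a + clen M c)"
| "ccom M (Cond e c d) a =
     cexp M e 0 @ [JumpZero 1 (a + elen M e + clen M c + 3)] @ ccom M c (a + elen M e + 1) @
     [SetConst 1 0, JumpZero 1 (a + elen M e + clen M c + clen M d + 3)] @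
     ccom M d (a + elen M e + clen M c + 3)"
| "ccom M (While e c) a =
     cexp M e 0 @ [JumpZero 1 (a + elen M e + clen M c + 3)] @ ccom M c (a + elen M e + 1) @
     [SetConst 1 0, JumpZero 1 a]"

fun wf_exp :: "nat \<Rightarrow> exp \<Rightarrow> bool" where
  "wf_exp M (ENum n) = True"
| "wf_exp M (EVar x) = True"
| "wf_exp M (e [+] e') = (wf_exp M e \<and> wf_exp M e')"
| "wf_exp M (e [-] e') = (wf_exp M e \<and> wf_exp M e')"
| "wf_exp M (EArr j e) = (j < M \<and> wf_exp M e)"

fun wf_com :: "nat \<Rightarrow> com \<Rightarrow> bool" where
  "wf_com M Skip = True"
| "wf_com M (Assign x e) = wf_exp M e"
| "wf_com M (SetArr j e e') = (j < M \<and> wf_exp M e \<and> wf_exp M e')"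
| "wf_com M (Read x e) = wf_exp M e"
| "wf_com M (Write e e') = (wf_exp M e \<and> wf_exp M e')"
| "wf_com M (c ;; d) = (wf_com M c \<and> wf_com M d)"
| "wf_com M (Cond e c d) = (wf_exp M e \<and> wf_com M c \<and> wf_com M d)"
| "wf_com M (While e c) = (wf_exp M e \<and> wf_com M c)"

text \<open>In \<open>big M L c s t s'\<close>, \<open>t\<close> is the exact number of machine steps of the compiled code.\<close>

inductive big :: "nat \<Rightarrow> nat \<Rightarrow> com \<Rightarrow> store \<Rightarrow> nat \<Rightarrow> store \<Rightarrow> bool" for M L where
  Skip: "big M L Skip s 0 s"
| Assign: "big M L (Assign x e) s (clen M (Assign x e)) (s\<lparr>var := (var s)(x := val e s)\<rparr>)"
| SetArr: "big M L (SetArr j e e') s (clen M (SetArr j e e'))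
    (s\<lparr>arr := (arr s)(j := (arr s j)(val e s := val e' s))\<rparr>)"
| Read: "val e s < L \<Longrightarrow>
    big M L (Read x e) s (clen M (Read x e)) (s\<lparr>var := (var s)(x := inp s (val e s))\<rparr>)"
| Write: "val e s < L \<Longrightarrow>
    big M L (Write e e') s (clen M (Write e e')) (s\<lparr>inp := (inp s)(val e s := val e' s)\<rparr>)"
| Seq: "big M L c s t s' \<Longrightarrow> big M L d s' t' s'' \<Longrightarrow> big M L (c ;; d) s (t + t') s''"
| CondTrue: "val e s \<noteq> 0 \<Longrightarrow> big M L c s t s' \<Longrightarrow>
    big M L (Cond e c d) s (elen M e + 1 + t + 2) s'"
| CondFalse: "val e s = 0 \<Longrightarrow> big M L d s t s' \<Longrightarrow> big M L (Cond e c d) s (elen M e + 1 + t) s'"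
| WhileFalse: "val e s = 0 \<Longrightarrow> big M L (While e c) s (elen M e + 1) s"
| WhileTrue: "val e s \<noteq> 0 \<Longrightarrow> big M L c s t s' \<Longrightarrow> big M L (While e c) s' t' s'' \<Longrightarrow>
    big M L (While e c) s (elen M e + 1 + t + 2 + t') s''"

text \<open>Odd registers are left unconstrained. Cells below \<open>L\<close> mirror
  \<open>inp\<close> and those above mirror the arrays, which is why \<open>big\<close> admits
  \<open>Read\<close> and \<open>Write\<close> only at addresses below \<open>L\<close>.\<close>

definition rel :: "nat \<Rightarrow> nat \<Rightarrow> store \<Rightarrow> config \<Rightarrow> bool" where
  "rel M L s \<sigma> \<longleftrightarrow> reg \<sigma> 0 = L \<and> (\<forall>x. reg \<sigma> (2*x+2) = var s x) \<and> (\<forall>a < L. mem \<sigma> a = inp s a) \<and>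
     (\<forall>j < M. \<forall>i. mem \<sigma> (L + M * i + j) = arr s j i)"

section \<open>Simulation of the while language by the machine\<close>

lemma length_cexp [simp]: "length (cexp M e t) = elen M e"
  by (induction e arbitrary: t) (simp_all add: caddr_def)

lemma length_ccom [simp]: "length (ccom M c a) = clen M c"
  by (induction c arbitrary: a) (simp_all add: caddr_def)

fun jump_free :: "instr \<Rightarrow> bool" where
  "jump_free (JumpZero i l) = False"
| "jump_free _ = True"

lemma jump_free_cexp: "i \<in> set (cexp M e t) \<Longrightarrow> jump_free i"
  by (induction e arbitrary: t) (auto simp: caddr_def split: if_splits)

lemma jump_free_caddr: "i \<in> set (caddr M j t) \<Longrightarrow> jump_free i"
  by (auto simp: caddr_def split: if_splits)

lemma pc_exec: "jump_free i \<Longrightarrow> pc (exec i \<sigma>) = Suc (pc \<sigma>)"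
  by (cases i) auto

lemma pc_fold_exec: "(\<And>i. i \<in> set is \<Longrightarrow> jump_free i) \<Longrightarrow> pc (fold exec is \<sigma>) = pc \<sigma> + length is"
  by (induction "is" arbitrary: \<sigma>) (auto simp: pc_exec)

definition code_at :: "instr list \<Rightarrow> nat \<Rightarrow> instr list \<Rightarrow> bool" where
  "code_at P a is \<longleftrightarrow> (\<exists>pre post. P = pre @ is @ post \<and> length pre = a)"

lemma code_at_append:
  "code_at P a (is @ js) \<longleftrightarrow> code_at P a is \<and> code_at P (a + length is) js"
proof
  assume "code_at P a (is @ js)"
  then obtain pre post where P: "P = pre @ (is @ js) @ post" "length pre = a"
    unfolding code_at_def by blast
  then have "P = pre @ is @ (js @ post)" "P = (pre @ is) @ js @ post"
    "length (pre @ is) = a + length is" by simp_all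
  then show "code_at P a is \<and> code_at P (a + length is) js"
    unfolding code_at_def using P(2) by blast
next
  assume "code_at P a is \<and> code_at P (a + length is) js"
  then obtain pre post pre' post' where *: "P = pre @ is @ post" "length pre = a"
    "P = pre' @ js @ post'" "length pre' = a + length is"
    unfolding code_at_def by blast
  then have "(pre @ is) @ post = pre' @ js @ post'" "length (pre @ is) = length pre'" by simp_all
  then have "post = js @ post'" using append_eq_append_conv by blast
  then have "P = pre @ (is @ js) @ post'" using * by simp
  then show "code_at P a (is @ js)" using *(2) unfolding code_at_def by blast
qed

lemma code_at_Cons:
  "code_at P a (i # js) \<longleftrightarrow> code_at P a [i] \<and> code_at P (Suc a) js"
  using code_at_append[of P a "[i]" js] by simp

lemma code_at_single: "code_at P a [i] \<Longrightarrow> a < length P \<and> P ! a = i"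
  unfolding code_at_def by (auto simp: nth_append)

lemma step_code_at: "code_at P (pc \<sigma>) [i] \<Longrightarrow> step P \<sigma> = exec i \<sigma>"
  using code_at_single[of P "pc \<sigma>" i] by (simp add: step_def halted_def)

lemma steps_straight:
  assumes "code_at P (pc \<sigma>) is" "\<And>i. i \<in> set is \<Longrightarrow> jump_free i"
  shows "(step P ^^ length is) \<sigma> = fold exec is \<sigma>"
  using assms
proof (induction "is" arbitrary: \<sigma>)
  case (Cons i js)
  then have "code_at P (pc \<sigma>) [i]" "code_at P (Suc (pc \<sigma>)) js"
    using code_at_Cons by blast+
  then have "step P \<sigma> = exec i \<sigma>" "code_at P (pc (exec i \<sigma>)) js"
    using Cons.prems(2) by (simp_all add: step_code_at pc_exec)
  then show ?case using Cons by (simp add: funpow_swap1)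
qed simp

lemma fold_replicate_Add:
  "r \<noteq> q \<Longrightarrow> let \<sigma>' = fold exec (replicate m (Add r r q)) \<sigma> in
     reg \<sigma>' = (reg \<sigma>)(r := reg \<sigma> r + m * reg \<sigma> q) \<and> mem \<sigma>' = mem \<sigma>"
  by (induction m arbitrary: \<sigma>) (auto simp: Let_def)

lemma caddr:
  "reg (fold exec (caddr M j t) \<sigma>) = (reg \<sigma>)(2*t+3 := reg \<sigma> 0 + M * reg \<sigma> (2*t+1) + j)"
  "mem (fold exec (caddr M j t) \<sigma>) = mem \<sigma>"
  using fold_replicate_Add[of "2*t+3" "2*t+1" M "exec (SetConst (2*t+3) j) \<sigma>"]
  by (auto simp: caddr_def Let_def)

lemma rel_cong: "rel M L s \<sigma> \<Longrightarrow> (\<And>r. even r \<Longrightarrow> reg \<sigma>' r = reg \<sigma> r) \<Longrightarrow> mem \<sigma>' = mem \<sigma> \<Longrightarrow> rel M L s \<sigma>'"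
  by (simp add: rel_def)

text \<open>Preservation of the registers below \<open>2*t+1\<close> keeps the left operand intact
  while the right one is evaluated one level higher.\<close>

lemma cexp:
  assumes "rel M L s \<sigma>" "wf_exp M e"
  shows "reg (fold exec (cexp M e t) \<sigma>) (2*t+1) = val e s \<and>
     (\<forall>r. even r \<or> r < 2*t+1 \<longrightarrow> reg (fold exec (cexp M e t) \<sigma>) r = reg \<sigma> r) \<and>
     mem (fold exec (cexp M e t) \<sigma>) = mem \<sigma>"
  using assms
proof (induction e arbitrary: t \<sigma>)
  case (ESum e1 e2)
  let ?\<sigma> = "fold exec (cexp M e1 t) \<sigma>"
  let ?\<tau> = "fold exec (cexp M e2 (Suc t)) ?\<sigma>"
  from ESum.prems(2) have wf: "wf_exp M e1" "wf_exp M e2" by simp_all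
  note 1 = ESum.IH(1)[OF ESum.prems(1) wf(1), of t]
  then have "rel M L s ?\<sigma>" using rel_cong[OF ESum.prems(1)] by blast
  note 2 = ESum.IH(2)[OF this wf(2), of "Suc t"]
  have "reg ?\<tau> (2*t+1) = val e1 s" "reg ?\<tau> (2*t+3) = val e2 s" "mem ?\<tau> = mem \<sigma>"
    using 1 2 by (simp_all add: numeral_3_eq_3)
  moreover have "reg ?\<tau> r = reg \<sigma> r" if "even r \<or> r < 2*t+1" for r
  proof -
    have "reg ?\<tau> r = reg ?\<sigma> r" using 2 that by (metis less_SucI mult_Suc_right add_2_eq_Suc add_Suc)
    then show ?thesis using 1 that by metis
  qed
  ultimately show ?case by auto
next
  case (EDiff e1 e2)
  let ?\<sigma> = "fold exec (cexp M e1 t) \<sigma>"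
  let ?\<tau> = "fold exec (cexp M e2 (Suc t)) ?\<sigma>"
  from EDiff.prems(2) have wf: "wf_exp M e1" "wf_exp M e2" by simp_all
  note 1 = EDiff.IH(1)[OF EDiff.prems(1) wf(1), of t]
  then have "rel M L s ?\<sigma>" using rel_cong[OF EDiff.prems(1)] by blast
  note 2 = EDiff.IH(2)[OF this wf(2), of "Suc t"]
  have "reg ?\<tau> (2*t+1) = val e1 s" "reg ?\<tau> (2*t+3) = val e2 s" "mem ?\<tau> = mem \<sigma>"
    using 1 2 by (simp_all add: numeral_3_eq_3)
  moreover have "reg ?\<tau> r = reg \<sigma> r" if "even r \<or> r < 2*t+1" for r
  proof -
    have "reg ?\<tau> r = reg ?\<sigma> r" using 2 that by (metis less_SucI mult_Suc_right add_2_eq_Suc add_Suc)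
    then show ?thesis using 1 that by metis
  qed
  ultimately show ?case by auto
next
  case (EArr j e)
  let ?\<sigma> = "fold exec (cexp M e t) \<sigma>"
  from EArr.prems(2) have wf: "wf_exp M e" "j < M" by simp_all
  note 1 = EArr.IH[OF EArr.prems(1) wf(1), of t]
  then have r: "reg ?\<sigma> (2*t+1) = val e s" "reg ?\<sigma> 0 = reg \<sigma> 0" "mem ?\<sigma> = mem \<sigma>"
    by simp_all
  have "reg \<sigma> 0 = L" "mem \<sigma> (L + M * val e s + j) = arr s j (val e s)"
    using EArr.prems(1) wf(2) by (simp_all add: rel_def)
  then show ?case using 1 r by (simp add: caddr)
next
  case (EVar x)
  have "Suc (2 * x) \<noteq> 2 * t" by presburger
  then show ?case using EVar by (auto simp: rel_def)
qed simp

lemma run_cexp: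
  assumes "rel M L s \<sigma>" "wf_exp M e" "code_at P (pc \<sigma>) (cexp M e t)"
  obtains \<sigma>' where "(step P ^^ elen M e) \<sigma> = \<sigma>'" "rel M L s \<sigma>'" "pc \<sigma>' = pc \<sigma> + elen M e"
    "reg \<sigma>' (2*t+1) = val e s" "\<And>r. r < 2*t+1 \<Longrightarrow> reg \<sigma>' r = reg \<sigma> r" "mem \<sigma>' = mem \<sigma>"
proof (rule that)
  show "(step P ^^ elen M e) \<sigma> = fold exec (cexp M e t) \<sigma>"
    using steps_straight[OF assms(3)] jump_free_cexp by (metis length_cexp)
  show "pc (fold exec (cexp M e t) \<sigma>) = pc \<sigma> + elen M e"
    using pc_fold_exec[of "cexp M e t"] jump_free_cexp by (metis length_cexp)
qed (use cexp[OF assms(1,2)] rel_cong[OF assms(1)] in auto)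

lemma address_inj:
  fixes M i i' j j' :: nat
  assumes "j < M" "j' < M" "M * i + j = M * i' + j'"
  shows "i = i' \<and> j = j'"
proof -
  have "(M * i + j) div M = (M * i' + j') div M" "(M * i + j) mod M = (M * i' + j') mod M"
    using assms(3) by simp_all
  then show ?thesis using assms(1,2) by (simp add: mult.commute[of M])
qed

lemma funpow_add_apply: "(f ^^ m) x = y \<Longrightarrow> (f ^^ n) y = z \<Longrightarrow> (f ^^ (m + n)) x = z"
  by (metis add.commute comp_apply funpow_add)

lemma compile_correct:
  assumes "big M L c s t s'" "wf_com M c" "rel M L s \<sigma>" "code_at P (pc \<sigma>) (ccom M c (pc \<sigma>))"
  shows "\<exists>\<sigma>'. (step P ^^ t) \<sigma> = \<sigma>' \<and> rel M L s' \<sigma>' \<and> pc \<sigma>' = pc \<sigma> + clen M c"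
  using assms
proof (induction arbitrary: \<sigma> rule: big.induct)
  case (Skip s)
  then show ?case by simp
next
  case (Assign x e s)
  then have code: "code_at P (pc \<sigma>) (cexp M e 0)"
    "code_at P (pc \<sigma> + elen M e) [SetConst (2*x+2) 0, Add (2*x+2) (2*x+2) 1]"
    by (simp_all add: code_at_append)
  obtain \<sigma>1 where 1: "(step P ^^ elen M e) \<sigma> = \<sigma>1" "rel M L s \<sigma>1" "pc \<sigma>1 = pc \<sigma> + elen M e"
    "reg \<sigma>1 1 = val e s"
    using run_cexp[OF _ _ code(1)] Assign by (metis mult_0_right plus_nat.add_0 wf_com.simps(2))
  have jf: "i \<in> set [SetConst (2*x+2) 0, Add (2*x+2) (2*x+2) 1] \<Longrightarrow> jump_free i" for i by auto
  have "(step P ^^ 2) \<sigma>1 = fold exec [SetConst (2*x+2) 0, Add (2*x+2) (2*x+2) 1] \<sigma>1"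
    using steps_straight[of P \<sigma>1 "[SetConst (2*x+2) 0, Add (2*x+2) (2*x+2) 1]", OF _ jf] code(2) 1(3)
    by (simp add: numeral_2_eq_2)
  from funpow_add_apply[OF 1(1) this] show ?case
    using 1 by (auto simp: rel_def)
next
  case (SetArr j e e' s)
  then have code: "code_at P (pc \<sigma>) (cexp M e' 0)" "code_at P (pc \<sigma> + elen M e') (cexp M e 1)"
    "code_at P (pc \<sigma> + elen M e' + elen M e) (caddr M j 1 @ [Store 5 1])"
    by (simp_all add: code_at_append add.assoc)
  obtain \<sigma>1 where 1: "(step P ^^ elen M e') \<sigma> = \<sigma>1" "rel M L s \<sigma>1" "pc \<sigma>1 = pc \<sigma> + elen M e'"
    "reg \<sigma>1 1 = val e' s"
    using run_cexp[OF _ _ code(1)] SetArr by (metis mult_0_right plus_nat.add_0 wf_com.simps(3))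
  have "wf_exp M e" "code_at P (pc \<sigma>1) (cexp M e 1)" using SetArr.prems(1) code(2) 1(3) by simp_all
  from run_cexp[OF 1(2) this] obtain \<sigma>2 where
    2: "(step P ^^ elen M e) \<sigma>1 = \<sigma>2" "rel M L s \<sigma>2" "pc \<sigma>2 = pc \<sigma>1 + elen M e"
    "reg \<sigma>2 (2*1+1) = val e s" "\<And>r. r < 2*1+1 \<Longrightarrow> reg \<sigma>2 r = reg \<sigma>1 r" by metis
  have 2: "(step P ^^ elen M e) \<sigma>1 = \<sigma>2" "rel M L s \<sigma>2" "pc \<sigma>2 = pc \<sigma>1 + elen M e"
    "reg \<sigma>2 3 = val e s" "reg \<sigma>2 1 = val e' s"
    using 2(1-4) 2(5)[of 1] 1(4) by (simp_all add: numeral_3_eq_3)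
  let ?is = "caddr M j 1 @ [Store 5 1]"
  have jf: "i \<in> set ?is \<Longrightarrow> jump_free i" for i by (auto dest: jump_free_caddr)
  have "(step P ^^ length ?is) \<sigma>2 = fold exec ?is \<sigma>2"
    using steps_straight[of P \<sigma>2 ?is, OF _ jf] code(3) 1(3) 2(3) by simp
  moreover have "length ?is = M + 3" by (simp add: caddr_def)
  ultimately have 3: "(step P ^^ (M + 3)) \<sigma>2 = fold exec ?is \<sigma>2" by (simp only:)
  have reg: "reg (fold exec (caddr M j 1) \<sigma>2) = (reg \<sigma>2)(5 := L + M * val e s + j)"
    using caddr(1)[of M j 1 \<sigma>2] 2(2,4) by (simp add: rel_def eval_nat_numeral)
  define \<sigma>3 where "\<sigma>3 = fold exec ?is \<sigma>2"
  have reg': "reg \<sigma>3 = (reg \<sigma>2)(5 := L + M * val e s + j)"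
    and mem': "mem \<sigma>3 = (mem \<sigma>2)(L + M * val e s + j := val e' s)"
    using 2(5) reg caddr(2)[of M j 1 \<sigma>2] by (simp_all add: \<sigma>3_def)
  have "j < M" using SetArr.prems(1) by simp
  \<comment> \<open>Distinct array cells have distinct interleaved addresses, so the store changes
    exactly one of them.\<close>
  have upd: "mem \<sigma>3 (L + M * i + j') =
      ((arr s)(j := (arr s j)(val e s := val e' s))) j' i" if "j' < M" for i j'
  proof (cases "j' = j \<and> i = val e s")
    case False
    then have "L + M * i + j' \<noteq> L + M * val e s + j"
      using address_inj[OF that \<open>j < M\<close>, of i "val e s"] by fastforce
    moreover have "mem \<sigma>2 (L + M * i + j') = arr s j' i" using 2(2) that by (simp add: rel_def)
    ultimately show ?thesis using False by (auto simp: mem')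
  qed (simp add: mem')
  have "reg \<sigma>3 0 = L" "reg \<sigma>3 (2*x+2) = var s x" "a < L \<Longrightarrow> mem \<sigma>3 a = inp s a" for x a
  proof -
    have "2 * x + 2 \<noteq> (5 :: nat)" by presburger
    then show "reg \<sigma>3 0 = L" "reg \<sigma>3 (2*x+2) = var s x" "a < L \<Longrightarrow> mem \<sigma>3 a = inp s a"
      using 2(2) unfolding rel_def reg' mem' by auto
  qed
  with upd have "rel M L (s\<lparr>arr := (arr s)(j := (arr s j)(val e s := val e' s))\<rparr>) \<sigma>3"
    by (simp add: rel_def)
  moreover have "pc \<sigma>3 = pc \<sigma> + clen M (SetArr j e e')"
    using pc_fold_exec[of ?is \<sigma>2, OF jf] 1(3) 2(3) \<open>length ?is = M + 3\<close> by (simp add: \<sigma>3_def)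
  moreover have "(step P ^^ clen M (SetArr j e e')) \<sigma> = \<sigma>3"
    using funpow_add_apply[OF funpow_add_apply[OF 1(1) 2(1)] 3] unfolding \<sigma>3_def[symmetric]
    by (simp add: add.assoc)
  ultimately show ?case by blast
next
  case (Read e s x)
  then have code: "code_at P (pc \<sigma>) (cexp M e 0)"
    "code_at P (pc \<sigma> + elen M e) [Load (2*x+2) 1]"
    by (simp_all add: code_at_append)
  obtain \<sigma>1 where 1: "(step P ^^ elen M e) \<sigma> = \<sigma>1" "rel M L s \<sigma>1" "pc \<sigma>1 = pc \<sigma> + elen M e"
    "reg \<sigma>1 1 = val e s"
    using run_cexp[OF _ _ code(1)] Read by (metis mult_0_right plus_nat.add_0 wf_com.simps(4))
  have "(step P ^^ 1) \<sigma>1 = exec (Load (2*x+2) 1) \<sigma>1"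
    using step_code_at[of P \<sigma>1] code(2) 1(3) by simp
  from funpow_add_apply[OF 1(1) this] show ?case
    using 1 Read.hyps by (auto simp: rel_def)
next
  case (Write e s e')
  then have code: "code_at P (pc \<sigma>) (cexp M e' 0)" "code_at P (pc \<sigma> + elen M e') (cexp M e 1)"
    "code_at P (pc \<sigma> + elen M e' + elen M e) [Store 3 1]"
    by (simp_all add: code_at_append add.assoc)
  obtain \<sigma>1 where 1: "(step P ^^ elen M e') \<sigma> = \<sigma>1" "rel M L s \<sigma>1" "pc \<sigma>1 = pc \<sigma> + elen M e'"
    "reg \<sigma>1 1 = val e' s"
    using run_cexp[OF _ _ code(1)] Write by (metis mult_0_right plus_nat.add_0 wf_com.simps(5))
  have "wf_exp M e" "code_at P (pc \<sigma>1) (cexp M e 1)" using Write.prems(1) code(2) 1(3) by simp_all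
  from run_cexp[OF 1(2) this] obtain \<sigma>2 where
    2: "(step P ^^ elen M e) \<sigma>1 = \<sigma>2" "rel M L s \<sigma>2" "pc \<sigma>2 = pc \<sigma>1 + elen M e"
    "reg \<sigma>2 (2*1+1) = val e s" "\<And>r. r < 2*1+1 \<Longrightarrow> reg \<sigma>2 r = reg \<sigma>1 r" by metis
  have 2: "(step P ^^ elen M e) \<sigma>1 = \<sigma>2" "rel M L s \<sigma>2" "pc \<sigma>2 = pc \<sigma>1 + elen M e"
    "reg \<sigma>2 3 = val e s" "reg \<sigma>2 1 = val e' s"
    using 2(1-4) 2(5)[of 1] 1(4) by (simp_all add: numeral_3_eq_3)
  have 3: "(step P ^^ 1) \<sigma>2 = exec (Store 3 1) \<sigma>2"
    using step_code_at[of P \<sigma>2] code(3) 1(3) 2(3) by simp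
  from funpow_add_apply[OF funpow_add_apply[OF 1(1) 2(1)] 3] show ?case
    using 1 2 Write.hyps by (auto simp: rel_def)
next
  case (Seq c s t s' d t' s'')
  then have code: "code_at P (pc \<sigma>) (ccom M c (pc \<sigma>))"
    "code_at P (pc \<sigma> + clen M c) (ccom M d (pc \<sigma> + clen M c))"
    by (simp_all add: code_at_append)
  obtain \<sigma>1 where 1: "(step P ^^ t) \<sigma> = \<sigma>1" "rel M L s' \<sigma>1" "pc \<sigma>1 = pc \<sigma> + clen M c"
    using Seq.IH(1)[OF _ Seq.prems(2) code(1)] Seq.prems(1) by auto
  obtain \<sigma>2 where 2: "(step P ^^ t') \<sigma>1 = \<sigma>2" "rel M L s'' \<sigma>2" "pc \<sigma>2 = pc \<sigma>1 + clen M d"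
    using Seq.IH(2)[OF _ 1(2)] Seq.prems(1) code(2) 1(3) by auto
  show ?case using funpow_add_apply[OF 1(1) 2(1)] 1(3) 2 by auto
next
  case (CondTrue e s c t s' d)
  let ?l = "pc \<sigma> + elen M e"
  have code: "code_at P (pc \<sigma>) (cexp M e 0)" "code_at P ?l [JumpZero 1 (?l + clen M c + 3)]"
    "code_at P (Suc ?l) (ccom M c (Suc ?l))" "code_at P (Suc ?l + clen M c) [SetConst 1 0]"
    "code_at P (Suc (Suc ?l + clen M c)) [JumpZero 1 (?l + clen M c + clen M d + 3)]"
    using CondTrue.prems(3) by (simp_all add: code_at_append code_at_Cons[of _ _ _ "_ # _"] code_at_Cons[of _ _ _ "_ @ _"] code_at_Cons[of _ _ _ "ccom _ _ _"] add_ac)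
  obtain \<sigma>1 where 1: "(step P ^^ elen M e) \<sigma> = \<sigma>1" "rel M L s \<sigma>1" "pc \<sigma>1 = ?l" "reg \<sigma>1 1 = val e s"
    using run_cexp[OF _ _ code(1)] CondTrue by (metis mult_0_right plus_nat.add_0 wf_com.simps(7))
  define \<sigma>2 where "\<sigma>2 = exec (JumpZero 1 (?l + clen M c + 3)) \<sigma>1"
  have 2: "(step P ^^ 1) \<sigma>1 = \<sigma>2" "rel M L s \<sigma>2" "pc \<sigma>2 = Suc ?l"
    using step_code_at[of P \<sigma>1] code(2) 1 CondTrue.hyps by (simp_all add: \<sigma>2_def rel_def)
  obtain \<sigma>3 where 3: "(step P ^^ t) \<sigma>2 = \<sigma>3" "rel M L s' \<sigma>3" "pc \<sigma>3 = Suc ?l + clen M c"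
    using CondTrue.IH[OF _ 2(2)] CondTrue.prems(1) code(3) 2(3) by auto
  define \<sigma>4 where "\<sigma>4 = exec (SetConst 1 0) \<sigma>3"
  have 4: "(step P ^^ 1) \<sigma>3 = \<sigma>4" "rel M L s' \<sigma>4" "pc \<sigma>4 = Suc (Suc ?l + clen M c)" "reg \<sigma>4 1 = 0"
    using step_code_at[of P \<sigma>3] code(4) 3 by (simp_all add: \<sigma>4_def rel_def)
  define \<sigma>5 where "\<sigma>5 = exec (JumpZero 1 (?l + clen M c + clen M d + 3)) \<sigma>4"
  have 5: "(step P ^^ 1) \<sigma>4 = \<sigma>5" "rel M L s' \<sigma>5" "pc \<sigma>5 = ?l + clen M c + clen M d + 3"
    using step_code_at[of P \<sigma>4] code(5) 4 by (simp_all add: \<sigma>5_def rel_def)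
  have "(step P ^^ (elen M e + 1 + t + 1 + 1)) \<sigma> = \<sigma>5"
    by (intro funpow_add_apply) (rule 1(1) 2(1) 3(1) 4(1) 5(1))+
  then show ?case using 5 by (simp add: numeral_2_eq_2)
next
  case (CondFalse e s d t s' c)
  let ?l = "pc \<sigma> + elen M e"
  have code: "code_at P (pc \<sigma>) (cexp M e 0)" "code_at P ?l [JumpZero 1 (?l + clen M c + 3)]"
    "code_at P (?l + clen M c + 3) (ccom M d (?l + clen M c + 3))"
    using CondFalse.prems(3) by (simp_all add: code_at_append code_at_Cons[of _ _ _ "_ # _"] code_at_Cons[of _ _ _ "_ @ _"] code_at_Cons[of _ _ _ "ccom _ _ _"] add_ac eval_nat_numeral)
  obtain \<sigma>1 where 1: "(step P ^^ elen M e) \<sigma> = \<sigma>1" "rel M L s \<sigma>1" "pc \<sigma>1 = ?l" "reg \<sigma>1 1 = val e s"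
    using run_cexp[OF _ _ code(1)] CondFalse by (metis mult_0_right plus_nat.add_0 wf_com.simps(7))
  define \<sigma>2 where "\<sigma>2 = exec (JumpZero 1 (?l + clen M c + 3)) \<sigma>1"
  have 2: "(step P ^^ 1) \<sigma>1 = \<sigma>2" "rel M L s \<sigma>2" "pc \<sigma>2 = ?l + clen M c + 3"
    using step_code_at[of P \<sigma>1] code(2) 1 CondFalse.hyps by (simp_all add: \<sigma>2_def rel_def)
  obtain \<sigma>3 where 3: "(step P ^^ t) \<sigma>2 = \<sigma>3" "rel M L s' \<sigma>3" "pc \<sigma>3 = ?l + clen M c + 3 + clen M d"
    using CondFalse.IH[OF _ 2(2)] CondFalse.prems(1) code(3) 2(3) by auto
  have "(step P ^^ (elen M e + 1 + t)) \<sigma> = \<sigma>3"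
    by (intro funpow_add_apply) (rule 1(1) 2(1) 3(1))+
  then show ?case using 3 by simp
next
  case (WhileFalse e s c)
  let ?l = "pc \<sigma> + elen M e"
  have code: "code_at P (pc \<sigma>) (cexp M e 0)" "code_at P ?l [JumpZero 1 (?l + clen M c + 3)]"
    using WhileFalse.prems(3) by (simp_all add: code_at_append code_at_Cons[of _ _ _ "_ # _"] code_at_Cons[of _ _ _ "_ @ _"] code_at_Cons[of _ _ _ "ccom _ _ _"] add_ac)
  obtain \<sigma>1 where 1: "(step P ^^ elen M e) \<sigma> = \<sigma>1" "rel M L s \<sigma>1" "pc \<sigma>1 = ?l" "reg \<sigma>1 1 = val e s"
    using run_cexp[OF _ _ code(1)] WhileFalse by (metis mult_0_right plus_nat.add_0 wf_com.simps(8))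
  define \<sigma>2 where "\<sigma>2 = exec (JumpZero 1 (?l + clen M c + 3)) \<sigma>1"
  have 2: "(step P ^^ 1) \<sigma>1 = \<sigma>2" "rel M L s \<sigma>2" "pc \<sigma>2 = ?l + clen M c + 3"
    using step_code_at[of P \<sigma>1] code(2) 1 WhileFalse.hyps by (simp_all add: \<sigma>2_def rel_def)
  show ?case using funpow_add_apply[OF 1(1) 2(1)] 2 by simp
next
  case (WhileTrue e s c t s' t' s'')
  let ?l = "pc \<sigma> + elen M e"
  have code: "code_at P (pc \<sigma>) (cexp M e 0)" "code_at P ?l [JumpZero 1 (?l + clen M c + 3)]"
    "code_at P (Suc ?l) (ccom M c (Suc ?l))" "code_at P (Suc ?l + clen M c) [SetConst 1 0]"
    "code_at P (Suc (Suc ?l + clen M c)) [JumpZero 1 (pc \<sigma>)]"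
    using WhileTrue.prems(3) by (simp_all add: code_at_append code_at_Cons[of _ _ _ "_ # _"] code_at_Cons[of _ _ _ "_ @ _"] code_at_Cons[of _ _ _ "ccom _ _ _"] add_ac)
  obtain \<sigma>1 where 1: "(step P ^^ elen M e) \<sigma> = \<sigma>1" "rel M L s \<sigma>1" "pc \<sigma>1 = ?l" "reg \<sigma>1 1 = val e s"
    using run_cexp[OF _ _ code(1)] WhileTrue by (metis mult_0_right plus_nat.add_0 wf_com.simps(8))
  define \<sigma>2 where "\<sigma>2 = exec (JumpZero 1 (?l + clen M c + 3)) \<sigma>1"
  have 2: "(step P ^^ 1) \<sigma>1 = \<sigma>2" "rel M L s \<sigma>2" "pc \<sigma>2 = Suc ?l"
    using step_code_at[of P \<sigma>1] code(2) 1 WhileTrue.hyps by (simp_all add: \<sigma>2_def rel_def)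
  obtain \<sigma>3 where 3: "(step P ^^ t) \<sigma>2 = \<sigma>3" "rel M L s' \<sigma>3" "pc \<sigma>3 = Suc ?l + clen M c"
    using WhileTrue.IH(1)[OF _ 2(2)] WhileTrue.prems(1) code(3) 2(3) by auto
  define \<sigma>4 where "\<sigma>4 = exec (SetConst 1 0) \<sigma>3"
  have 4: "(step P ^^ 1) \<sigma>3 = \<sigma>4" "rel M L s' \<sigma>4" "pc \<sigma>4 = Suc (Suc ?l + clen M c)" "reg \<sigma>4 1 = 0"
    using step_code_at[of P \<sigma>3] code(4) 3 by (simp_all add: \<sigma>4_def rel_def)
  define \<sigma>5 where "\<sigma>5 = exec (JumpZero 1 (pc \<sigma>)) \<sigma>4"
  have 5: "(step P ^^ 1) \<sigma>4 = \<sigma>5" "rel M L s' \<sigma>5" "pc \<sigma>5 = pc \<sigma>"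
    using step_code_at[of P \<sigma>4] code(5) 4 by (simp_all add: \<sigma>5_def rel_def)
  obtain \<sigma>6 where 6: "(step P ^^ t') \<sigma>5 = \<sigma>6" "rel M L s'' \<sigma>6" "pc \<sigma>6 = pc \<sigma> + clen M (While e c)"
    using WhileTrue.IH(2)[OF WhileTrue.prems(1) 5(2)] WhileTrue.prems(3) 5(3) by auto
  have "(step P ^^ (elen M e + 1 + t + 1 + 1 + t')) \<sigma> = \<sigma>6"
    by (intro funpow_add_apply) (rule 1(1) 2(1) 3(1) 4(1) 5(1) 6(1))+
  then show ?case using 6 by (simp add: numeral_2_eq_2)
qed

text \<open>The prologue leaves \<open>2 + k * n\<close>, the length of an encoded graph, in
  register 0: it loads \<open>n\<close> from cell 0 and adds it \<open>k\<close> times to 2. It has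
  \<open>k + 3\<close> instructions, whence the start address of the body.\<close>

definition program :: "nat \<Rightarrow> nat \<Rightarrow> com \<Rightarrow> instr list" where
  "program k M c = [SetConst 1 0, Load 1 1, SetConst 0 2] @ replicate k (Add 0 0 1) @ ccom M c (k + 3)"

definition initial_store :: "nat list \<Rightarrow> store" where
  "initial_store xs = \<lparr> var = \<lambda>_. 0, arr = \<lambda>_ _. 0, inp = \<lambda>i. if i < length xs then xs ! i else 0 \<rparr>"

lemma program_correct:
  assumes c: "big M (length xs) c (initial_store xs) t s'" "wf_com M c"
    and len: "length xs = 2 + k * xs ! 0"
  shows "\<exists>\<sigma>. (step (program k M c) ^^ (k + 3 + t)) (initial xs) = \<sigma> \<and> halted (program k M c) \<sigma> \<and>
    (\<forall>i < length xs. mem \<sigma> i = inp s' i)"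
proof -
  let ?P = "program k M c" and ?is = "[SetConst 1 0, Load 1 1, SetConst 0 2] @ replicate k (Add 0 0 1)"
  let ?\<sigma> = "fold exec ?is (initial xs)"
  have jf: "i \<in> set ?is \<Longrightarrow> jump_free i" for i by (auto split: if_splits)
  have P: "?P = ?is @ ccom M c (k + 3)" by (simp add: program_def)
  have "code_at ?P (pc (initial xs)) ?is"
    unfolding code_at_def P by (intro exI[of _ "[]"] exI[of _ "ccom M c (k + 3)"]) (simp add: initial_def)
  from steps_straight[OF this jf] have 1: "(step ?P ^^ (k + 3)) (initial xs) = ?\<sigma>"
    by (simp add: numeral_3_eq_3)
  have pc: "pc ?\<sigma> = k + 3"
    using pc_fold_exec[of ?is "initial xs", OF jf] by (simp add: initial_def)
  have "0 < length xs" using len by simp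
  have "rel M (length xs) (initial_store xs) ?\<sigma>"
    using fold_replicate_Add[of 0 1 k "fold exec [SetConst 1 0, Load 1 1, SetConst 0 2] (initial xs)"]
      len \<open>0 < length xs\<close>
    by (simp add: rel_def initial_store_def Let_def) (simp add: initial_def)
  moreover have "code_at ?P (pc ?\<sigma>) (ccom M c (pc ?\<sigma>))"
    unfolding code_at_def P pc by (intro exI[of _ ?is] exI[of _ "[]"]) simp
  ultimately obtain \<sigma>' where 2: "(step ?P ^^ t) ?\<sigma> = \<sigma>'" "rel M (length xs) s' \<sigma>'" "pc \<sigma>' = k + 3 + clen M c"
    using compile_correct[OF c] pc by metis
  have "halted ?P \<sigma>'" using 2(3) by (simp add: halted_def program_def)
  then show ?thesis using funpow_add_apply[OF 1 2(1)] 2(2) by (auto simp: rel_def)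
qed

section \<open>Weakest preconditions and timed Hoare triples\<close>

text \<open>Meant for loop-free code only, where each instruction runs at most once and the time
  bound is the code length. Loops get \<open>False\<close> and are treated by triples.\<close>

fun wp :: "nat \<Rightarrow> com \<Rightarrow> (store \<Rightarrow> bool) \<Rightarrow> store \<Rightarrow> bool" where
  "wp L Skip Q s = Q s"
| "wp L (Assign x e) Q s = Q (s\<lparr>var := (var s)(x := val e s)\<rparr>)"
| "wp L (SetArr j e e') Q s = Q (s\<lparr>arr := (arr s)(j := (arr s j)(val e s := val e' s))\<rparr>)"
| "wp L (Read x e) Q s = (val e s < L \<and> Q (s\<lparr>var := (var s)(x := inp s (val e s))\<rparr>))"
| "wp L (Write e e') Q s = (val e s < L \<and> Q (s\<lparr>inp := (inp s)(val e s := val e' s)\<rparr>))"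
| "wp L (c ;; d) Q s = wp L c (wp L d Q) s"
| "wp L (Cond e c d) Q s = (if val e s \<noteq> 0 then wp L c Q s else wp L d Q s)"
| "wp L (While e c) Q s = False"

lemma wp_big:
  "wp L c Q s \<Longrightarrow> \<exists>t s'. big M L c s t s' \<and> t \<le> clen M c \<and> Q s'"
proof (induction c arbitrary: Q s)
  case (Seq c d)
  then obtain t s' where 1: "big M L c s t s'" "t \<le> clen M c" "wp L d Q s'" by fastforce
  then obtain t' s'' where "big M L d s' t' s''" "t' \<le> clen M d" "Q s''" using Seq.IH(2) by blast
  then show ?case using 1 by (fastforce intro: big.Seq)
next
  case (Cond e c d)
  show ?case
  proof (cases "val e s = 0")
    case True
    then obtain t s' where "big M L d s t s'" "t \<le> clen M d" "Q s'" using Cond by fastforce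
    then show ?thesis using big.CondFalse[OF True, of M L d t s' c] by fastforce
  next
    case False
    then obtain t s' where "big M L c s t s'" "t \<le> clen M c" "Q s'" using Cond by fastforce
    then show ?thesis using big.CondTrue[OF False, of M L c t s' d] by fastforce
  qed
next
  case Skip
  then show ?case by (metis big.Skip le0 wp.simps(1))
next
  case (Assign x e)
  then show ?case by (metis big.Assign order_refl wp.simps(2))
next
  case (SetArr j e e')
  then show ?case by (metis big.SetArr order_refl wp.simps(3))
next
  case (Read x e)
  then show ?case by (metis big.Read order_refl wp.simps(4))
next
  case (Write e e')
  then show ?case by (metis big.Write order_refl wp.simps(5))
qed simp

lemma wp_mono: "wp L c Q s \<Longrightarrow> (\<And>s. Q s \<Longrightarrow> R s) \<Longrightarrow> wp L c R s"
proof (induction c arbitrary: Q R s)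
  case (Seq c d)
  have "wp L d Q s \<Longrightarrow> wp L d R s" for s using Seq.IH(2)[of Q s R] Seq.prems(2) by blast
  then show ?case using Seq.IH(1)[of "wp L d Q" s "wp L d R"] Seq.prems(1) by simp
next
  case (Cond e c d)
  have "wp L c Q s \<Longrightarrow> wp L c R s" "wp L d Q s \<Longrightarrow> wp L d R s"
    using Cond.IH[OF _ Cond.prems(2)] by simp_all
  then show ?case using Cond.prems(1) by (cases "val e s = 0") simp_all
qed simp_all

text \<open>Serves to unroll loops over letters, whose number is fixed with the program.\<close>

definition seqs :: "com list \<Rightarrow> com" where
  "seqs cs = foldr Seq cs Skip"

lemma wp_seqs:
  assumes "\<And>j s. j < k \<Longrightarrow> I j s \<Longrightarrow> wp L (f j) (I (Suc j)) s" "I 0 s"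
  shows "wp L (seqs (map f [0..<k])) (I k) s"
proof -
  have "wp L (foldr Seq (map f [i..<k]) Skip) (I k) s" if "i \<le> k" "I i s" for i
    using that
  proof (induction "k - i" arbitrary: i s)
    case (Suc m)
    then have "[i..<k] = i # [Suc i..<k]" by (simp add: upt_conv_Cons)
    moreover have "wp L (f i) (I (Suc i)) s" using Suc assms(1) by simp
    ultimately show ?case using Suc by (auto elim!: wp_mono)
  qed simp
  from this[of 0] show ?thesis using assms(2) by (simp add: seqs_def)
qed

lemma wf_com_seqs [simp]: "wf_com M (seqs cs) \<longleftrightarrow> (\<forall>c \<in> set cs. wf_com M c)"
  by (induction cs) (simp_all add: seqs_def)

text \<open>
  \<open>B\<close> bounds how often each single instruction of the compiled code is executed; this makes
  the bounds of composed programs easy to combine.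
\<close>

definition triple :: "nat \<Rightarrow> nat \<Rightarrow> (store \<Rightarrow> bool) \<Rightarrow> com \<Rightarrow> nat \<Rightarrow> (store \<Rightarrow> bool) \<Rightarrow> bool" where
  "triple M L P c B Q \<longleftrightarrow> (\<forall>s. P s \<longrightarrow> (\<exists>t s'. big M L c s t s' \<and> t \<le> clen M c * B \<and> Q s'))"

lemma triple_wp:
  assumes "\<And>s. P s \<Longrightarrow> wp L c Q s" "1 \<le> B"
  shows "triple M L P c B Q"
  unfolding triple_def
proof (intro allI impI)
  fix s assume "P s"
  then obtain t s' where "big M L c s t s'" "t \<le> clen M c" "Q s'" using wp_big[OF assms(1)] by blast
  moreover have "clen M c \<le> clen M c * B" using assms(2) by simp
  ultimately show "\<exists>t s'. big M L c s t s' \<and> t \<le> clen M c * B \<and> Q s'"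
    using le_trans by blast
qed

lemma triple_conseq:
  assumes "triple M L P c B Q" "\<And>s. P' s \<Longrightarrow> P s" "\<And>s. Q s \<Longrightarrow> Q' s" "B \<le> B'"
  shows "triple M L P' c B' Q'"
  using assms unfolding triple_def by (meson le_trans mult_le_mono2)

lemma triple_seq:
  assumes "triple M L P c B R" "triple M L R d B Q"
  shows "triple M L P (c ;; d) B Q"
  unfolding triple_def
proof (intro allI impI)
  fix s assume "P s"
  then obtain t s' where 1: "big M L c s t s'" "t \<le> clen M c * B" "R s'"
    using assms(1) unfolding triple_def by blast
  then obtain t' s'' where 2: "big M L d s' t' s''" "t' \<le> clen M d * B" "Q s''"
    using assms(2) unfolding triple_def by blast
  show "\<exists>t s'. big M L (c ;; d) s t s' \<and> t \<le> clen M (c ;; d) * B \<and> Q s'"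
    using big.Seq[OF 1(1) 2(1)] 1 2 by (intro exI[of _ "t + t'"] exI[of _ s'']) (simp add: add_mult_distrib)
qed

lemma triple_cond:
  assumes "triple M L (\<lambda>s. P s \<and> val e s \<noteq> 0) c B Q" "triple M L (\<lambda>s. P s \<and> val e s = 0) d B Q" "1 \<le> B"
  shows "triple M L P (Cond e c d) B Q"
  unfolding triple_def
proof (intro allI impI)
  fix s assume P: "P s"
  have e: "elen M e + 3 \<le> (elen M e + 3) * B" using assms(3) by simp
  show "\<exists>t s'. big M L (Cond e c d) s t s' \<and> t \<le> clen M (Cond e c d) * B \<and> Q s'"
  proof (cases "val e s = 0")
    case True
    then obtain t s' where 1: "big M L d s t s'" "t \<le> clen M d * B" "Q s'"
      using P assms(2) unfolding triple_def by blast
    have "elen M e + 1 + t \<le> clen M (Cond e c d) * B"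
      using e 1(2) by (simp add: add_mult_distrib)
    then show ?thesis using big.CondFalse[OF True 1(1)] 1(3) by blast
  next
    case False
    then obtain t s' where 1: "big M L c s t s'" "t \<le> clen M c * B" "Q s'"
      using P assms(1) unfolding triple_def by blast
    have "elen M e + 1 + t + 2 \<le> clen M (Cond e c d) * B"
      using e 1(2) by (simp add: add_mult_distrib)
    then show ?thesis using big.CondTrue[OF False 1(1)] 1(3) by blast
  qed
qed

text \<open>The measure allows at most \<open>m\<close> passes through the body; the additional unit
  in \<open>Suc m\<close> pays for the final test.\<close>

lemma triple_while:
  assumes body: "\<And>m. triple M L (\<lambda>s. I s \<and> val e s \<noteq> 0 \<and> \<mu> s = m) c B (\<lambda>s. I s \<and> \<mu> s < m)"
    and "1 \<le> B"
  shows "triple M L (\<lambda>s. I s \<and> \<mu> s \<le> m) (While e c) (Suc m * B) (\<lambda>s. I s \<and> val e s = 0)"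
proof -
  have "\<exists>t s'. big M L (While e c) s t s' \<and> t \<le> clen M (While e c) * (Suc (\<mu> s) * B) \<and> I s' \<and> val e s' = 0"
    if "I s" for s
    using that
  proof (induction "\<mu> s" arbitrary: s rule: less_induct)
    case less
    have e: "elen M e + 3 \<le> (elen M e + 3) * B" using assms(2) by simp
    show ?case
    proof (cases "val e s = 0")
      case True
      have "elen M e + 1 \<le> (elen M e + 3 + clen M c) * B" using e by (simp add: add_mult_distrib)
      then have "elen M e + 1 \<le> clen M (While e c) * (Suc (\<mu> s) * B)"
        by (simp add: add.commute add.left_commute algebra_simps)
      then show ?thesis using big.WhileFalse[OF True] True less.prems by blast
    next
      case False
      then obtain t s' where 1: "big M L c s t s'" "t \<le> clen M c * B" "I s'" "\<mu> s' < \<mu> s"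
        using body[of "\<mu> s"] less.prems unfolding triple_def by blast
      obtain t' s'' where 2: "big M L (While e c) s' t' s''"
        "t' \<le> clen M (While e c) * (Suc (\<mu> s') * B)" "I s''" "val e s'' = 0"
        using less.hyps[OF 1(4,3)] by blast
      have "t' \<le> clen M (While e c) * (\<mu> s * B)"
        using 2(2) 1(4) by (meson Suc_leI le_trans mult_le_mono1 mult_le_mono2)
      moreover have "elen M e + 1 + t + 2 \<le> clen M (While e c) * B"
        using e 1(2) by (simp add: add_mult_distrib)
      ultimately have "elen M e + 1 + t + 2 + t' \<le> clen M (While e c) * (Suc (\<mu> s) * B)"
        by (simp add: add_mult_distrib2 del: clen.simps)
      then show ?thesis using big.WhileTrue[OF False 1(1) 2(1)] 2 by blast
    qed
  qed
  then show ?thesis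
    unfolding triple_def by (meson Suc_le_mono le_trans mult_le_mono1 mult_le_mono2)
qed

lemma triple_Ex: "(\<And>x. triple M L (P x) c B Q) \<Longrightarrow> triple M L (\<lambda>s. \<exists>x. P x s) c B Q"
  unfolding triple_def by blast

definition For :: "nat \<Rightarrow> nat \<Rightarrow> com \<Rightarrow> com" where
  "For x y c = Assign x (ENum 0) ;; While (EVar y [-] EVar x) (c ;; Assign x (EVar x [+] ENum 1))"

text \<open>The body is loop-free, so each of the \<open>n\<close> passes executes an instruction at
  most once. The invariant gets the index as the parameter \<open>p\<close> and must be blind to the
  counter variable (\<open>indep\<close>), because the counter is advanced only after the
  body.\<close>

lemma triple_for:
  assumes body: "\<And>p s. p < n \<Longrightarrow> I p s \<Longrightarrow> var s x = p \<Longrightarrow> var s y = n \<Longrightarrow>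
      wp L c (\<lambda>s. I (Suc p) s \<and> var s x = p \<and> var s y = n) s"
    and indep: "\<And>p s v. I p (s\<lparr>var := (var s)(x := v)\<rparr>) \<longleftrightarrow> I p s"
    and xy: "x \<noteq> y" and B: "Suc n \<le> B"
  shows "triple M L (\<lambda>s. I 0 s \<and> var s y = n) (For x y c) B (\<lambda>s. I n s \<and> var s y = n)"
proof -
  define J where "J s \<longleftrightarrow> I (var s x) s \<and> var s y = n \<and> var s x \<le> n" for s
  have "triple M L (\<lambda>s. J s \<and> val (EVar y [-] EVar x) s \<noteq> 0 \<and> n - var s x = m)
      (c ;; Assign x (EVar x [+] ENum 1)) 1 (\<lambda>s. J s \<and> n - var s x < m)" for m
  proof (rule triple_wp)
    fix s assume *: "J s \<and> val (EVar y [-] EVar x) s \<noteq> 0 \<and> n - var s x = m"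
    then have "wp L c (\<lambda>s'. I (Suc (var s x)) s' \<and> var s' x = var s x \<and> var s' y = n) s"
      by (intro body) (auto simp: J_def)
    then show "wp L (c ;; Assign x (EVar x [+] ENum 1)) (\<lambda>s. J s \<and> n - var s x < m) s"
      unfolding wp.simps by (rule wp_mono) (use * xy in \<open>auto simp: J_def indep\<close>)
  qed simp
  from triple_while[OF this, of n]
  have "triple M L (\<lambda>s. J s \<and> n - var s x \<le> n) (While (EVar y [-] EVar x) (c ;; Assign x (EVar x [+] ENum 1)))
    (Suc n * 1) (\<lambda>s. J s \<and> val (EVar y [-] EVar x) s = 0)" by simp
  then show ?thesis unfolding For_def
  proof (intro triple_seq[OF triple_wp])
    show "triple M L (\<lambda>s. J s \<and> var s x = 0) (While (EVar y [-] EVar x) (c ;; Assign x (EVar x [+] ENum 1))) B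
      (\<lambda>s. I n s \<and> var s y = n)"
      by (rule triple_conseq[OF \<open>triple M L (\<lambda>s. J s \<and> n - var s x \<le> n) _ _ _\<close>])
        (use B in \<open>auto simp: J_def\<close>)
  qed (use B xy in \<open>auto simp: J_def indep\<close>)
qed

section \<open>The saturation procedure\<close>

context
  fixes g :: "'v \<Rightarrow> 'w" and \<Delta> :: "('v, 'a) pointed_graph"
  assumes inj: "inj_on g (vertices \<Delta>)"
    and ends: "\<And>p x q. traverses \<Delta> p x q \<Longrightarrow> q \<in> vertices \<Delta>"
begin

lemma traverses_map_graph_inj:
  assumes "p \<in> vertices \<Delta>"
  shows "traverses (map_graph g \<Delta>) (g p) x Q \<longleftrightarrow> (\<exists>q. traverses \<Delta> p x q \<and> Q = g q)"
proof
  assume "traverses (map_graph g \<Delta>) (g p) x Q"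
  then obtain p' q where *: "traverses \<Delta> p' x q" "g p' = g p" "g q = Q"
    by (auto simp: traverses_map_graph)
  then have "p' \<in> vertices \<Delta>" using ends[of q "bar x" p'] by simp
  then have "p' = p" using inj assms *(2) by (auto dest: inj_onD)
  then show "\<exists>q. traverses \<Delta> p x q \<and> Q = g q" using * by auto
qed (auto simp: traverses_map_graph)

lemma labels_path_map_graph_inj:
  assumes "p \<in> vertices \<Delta>" "q \<in> vertices \<Delta>"
  shows "labels_path (map_graph g \<Delta>) (g p) w (g q) \<longleftrightarrow> labels_path \<Delta> p w q"
  using assms(1)
proof (induction w arbitrary: p)
  case Nil
  then show ?case using inj assms(2) by (auto dest: inj_onD)
next
  case (Cons x w)
  then show ?case using ends by (auto simp: traverses_map_graph_inj)
qed

lemma lang_map_graph_inj: "base \<Delta> \<in> vertices \<Delta> \<Longrightarrow> lang A (map_graph g \<Delta>) = lang A \<Delta>"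
  by (simp add: lang_def labels_path_map_graph_inj)

lemma folded_map_graph_inj:
  assumes "folded \<Delta>"
  shows "folded (map_graph g \<Delta>)"
  unfolding folded_def
proof (intro allI impI)
  fix P x Q Q' assume *: "traverses (map_graph g \<Delta>) P x Q" "traverses (map_graph g \<Delta>) P x Q'"
  then obtain p q where "traverses \<Delta> p x q" "g p = P" by (auto simp: traverses_map_graph)
  then have "p \<in> vertices \<Delta>" using ends[of q "bar x" p] by simp
  then show "Q = Q'"
    using * assms traverses_map_graph_inj \<open>g p = P\<close> unfolding folded_def by metis
qed

end

lemma two_le_card_iff:
  "finite X \<Longrightarrow> 2 \<le> card X \<longleftrightarrow> (\<exists>x \<in> X. \<exists>y \<in> X. x \<noteq> y)"
  using card_le_Suc0_iff_eq[of X] by (auto simp: numeral_2_eq_2 not_less_eq_eq[symmetric])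

lemma table_entry_Suc:
  assumes "folded \<Gamma>"
  shows "table_entry \<Gamma> p a = Suc q \<longleftrightarrow> (p, a, q) \<in> edges \<Gamma>"
proof -
  have "(THE q. (p, a, q) \<in> edges \<Gamma>) = q" if "(p, a, q) \<in> edges \<Gamma>" for q
    using that assms by (intro the_equality) (auto simp: folded_iff)
  then show ?thesis by (auto simp: table_entry_def)
qed

lemma concat_rows:
  "length (concat (map (\<lambda>p. map (f p) as) [0..<m])) = length as * m"
  "p < m \<Longrightarrow> j < length as \<Longrightarrow>
    concat (map (\<lambda>p. map (f p) as) [0..<m]) ! (length as * p + j) = f p (as ! j)"
proof -
  show len: "length (concat (map (\<lambda>p. map (f p) as) [0..<m])) = length as * m" for m
    by (induction m) auto
  show "concat (map (\<lambda>p. map (f p) as) [0..<m]) ! (length as * p + j) = f p (as ! j)"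
    if "p < m" "j < length as"
    using that
  proof (induction m)
    case (Suc m)
    show ?case
    proof (cases "p < m")
      case True
      have "length as * p + j < length as * Suc p" using Suc.prems by simp
      also have "\<dots> \<le> length as * m" using True by (intro mult_le_mono2) simp
      finally show ?thesis using Suc True by (simp add: nth_append len)
    next
      case False
      then have "p = m" using Suc.prems by simp
      then show ?thesis using Suc.prems by (simp add: nth_append len)
    qed
  qed simp
qed

lemma encode_graph_nth:
  assumes "card (vertices \<Delta>) = m"
  shows "length (encode_graph as \<Delta>) = 2 + length as * m"
    "encode_graph as \<Delta> ! 0 = m" "encode_graph as \<Delta> ! 1 = base \<Delta>"
    "p < m \<Longrightarrow> j < length as \<Longrightarrow> encode_graph as \<Delta> ! (2 + length as * p + j) = table_entry \<Delta> p (as ! j)"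
  using assms concat_rows[where f = "table_entry \<Delta>" and as = as and m = m] by (simp_all add: encode_graph_def)

lemma encode_graph_index:
  assumes "card (vertices \<Delta>) = m" "i < length (encode_graph as \<Delta>)"
  obtains "i = 0" | "i = 1" | p j where "p < m" "j < length as" "i = 2 + length as * p + j"
proof (cases "i < 2")
  case True
  then show ?thesis using that(1,2) by linarith
next
  case False
  let ?l = "length as"
  have less: "i - 2 < ?l * m" using assms False by (simp add: encode_graph_nth(1))
  then have "0 < ?l" by (cases "?l = 0") auto
  then have "(i - 2) mod ?l < ?l" by simp
  moreover have "(i - 2) div ?l < m" using less by (simp add: less_mult_imp_div_less mult.commute)
  moreover have "i = 2 + ?l * ((i - 2) div ?l) + (i - 2) mod ?l" using False by simp
  ultimately show ?thesis using that(3) by blast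
qed

section \<open>Letters, partitions and tables as data of the program\<close>

locale stallings_input =
  fixes A :: "'a set" and as :: "'a list" and \<Gamma> :: "(nat, 'a) pointed_graph"
    and n :: nat and H :: "'a word set"
  assumes distinct_as: "distinct as" and set_as: "set as = A"
    and H: "subgroup H (free_group A)"
    and st: "stallings_graph A H \<Gamma>" and vertices: "vertices \<Gamma> = {..<n}"
begin

definition k :: nat where "k = length as"

definition letter :: "nat \<Rightarrow> 'a + 'a" where
  "letter x = (if x < k then Inl (as ! x) else Inr (as ! (x - k)))"

definition xbar :: "nat \<Rightarrow> nat" where
  "xbar x = (if x < k then k + x else x - k)"

lemma letter_xbar: "x < 2 * k \<Longrightarrow> letter (xbar x) = bar (letter x) \<and> xbar x < 2 * k"
  by (auto simp: letter_def xbar_def)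

lemma letter_inj: "x < 2 * k \<Longrightarrow> y < 2 * k \<Longrightarrow> letter x = letter y \<longleftrightarrow> x = y"
  using distinct_as by (auto simp: letter_def k_def nth_eq_iff_index_eq)

lemma letter_surj: "y \<in> A <+> A \<Longrightarrow> \<exists>x < 2 * k. y = letter x"
proof (cases y)
  case (Inl a)
  assume "y \<in> A <+> A"
  then obtain i where "i < k" "as ! i = a" using Inl set_as by (auto simp: in_set_conv_nth k_def)
  then show ?thesis using Inl by (intro exI[of _ i]) (simp add: letter_def)
next
  case (Inr a)
  assume "y \<in> A <+> A"
  then obtain i where "i < k" "as ! i = a" using Inr set_as by (auto simp: in_set_conv_nth k_def)
  then show ?thesis using Inr by (intro exI[of _ "k + i"]) (simp add: letter_def)
qed

lemma lang_eq: "lang A \<Gamma> = H"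
  using stallings_lang[OF st] subgroup.subset[OF H] by simp

lemma traverses_less: "traverses \<Gamma> p x q \<Longrightarrow> p < n \<and> q < n"
  using stallings_traverses[OF st, of p x q] stallings_traverses[OF st, of q "bar x" p]
  by (simp add: vertices)

lemma base_less: "base \<Gamma> < n"
  using stallings_base[OF st] by (simp add: vertices)

lemma table_entry_eq:
  assumes "j < k"
  shows "table_entry \<Gamma> p (as ! j) = Suc q \<longleftrightarrow> traverses \<Gamma> p (letter j) q"
  using assms table_entry_Suc[OF stallings_folded[OF st]] by (simp add: letter_def)

abbreviation quot :: "(nat \<Rightarrow> nat) \<Rightarrow> (nat, 'a) pointed_graph" where
  "quot rep \<equiv> map_graph rep \<Gamma>"

text \<open>The table has columns for the inverse letters as well, unlike the input. As a cell holds
  one value, a correct table can exist only if the quotient is folded.\<close>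

definition table_ok :: "(nat \<Rightarrow> nat) \<Rightarrow> (nat \<Rightarrow> nat \<Rightarrow> nat) \<Rightarrow> bool" where
  "table_ok rep T \<longleftrightarrow> (\<forall>x < 2 * k. \<forall>P Q. T x P = Suc Q \<longleftrightarrow> traverses (quot rep) P (letter x) Q)"

text \<open>A partition is given by idempotent representatives, and only soundness is demanded of
  it; the quotient may still be far from folded.\<close>

definition rep_ok :: "(nat \<Rightarrow> nat) \<Rightarrow> bool" where
  "rep_ok rep \<longleftrightarrow> (\<forall>p < n. rep p < n \<and> rep (rep p) = rep p) \<and>
     (\<forall>p < n. \<forall>q < n. rep p = rep q \<longrightarrow> forced A \<Gamma> p q)"

lemmas forced_rules =
  stallings_folded[OF st] stallings_labelled[OF st] stallings_traverses[OF st] stallings_reachable[OF st]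

lemma forced_refl': "forced A \<Gamma> p p"
  by (rule forced_refl[OF forced_rules])

lemma forced_sym': "forced A \<Gamma> p q \<Longrightarrow> forced A \<Gamma> q p"
  by (rule forced_sym[OF forced_rules])

lemma forced_trans': "forced A \<Gamma> p q \<Longrightarrow> forced A \<Gamma> q r \<Longrightarrow> q < n \<Longrightarrow> forced A \<Gamma> p r"
  by (rule forced_trans[OF forced_rules]) (simp_all add: vertices)

lemma forced_traverses':
  "traverses \<Gamma> p x q \<Longrightarrow> traverses \<Gamma> p' x q' \<Longrightarrow> forced A \<Gamma> p p' \<Longrightarrow> forced A \<Gamma> q q'"
  by (rule forced_traverses[OF forced_rules])

lemma rep_ok_less: "rep_ok rep \<Longrightarrow> p < n \<Longrightarrow> rep p < n"
  by (simp add: rep_ok_def)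

lemma rep_ok_idem: "rep_ok rep \<Longrightarrow> p < n \<Longrightarrow> rep (rep p) = rep p"
  by (simp add: rep_ok_def)

lemma rep_ok_forced: "rep_ok rep \<Longrightarrow> p < n \<Longrightarrow> q < n \<Longrightarrow> rep p = rep q \<Longrightarrow> forced A \<Gamma> p q"
  by (simp add: rep_ok_def)

definition merge :: "(nat \<Rightarrow> nat) \<Rightarrow> nat \<Rightarrow> nat \<Rightarrow> nat \<Rightarrow> nat" where
  "merge rep u v p = (if p < n \<and> rep p = v then u else rep p)"

text \<open>The class of \<open>v\<close> joins that of \<open>u\<close>: \<open>v\<close> ceases to
  be a representative and no new one appears, which bounds the number of rounds.\<close>

lemma merge:
  assumes rep: "rep_ok rep" and uv: "u \<noteq> v" "u < n" "v < n" "rep u = u" "rep v = v" "forced A \<Gamma> u v"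
  shows "rep_ok (merge rep u v)" "card (merge rep u v ` {..<n}) < card (rep ` {..<n})"
proof -
  have 1: "forced A \<Gamma> p (rep p)" if "p < n" for p
    using rep that by (simp add: rep_ok_def)
  note 2 = rep_ok_less[OF rep]
  have 3: "forced A \<Gamma> p q" if "p < n" "q < n" "rep p = v" "rep q = u" for p q
    using 1[of p] 1[of q] that uv forced_trans' forced_sym' by metis
  show "rep_ok (merge rep u v)"
    unfolding rep_ok_def
  proof (intro conjI allI impI)
    fix p assume "p < n"
    then show "merge rep u v p < n" "merge rep u v (merge rep u v p) = merge rep u v p"
      using uv 2 rep_ok_idem[OF rep] by (auto simp: merge_def)
  next
    fix p q assume "p < n" "q < n" "merge rep u v p = merge rep u v q"
    then consider "rep p = rep q" | "rep p = v" "rep q = u" | "rep q = v" "rep p = u"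
      by (auto simp: merge_def split: if_splits)
    then show "forced A \<Gamma> p q"
      using 3 forced_sym' rep_ok_forced[OF rep] \<open>p < n\<close> \<open>q < n\<close> by cases blast+
  qed
  have "u \<in> rep ` {..<n}" using uv by (metis imageI lessThan_iff)
  then have "merge rep u v ` {..<n} \<subseteq> rep ` {..<n} - {v}"
    using uv by (auto simp: merge_def)
  moreover have "v \<in> rep ` {..<n}" using uv by (metis imageI lessThan_iff)
  ultimately show "card (merge rep u v ` {..<n}) < card (rep ` {..<n})"
    by (meson card_mono card_Diff1_less finite_Diff finite_imageI finite_lessThan le_less_trans)
qed

lemma quot_traverses_rep:
  assumes "rep_ok rep" "traverses (quot rep) P x Q"
  shows "P < n" "Q < n" "rep P = P" "rep Q = Q"
  using assms rep_ok_less[OF assms(1)] rep_ok_idem[OF assms(1)] traverses_less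
  unfolding traverses_map_graph by metis+

lemma table_ok_folded:
  assumes "table_ok rep T"
  shows "folded (quot rep)"
  unfolding folded_def
proof (intro allI impI)
  fix p y q q' assume *: "traverses (quot rep) p y q" "traverses (quot rep) p y q'"
  then have "y \<in> A <+> A"
    using labelled_map_graph[OF stallings_labelled[OF st], of rep] unfolding labelled_def by blast
  then obtain x where "x < 2 * k" "y = letter x" using letter_surj by blast
  then show "q = q'" using * assms unfolding table_ok_def by (metis Suc_inject)
qed

subsection \<open>Conflicts while building the quotient table\<close>

text \<open>
  Table entries are successors of vertices, as in \<^const>\<open>table_entry\<close>.  The set \<open>E\<close> collects the
  transitions entered so far; \<open>u \<noteq> v\<close> records a conflict, and \<open>u = v\<close> that there was none.
\<close>

definition tab :: "(nat \<times> nat \<times> nat) set \<Rightarrow> (nat \<Rightarrow> nat \<Rightarrow> nat) \<Rightarrow> nat \<Rightarrow> nat \<Rightarrow> bool" where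
  "tab E T u v \<longleftrightarrow>
     (\<forall>x < 2 * k. \<forall>P Q. T x P = Suc Q \<longrightarrow> (P, x, Q) \<in> E) \<and>
     (u \<noteq> v \<longrightarrow> (\<exists>x P. (P, x, u) \<in> E \<and> (P, x, v) \<in> E)) \<and>
     (u = v \<longrightarrow> (\<forall>P x Q. (P, x, Q) \<in> E \<longrightarrow> T x P = Suc Q))"

lemma tab_empty: "(\<And>x P. x < 2 * k \<Longrightarrow> T x P = 0) \<Longrightarrow> tab {} T 0 0"
  by (simp add: tab_def)

lemma tab_enter_new:
  assumes "tab E T u v" "T x P = 0"
  shows "tab (insert (P, x, Q) E) (T(x := (T x)(P := Suc Q))) u v"
  using assms unfolding tab_def by (auto 4 4 split: if_splits)

lemma tab_enter_old:
  assumes "tab E T u v" "T x P = Suc Q"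
  shows "tab (insert (P, x, Q) E) T u v"
  using assms unfolding tab_def by blast

text \<open>A later conflict may overwrite an earlier one. The rejected transition belongs to
  \<open>E\<close> but not to \<open>T\<close>; this is harmless, since \<open>T\<close> has to
  contain all of \<open>E\<close> only as long as \<open>u = v\<close>.\<close>

lemma tab_enter_conflict:
  assumes "tab E T u v" "T x P = Suc Q'" "Q' \<noteq> Q" "x < 2 * k"
  shows "tab (insert (P, x, Q) E) T Q' Q"
  using assms unfolding tab_def by blast

text \<open>The state of the sweep after all rows before \<open>p\<close> and the first
  \<open>j\<close> entries of row \<open>p\<close>. Every edge is entered in both directions, the
  inverse one in column \<open>k + j'\<close>.\<close>

definition entered :: "(nat \<Rightarrow> nat) \<Rightarrow> nat \<Rightarrow> nat \<Rightarrow> (nat \<times> nat \<times> nat) set" where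
  "entered rep p j = {t. \<exists>p' j' q. (p' < p \<or> p' = p \<and> j' < j) \<and> j' < k \<and> traverses \<Gamma> p' (letter j') q \<and>
     (t = (rep p', j', rep q) \<or> t = (rep q, k + j', rep p'))}"

lemma entered_0: "entered rep 0 0 = {}"
  by (simp add: entered_def)

lemma entered_row: "entered rep p k = entered rep (Suc p) 0"
  by (auto simp: entered_def less_Suc_eq)

lemma entered_Suc_none:
  assumes "\<And>q. \<not> traverses \<Gamma> p (letter j) q"
  shows "entered rep p (Suc j) = entered rep p j"
  using assms by (auto simp: entered_def less_Suc_eq)

lemma entered_Suc:
  assumes "traverses \<Gamma> p (letter j) q" "j < k"
  shows "entered rep p (Suc j) = insert (rep q, k + j, rep p) (insert (rep p, j, rep q) (entered rep p j))"
proof -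
  have "q' = q" if "traverses \<Gamma> p (letter j) q'" for q'
    using that assms stallings_folded[OF st] unfolding folded_def by blast
  then have *: "traverses \<Gamma> p (letter j) q' \<longleftrightarrow> q' = q" for q' using assms(1) by blast
  have "t \<in> entered rep p (Suc j) \<longleftrightarrow> t \<in> entered rep p j \<or>
      (\<exists>q'. traverses \<Gamma> p (letter j) q' \<and> (t = (rep p, j, rep q') \<or> t = (rep q', k + j, rep p)))" for t
    unfolding entered_def less_Suc_eq mem_Collect_eq using assms(2) by blast
  then show ?thesis unfolding * by blast
qed

lemma entered_all:
  "(P, x, Q) \<in> entered rep n 0 \<longleftrightarrow> x < 2 * k \<and> traverses (quot rep) P (letter x) Q"
proof
  assume "(P, x, Q) \<in> entered rep n 0"
  then obtain p j q where *: "j < k" "traverses \<Gamma> p (letter j) q"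
    "(P, x, Q) = (rep p, j, rep q) \<or> (P, x, Q) = (rep q, k + j, rep p)"
    by (auto simp: entered_def)
  moreover have "letter (k + j) = bar (letter j)" using * by (simp add: letter_def)
  ultimately show "x < 2 * k \<and> traverses (quot rep) P (letter x) Q"
    unfolding traverses_map_graph using traverses_bar by fastforce
next
  assume *: "x < 2 * k \<and> traverses (quot rep) P (letter x) Q"
  then obtain p q where pq: "traverses \<Gamma> p (letter x) q" "P = rep p" "Q = rep q"
    by (auto simp: traverses_map_graph)
  show "(P, x, Q) \<in> entered rep n 0"
  proof (cases "x < k")
    case True
    then show ?thesis using pq traverses_less by (auto simp: entered_def)
  next
    case False
    have "traverses \<Gamma> q (letter (x - k)) p"
      using False pq * letter_xbar[of x] by (simp add: xbar_def)
    then show ?thesis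
      using False pq traverses_less * unfolding entered_def
      by (intro CollectI exI[of _ q] exI[of _ "x - k"] exI[of _ p]) auto
  qed
qed

lemma tab_ok:
  assumes "tab (entered rep n 0) T u u"
  shows "table_ok rep T"
  using assms unfolding tab_def table_ok_def entered_all by blast

text \<open>The clashing transitions stem from edges with equal label whose sources lie in one
  class. The sources are forced together, hence so are the targets, and with them their
  representatives \<open>u\<close> and \<open>v\<close>.\<close>

lemma tab_conflict:
  assumes rep: "rep_ok rep" and T: "tab (entered rep n 0) T u v" "u \<noteq> v"
  shows "u < n \<and> v < n \<and> rep u = u \<and> rep v = v \<and> forced A \<Gamma> u v"
proof -
  obtain x P where "traverses (quot rep) P (letter x) u" "traverses (quot rep) P (letter x) v"
    using T unfolding tab_def entered_all by blast
  then obtain p q p' q' where *: "traverses \<Gamma> p (letter x) q" "traverses \<Gamma> p' (letter x) q'"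
    "rep p = rep p'" "rep q = u" "rep q' = v"
    by (auto simp: traverses_map_graph)
  have less: "p < n" "p' < n" "q < n" "q' < n" using * traverses_less by blast+
  have "forced A \<Gamma> q q'"
    using forced_traverses'[OF *(1,2)] rep_ok_forced[OF rep less(1,2) *(3)] by blast
  moreover have "forced A \<Gamma> u q" "forced A \<Gamma> q' v"
    using rep less * rep_ok_idem[OF rep] rep_ok_less[OF rep] rep_ok_forced[OF rep] by metis+
  ultimately show ?thesis
    using forced_trans' less * rep_ok_idem[OF rep] rep_ok_less[OF rep] by metis
qed


subsection \<open>Stripping the leaves of the off-diagonal square\<close>

text \<open>The pair \<open>(P, Q)\<close> is encoded as \<open>P * n + Q\<close>.\<close>

definition nbr :: "(nat \<Rightarrow> nat \<Rightarrow> nat) \<Rightarrow> nat \<Rightarrow> nat \<Rightarrow> nat \<Rightarrow> bool" where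
  "nbr T x i e \<longleftrightarrow> (\<exists>P Q. T x (i div n) = Suc P \<and> T x (i mod n) = Suc Q \<and> e = P * n + Q)"

text \<open>Letters are counted rather than neighbours: parallel edges count separately, and for a
  correct table a loop counts twice, once in each direction.\<close>

definition deg :: "(nat \<Rightarrow> nat \<Rightarrow> nat) \<Rightarrow> nat set \<Rightarrow> nat \<Rightarrow> nat" where
  "deg T S i = card {x. x < 2 * k \<and> (\<exists>e \<in> S. nbr T x i e)}"

definition offdiag :: "nat set" where
  "offdiag = {i. i < n * n \<and> i div n \<noteq> i mod n}"

text \<open>
  Stripping scans the pairs in the order of their codes \<open>I\<close>.  Removing the pair \<open>J\<close> can create at
  most one new leaf, its last neighbour, which becomes the next \<open>J\<close>.  So neither a worklist nor
  stored degrees are needed: among the scanned pairs only \<open>J\<close> may be a leaf.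
\<close>

definition strip_inv :: "(nat \<Rightarrow> nat \<Rightarrow> nat) \<Rightarrow> nat set \<Rightarrow> nat \<Rightarrow> nat \<Rightarrow> bool" where
  "strip_inv T S I J \<longleftrightarrow> S \<subseteq> offdiag \<and>
     (\<forall>C \<subseteq> offdiag. (\<forall>i \<in> C. 2 \<le> deg T C i) \<longrightarrow> C \<subseteq> S) \<and>
     (\<forall>i \<le> I. i \<in> S \<longrightarrow> i = J \<or> 2 \<le> deg T S i) \<and> (if I < n * n then J < n * n else J = I)"

lemma deg_ge_2: "2 \<le> deg T S i \<longleftrightarrow>
    (\<exists>x y. x < 2 * k \<and> y < 2 * k \<and> x \<noteq> y \<and> (\<exists>e \<in> S. nbr T x i e) \<and> (\<exists>e \<in> S. nbr T y i e))"
  unfolding deg_def by (subst two_le_card_iff) auto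

lemma deg_mono: "C \<subseteq> S \<Longrightarrow> deg T C i \<le> deg T S i"
  unfolding deg_def by (intro card_mono) auto

lemma nbr_unique: "nbr T x i e \<Longrightarrow> nbr T x i e' \<Longrightarrow> e = e'"
  by (auto simp: nbr_def)

lemma code_less: "P < n \<Longrightarrow> Q < n \<Longrightarrow> P * n + Q < n * n"
proof -
  assume "P < n" "Q < n"
  then have "P * n + Q < Suc P * n" by simp
  also have "\<dots> \<le> n * n" using \<open>P < n\<close> by (intro mult_le_mono1) simp
  finally show ?thesis .
qed

lemma code_div_mod: "Q < n \<Longrightarrow> (P * n + Q) div n = P" "Q < n \<Longrightarrow> (P * n + Q) mod n = Q"
  by simp_all

lemma strip_init: "strip_inv T offdiag 0 0"
  by (simp add: strip_inv_def)

context
  fixes rep T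
  assumes rep: "rep_ok rep" and T: "table_ok rep T"
begin

lemma table_entry_less: "x < 2 * k \<Longrightarrow> T x P = Suc Q \<Longrightarrow> P < n \<and> Q < n \<and> rep P = P \<and> rep Q = Q"
  using T quot_traverses_rep[OF rep] unfolding table_ok_def by blast

lemma nbr_sym:
  assumes "x < 2 * k" "nbr T x i e"
  shows "nbr T (xbar x) e i"
proof -
  obtain P Q where *: "T x (i div n) = Suc P" "T x (i mod n) = Suc Q" "e = P * n + Q"
    using assms by (auto simp: nbr_def)
  have "T (xbar x) P = Suc (i div n)" "T (xbar x) Q = Suc (i mod n)"
    using T * assms(1) letter_xbar[of x] unfolding table_ok_def by simp_all
  moreover have "Q < n" using * table_entry_less assms by blast
  ultimately show ?thesis using * unfolding nbr_def
    by (simp only: code_div_mod) simp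
qed

text \<open>A pair of degree at most one in \<open>S\<close> lies in no subset of \<open>S\<close>
  of minimum degree two, so deleting it is safe. In degree 0 the dead pair \<open>J\<close> itself
  serves as a harmless default for \<open>X\<close>.\<close>

lemma strip_kill:
  assumes inv: "strip_inv T S I J" and J: "J \<in> S" "deg T S J \<le> 1"
    and I: "I < n * n"
    and X: "deg T S J = 0 \<Longrightarrow> X = J" "deg T S J \<noteq> 0 \<Longrightarrow> X \<in> S \<and> (\<exists>y < 2 * k. nbr T y J X)"
  shows "strip_inv T (S - {J}) I X"
  unfolding strip_inv_def
proof (intro conjI allI impI)
  show "S - {J} \<subseteq> offdiag" using inv by (auto simp: strip_inv_def)
  have "X \<in> S" using X J by blast
  then have "X \<in> offdiag" using inv by (auto simp: strip_inv_def)
  with I show "if I < n * n then X < n * n else X = I" by (simp add: offdiag_def)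
next
  fix C assume "C \<subseteq> offdiag" and C: "\<forall>i \<in> C. 2 \<le> deg T C i"
  then have "C \<subseteq> S" using inv by (simp add: strip_inv_def)
  moreover have "J \<notin> C"
    using C deg_mono[OF \<open>C \<subseteq> S\<close>, of T J] J(2) by fastforce
  ultimately show "C \<subseteq> S - {J}" by blast
next
  fix i assume i: "i \<le> I" "i \<in> S - {J}"
  then have deg: "2 \<le> deg T S i" using inv by (auto simp: strip_inv_def)
  show "i = X \<or> 2 \<le> deg T (S - {J}) i"
  proof (cases "\<exists>y < 2 * k. nbr T y i J")
    \<comment> \<open>If \<open>i\<close> loses the neighbour \<open>J\<close>, then
      \<open>xbar y\<close> leads from \<open>J\<close> back to \<open>i\<close>. Only one letter
      leads from \<open>J\<close> into \<open>S\<close>, so \<open>i\<close> is \<open>X\<close>,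
      the permitted exception.\<close>
    case True
    then obtain y where y: "y < 2 * k" "nbr T (xbar y) J i" "xbar y < 2 * k"
      using nbr_sym letter_xbar by blast
    have fin: "finite {x. x < 2 * k \<and> (\<exists>e \<in> S. nbr T x J e)}" by simp
    have mem: "xbar y \<in> {x. x < 2 * k \<and> (\<exists>e \<in> S. nbr T x J e)}" using y i by blast
    then have "deg T S J \<noteq> 0" unfolding deg_def using fin by (metis card_0_eq empty_iff)
    then obtain z where z: "z < 2 * k" "nbr T z J X" "X \<in> S" using X(2) by blast
    then have "z = xbar y"
      using J(2) mem fin unfolding deg_def by (auto simp: card_le_Suc0_iff_eq)
    then show ?thesis using z y nbr_unique by blast
  next
    case False
    then have "{x. x < 2 * k \<and> (\<exists>e \<in> S - {J}. nbr T x i e)} = {x. x < 2 * k \<and> (\<exists>e \<in> S. nbr T x i e)}"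
      by blast
    then show ?thesis using deg by (simp add: deg_def)
  qed
qed

text \<open>No exception is left among the scanned pairs, so the newly scanned pair
  \<open>Suc I\<close> may become the exception before its degree is known.\<close>

lemma strip_advance:
  assumes "strip_inv T S I J" "J \<notin> S \<or> 2 \<le> deg T S J"
  shows "strip_inv T S (Suc I) (Suc I)"
  using assms unfolding strip_inv_def by (auto simp: le_Suc_eq)

text \<open>After the scan \<open>J = I \<ge> n * n\<close> is not the code of a pair, so the
  exception has become void.\<close>

lemma strip_final:
  assumes "strip_inv T S I J" "n * n \<le> I" "i \<in> S"
  shows "2 \<le> deg T S i"
proof -
  have "S \<subseteq> offdiag" using assms by (simp add: strip_inv_def)
  then have "i < n * n" using assms(3) by (auto simp: offdiag_def)
  then have "i \<le> I" "i \<noteq> J" using assms(1,2) by (auto simp: strip_inv_def split: if_splits)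
  then show ?thesis using assms(1,3) unfolding strip_inv_def by blast
qed

text \<open>Survivors of the stripping have degree at least two among themselves. Decoded into pairs
  of vertices, they meet the hypothesis of \<open>common_loop\<close>, and the common loop forces
  the two coordinates together.\<close>

lemma core_forced:
  assumes "finite S" "\<And>i. i \<in> S \<Longrightarrow> 2 \<le> deg T S i" "S \<subseteq> offdiag" "i \<in> S"
  shows "i div n < n \<and> i mod n < n \<and> rep (i div n) = i div n \<and> rep (i mod n) = i mod n \<and>
    forced A \<Gamma> (i div n) (i mod n)"
proof -
  define S' where "S' = (\<lambda>i. (i div n, i mod n)) ` S"
  have step: "\<exists>P Q. traverses (quot rep) (i div n) (letter x) P \<and> traverses (quot rep) (i mod n) (letter x) Q \<and>
      (P, Q) \<in> S'" if x: "x < 2 * k" "nbr T x i e" "e \<in> S" for x i e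
  proof -
    obtain P Q where PQ: "T x (i div n) = Suc P" "T x (i mod n) = Suc Q" "e = P * n + Q"
      using x(2) by (auto simp: nbr_def)
    then have "Q < n" using table_entry_less x(1) by blast
    then have "(P, Q) = (e div n, e mod n)" unfolding PQ(3) by (simp only: code_div_mod)
    then have "(P, Q) \<in> S'" unfolding S'_def using x(3) by blast
    then show ?thesis using PQ T x(1) unfolding table_ok_def by blast
  qed
  have two: "\<exists>x y P1 Q1 P2 Q2. x \<noteq> y \<and> (P1, Q1) \<in> S' \<and> (P2, Q2) \<in> S' \<and>
      traverses (quot rep) P x P1 \<and> traverses (quot rep) Q x Q1 \<and>
      traverses (quot rep) P y P2 \<and> traverses (quot rep) Q y Q2" if PQ: "(P, Q) \<in> S'" for P Q
  proof -
    obtain i where i: "i \<in> S" "P = i div n" "Q = i mod n" using PQ by (auto simp: S'_def)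
    then obtain x y e e' where "x < 2 * k" "y < 2 * k" "x \<noteq> y" "e \<in> S" "nbr T x i e"
      "e' \<in> S" "nbr T y i e'"
      using assms(2)[of i] unfolding deg_ge_2 by blast
    then show ?thesis using step[of x i e] step[of y i e'] letter_inj[of x y] i by metis
  qed
  have iS: "(i div n, i mod n) \<in> S'" using assms(4) by (auto simp: S'_def)
  from two[OF this] have less: "i div n < n" "i mod n < n" "rep (i div n) = i div n" "rep (i mod n) = i mod n"
    using quot_traverses_rep[OF rep] by blast+
  have "finite S'" using assms(1) by (simp add: S'_def)
  from common_loop[OF this iS two] obtain w where "reduce w \<noteq> []"
    "labels_path (quot rep) (i div n) w (i div n)" "labels_path (quot rep) (i mod n) w (i mod n)" by blast
  then have "forced A \<Gamma> (i div n) (i mod n)"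
    using forced_common_loop[OF forced_rules, where f = rep and p = "i div n" and q = "i mod n" and w = w] less rep_ok_forced[OF rep]
    by (simp add: vertices)
  then show ?thesis using less by blast
qed

text \<open>By \<open>core_pair_step\<close> the codes of the core pairs form an off-diagonal set of
  minimum degree two, which the invariant keeps inside the surviving set.\<close>

lemma core_empty:
  assumes "strip_inv T {} I J"
  shows "\<not> core_pair (quot rep) P Q"
proof
  assume PQ: "core_pair (quot rep) P Q"
  define C where "C = {i. i < n * n \<and> core_pair (quot rep) (i div n) (i mod n)}"
  have codes: "P < n \<and> Q < n" if core: "core_pair (quot rep) P Q" for P Q
  proof -
    obtain u where "u \<noteq> []" "labels_path (quot rep) P u P" "labels_path (quot rep) Q u Q"
      using core unfolding core_pair_def by blast
    then show ?thesis using quot_traverses_rep[OF rep] by (cases u) auto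
  qed
  have C_code: "P * n + Q \<in> C" if "core_pair (quot rep) P Q" for P Q
    using codes[OF that] that code_less unfolding C_def by (simp add: code_div_mod)
  have letters: "\<exists>a < 2 * k. x = letter a" if "traverses (quot rep) P x Q" for P x Q
    using that labelled_map_graph[OF stallings_labelled[OF st], of rep] letter_surj
    unfolding labelled_def by blast
  have "C \<subseteq> offdiag"
    unfolding C_def offdiag_def core_pair_def by blast
  moreover have "2 \<le> deg T C i" if "i \<in> C" for i
  proof -
    have "core_pair (quot rep) (i div n) (i mod n)" using that by (simp add: C_def)
    from core_pair_step[OF table_ok_folded[OF T] this] obtain x y r s r' s' where *:
      "x \<noteq> y" "traverses (quot rep) (i div n) x r" "traverses (quot rep) (i mod n) x s" "core_pair (quot rep) r s"
      "traverses (quot rep) (i div n) y r'" "traverses (quot rep) (i mod n) y s'" "core_pair (quot rep) r' s'"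
      by blast
    obtain a b where ab: "a < 2 * k" "x = letter a" "b < 2 * k" "y = letter b"
      using letters *(2,5) by metis
    have "nbr T a i (r * n + s)" "nbr T b i (r' * n + s')"
      using * T ab unfolding nbr_def table_ok_def by blast+
    then show ?thesis using C_code[OF *(4)] C_code[OF *(7)] ab *(1) unfolding deg_ge_2 by blast
  qed
  ultimately have "C \<subseteq> {}" using assms unfolding strip_inv_def by blast
  then show False using C_code[OF PQ] by blast
qed

end



subsection \<open>Renumbering the classes\<close>

text \<open>The rank of \<open>i\<close> among the representatives gives consecutive new names and
  is computable in one sweep; \<open>num rep n\<close> is the number of classes.\<close>

definition num :: "(nat \<Rightarrow> nat) \<Rightarrow> nat \<Rightarrow> nat" where
  "num rep i = card {i'. i' < i \<and> rep i' = i'}"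

lemma num_0: "num rep 0 = 0"
  by (simp add: num_def)

lemma num_Suc: "num rep (Suc i) = (if rep i = i then Suc (num rep i) else num rep i)"
proof -
  have "{i'. i' < Suc i \<and> rep i' = i'} =
      (if rep i = i then insert i {i'. i' < i \<and> rep i' = i'} else {i'. i' < i \<and> rep i' = i'})"
    by (auto simp: less_Suc_eq)
  then show ?thesis by (simp add: num_def)
qed

lemma num_mono: "i \<le> j \<Longrightarrow> num rep i \<le> num rep j"
  unfolding num_def by (intro card_mono) auto

lemma num_less: "i < j \<Longrightarrow> rep i = i \<Longrightarrow> num rep i < num rep j"
  using num_mono[of "Suc i" j rep] by (simp add: num_Suc)

lemma num_le: "num rep i \<le> i"
  by (induction i) (auto simp: num_0 num_Suc)

lemma num_inj: "inj_on (num rep) {i. rep i = i}"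
proof (rule inj_onI)
  fix i j assume *: "i \<in> {i. rep i = i}" "j \<in> {i. rep i = i}" "num rep i = num rep j"
  show "i = j"
    using num_less[of i j rep] num_less[of j i rep] * by (cases i j rule: linorder_cases) simp_all
qed

lemma num_image: "num rep ` {i. i < m \<and> rep i = i} = {..<num rep m}"
proof (rule card_subset_eq)
  show "num rep ` {i. i < m \<and> rep i = i} \<subseteq> {..<num rep m}" by (auto simp: num_less)
  have "card (num rep ` {i. i < m \<and> rep i = i}) = card {i. i < m \<and> rep i = i}"
    by (intro card_image inj_on_subset[OF num_inj]) auto
  then show "card (num rep ` {i. i < m \<and> rep i = i}) = card {..<num rep m}"
    by (simp add: num_def)
qed simp

context
  fixes rep T
  assumes rep: "rep_ok rep" and T: "table_ok rep T" and core: "\<And>P Q. \<not> core_pair (quot rep) P Q"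
begin

lemma rep_image: "rep ` {..<n} = {i. i < n \<and> rep i = i}"
proof
  show "rep ` {..<n} \<subseteq> {i. i < n \<and> rep i = i}"
    using rep_ok_less[OF rep] rep_ok_idem[OF rep] by auto
  show "{i. i < n \<and> rep i = i} \<subseteq> rep ` {..<n}"
  proof
    fix i assume "i \<in> {i. i < n \<and> rep i = i}"
    then show "i \<in> rep ` {..<n}" by (intro image_eqI[of _ _ i]) simp_all
  qed
qed

definition result :: "(nat, 'a) pointed_graph" where
  "result = map_graph (num rep) (quot rep)"

lemma result_map: "result = map_graph (num rep \<circ> rep) \<Gamma>"
  by (auto simp: result_def map_graph_def image_image split_def)

lemma quot_inj: "inj_on (num rep) (vertices (quot rep))"
  using inj_on_subset[OF num_inj] rep_image by (auto simp: vertices)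

lemma quot_ends: "traverses (quot rep) p x q \<Longrightarrow> q \<in> vertices (quot rep)"
  using traverses_less by (auto simp: traverses_map_graph vertices)

lemma vertices_result: "vertices result = {..<num rep n}"
  using num_image[of rep n] by (simp add: result_def vertices rep_image)

text \<open>Absence of core pairs gives malnormality, forced classes give leastness, and the
  renumbering is injective on classes. The degree condition is obtained for the composite map
  directly from \<open>\<Gamma>\<close>.\<close>

lemma stallings_result: "stallings_graph A (malnormal_closure (free_group A) H) result"
proof -
  have lab: "labelled A (quot rep)" by (rule labelled_map_graph[OF stallings_labelled[OF st]])
  have "malnormal (free_group A) (lang A (quot rep))"
    by (rule malnormal_lang[OF table_ok_folded[OF T] lab core])
  from malnormal_closure_eq_lang_map_graph[OF forced_rules _ this]
  have "malnormal_closure (free_group A) H = lang A (quot rep)"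
    using rep_ok_forced[OF rep] stallings_base[OF st] lang_eq by (simp add: vertices)
  also have "\<dots> = lang A result"
    unfolding result_def
    by (rule lang_map_graph_inj[OF quot_inj quot_ends, symmetric]) (use stallings_base[OF st] in auto)
  finally show ?thesis
    using stallings_map_graph[OF st, of "num rep \<circ> rep"]
      folded_map_graph_inj[OF quot_inj quot_ends table_ok_folded[OF T]]
    by (simp add: result_map[symmetric] result_def[symmetric])
qed

lemma base_result: "base result = num rep (rep (base \<Gamma>))"
  by (simp add: result_def)

lemma table_entry_result:
  assumes "P < n" "rep P = P" "j < k"
  shows "table_entry result (num rep P) (as ! j) = (case T j P of 0 \<Rightarrow> 0 | Suc Q \<Rightarrow> Suc (num rep Q))"
proof -
  have P: "P \<in> vertices (quot rep)" using assms rep_image by (auto simp: vertices)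
  have fold: "folded result"
    unfolding result_def by (rule folded_map_graph_inj[OF quot_inj quot_ends table_ok_folded[OF T]])
  have "table_entry result (num rep P) (as ! j) = Suc q \<longleftrightarrow>
      (\<exists>Q. traverses (quot rep) P (letter j) Q \<and> q = num rep Q)" for q
    using table_entry_Suc[OF fold, of "num rep P" "as ! j" q]
      traverses_map_graph_inj[OF quot_inj quot_ends P, where x = "letter j" and Q = q] assms(3)
    by (simp add: letter_def result_def)
  moreover have "traverses (quot rep) P (letter j) Q \<longleftrightarrow> T j P = Suc Q" for Q
    using T assms(3) unfolding table_ok_def by simp
  ultimately have *: "table_entry result (num rep P) (as ! j) = Suc q \<longleftrightarrow> (\<exists>Q. T j P = Suc Q \<and> q = num rep Q)" for q
    by simp
  show ?thesis
  proof (cases "T j P")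
    case 0
    then have "table_entry result (num rep P) (as ! j) \<noteq> Suc q" for q using *[of q] by simp
    then show ?thesis using 0 by (metis nat.case(1) not0_implies_Suc)
  next
    case (Suc Q)
    then show ?thesis using *[of "num rep Q"] by simp
  qed
qed

end

end

section \<open>The program\<close>

abbreviation (input) "vN \<equiv> (2::nat)"
abbreviation (input) "vNN \<equiv> (3::nat)"
abbreviation (input) "vI \<equiv> (4::nat)"
abbreviation (input) "vU \<equiv> (5::nat)"
abbreviation (input) "vW \<equiv> (6::nat)"
abbreviation (input) "vGo \<equiv> (7::nat)"
abbreviation (input) "vE \<equiv> (8::nat)"
abbreviation (input) "vP \<equiv> (9::nat)"
abbreviation (input) "vQ \<equiv> (10::nat)"
abbreviation (input) "vJ \<equiv> (11::nat)"
abbreviation (input) "vD \<equiv> (12::nat)"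
abbreviation (input) "vX \<equiv> (13::nat)"
abbreviation (input) "vC \<equiv> (14::nat)"
abbreviation (input) "vO \<equiv> (15::nat)"
abbreviation (input) "vB \<equiv> (16::nat)"

text \<open>
  \<open>vU\<close> and \<open>vW\<close> hold a pair of classes to be merged; equal values mean that none has been found.
\<close>

abbreviation (input) "aRep \<equiv> (2::nat)"
abbreviation (input) "aR \<equiv> (3::nat)"
abbreviation (input) "aPP \<equiv> (4::nat)"
abbreviation (input) "aQQ \<equiv> (5::nat)"
abbreviation (input) "aAl \<equiv> (6::nat)"
abbreviation (input) "aNew \<equiv> (7::nat)"
abbreviation (input) "aT x \<equiv> (8::nat) + x"

text \<open>An inequality test from truncated subtraction; nonzero means true.\<close>

definition eneq :: "exp \<Rightarrow> exp \<Rightarrow> exp" where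
  "eneq e e' = (e [-] e') [+] (e' [-] e)"

lemma val_eneq [simp]: "val (eneq e e') s = 0 \<longleftrightarrow> val e s = val e' s" "0 < val (eneq e e') s \<longleftrightarrow> val e s \<noteq> val e' s"
  by (auto simp: eneq_def)

lemma wf_eneq [simp]: "wf_exp M (eneq e e') \<longleftrightarrow> wf_exp M e \<and> wf_exp M e'"
  by (auto simp: eneq_def)

fun etimes :: "nat \<Rightarrow> exp \<Rightarrow> exp" where
  "etimes 0 e = ENum 0"
| "etimes (Suc m) e = etimes m e [+] e"

lemma val_etimes [simp]: "val (etimes m e) s = m * val e s"
  by (induction m) simp_all

lemma wf_etimes [simp]: "wf_exp M e \<Longrightarrow> wf_exp M (etimes m e)"
  by (induction m) simp_all

text \<open>\<open>aR\<close> tabulates the multiples of \<open>n\<close>, and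
  \<open>init_pairs\<close> tabulates quotients and remainders by \<open>n\<close>. These tables,
  filled once by counting, stand in for multiplication and division when pairs are encoded and
  decoded.\<close>

definition init_reps :: com where
  "init_reps = For vI vN
     (SetArr aRep (EVar vI) (EVar vI) ;;
      SetArr aR (EVar vI) (EVar vNN) ;;
      Assign vNN (EVar vNN [+] EVar vN))"

definition init_pairs :: com where
  "init_pairs = For vI vNN
     (SetArr aPP (EVar vI) (EVar vP) ;;
      SetArr aQQ (EVar vI) (EVar vQ) ;;
      Assign vQ (EVar vQ [+] ENum 1) ;;
      Cond (EVar vN [-] EVar vQ) Skip (Assign vQ (ENum 0) ;; Assign vP (EVar vP [+] ENum 1)))"

definition init :: com where
  "init = (Read vN (ENum 0) ;; Read vB (ENum 1) ;; Assign vNN (ENum 0)) ;; init_reps ;;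
     (Assign vP (ENum 0) ;; Assign vQ (ENum 0)) ;; init_pairs"

definition clear :: "nat \<Rightarrow> com" where
  "clear k = For vI vN (seqs (map (\<lambda>x. SetArr (aT x) (EVar vI) (ENum 0)) [0..<2*k]))"

text \<open>A nonzero cell is occupied. A clash is only recorded in \<open>vU\<close> and
  \<open>vW\<close>, so the sweep goes on without an early exit.\<close>

definition enter :: "nat \<Rightarrow> nat \<Rightarrow> nat \<Rightarrow> com" where
  "enter x p q =
     Cond (EArr (aT x) (EVar p))
       (Cond (eneq (EArr (aT x) (EVar p)) (EVar q [+] ENum 1))
         (Assign vU (EArr (aT x) (EVar p) [-] ENum 1) ;; Assign vW (EVar q)) Skip)
       (SetArr (aT x) (EVar p) (EVar q [+] ENum 1))"

definition build_entry :: "nat \<Rightarrow> nat \<Rightarrow> com" where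
  "build_entry k j =
     Read vE (ENum (2 + j) [+] etimes k (EVar vI)) ;;
     Cond (EVar vE)
       (Assign vP (EArr aRep (EVar vI)) ;;
        Assign vQ (EArr aRep (EVar vE [-] ENum 1)) ;;
        enter j vP vQ ;; enter (k + j) vQ vP) Skip"

definition build :: "nat \<Rightarrow> com" where
  "build k = For vI vN (seqs (map (build_entry k) [0..<k]))"

definition init_alive :: com where
  "init_alive = For vI vNN
     (SetArr aAl (EVar vI) (eneq (EArr aPP (EVar vI)) (EArr aQQ (EVar vI))))"

definition scan :: "nat \<Rightarrow> com" where
  "scan x =
     Cond (EArr (aT x) (EArr aPP (EVar vJ)))
       (Cond (EArr (aT x) (EArr aQQ (EVar vJ)))
         (Assign vE (EArr aR (EArr (aT x) (EArr aPP (EVar vJ)) [-] ENum 1) [+]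
                     (EArr (aT x) (EArr aQQ (EVar vJ)) [-] ENum 1)) ;;
          Cond (EArr aAl (EVar vE)) (Assign vD (EVar vD [+] ENum 1) ;; Assign vX (EVar vE)) Skip)
         Skip)
       Skip"

definition advance :: com where
  "advance = Assign vI (EVar vI [+] ENum 1) ;; Assign vJ (EVar vI)"

text \<open>Every execution deletes a pair or advances the scan. As \<open>vX\<close> starts as
  \<open>vJ\<close>, deleting an isolated pair leaves \<open>vJ\<close> on a dead pair, and the next
  execution advances.\<close>

definition strip_step :: "nat \<Rightarrow> com" where
  "strip_step k =
     Assign vD (ENum 0) ;; Assign vX (EVar vJ) ;; seqs (map scan [0..<2*k]) ;;
     Cond (EArr aAl (EVar vJ))
       (Cond (EVar vD [-] ENum 1) advance
         (SetArr aAl (EVar vJ) (ENum 0) ;; Assign vJ (EVar vX)))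
       advance"

definition strip_loop :: "nat \<Rightarrow> com" where
  "strip_loop k = While (EVar vNN [-] EVar vI) (strip_step k)"

definition find_alive :: com where
  "find_alive = For vI vNN
     (Cond (EArr aAl (EVar vI)) (Assign vU (EArr aPP (EVar vI)) ;; Assign vW (EArr aQQ (EVar vI))) Skip)"

definition strip :: "nat \<Rightarrow> com" where
  "strip k = init_alive ;; (Assign vI (ENum 0) ;; Assign vJ (ENum 0)) ;; strip_loop k ;; find_alive"

definition merge_loop :: com where
  "merge_loop = For vI vN
     (Cond (eneq (EArr aRep (EVar vI)) (EVar vW)) Skip (SetArr aRep (EVar vI) (EVar vU)))"

definition merge_round :: "nat \<Rightarrow> com" where
  "merge_round k = (Assign vU (ENum 0) ;; Assign vW (ENum 0)) ;; clear k ;; build k ;;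
     Cond (eneq (EVar vU) (EVar vW)) Skip (strip k) ;;
     Cond (eneq (EVar vU) (EVar vW)) (merge_loop ;; Assign vGo (ENum 1)) (Assign vGo (ENum 0))"

definition renumber :: com where
  "renumber = For vI vN
     (Cond (eneq (EArr aRep (EVar vI)) (EVar vI)) Skip
       (SetArr aNew (EVar vI) (EVar vC) ;; Assign vC (EVar vC [+] ENum 1)))"

definition write_entry :: "nat \<Rightarrow> com" where
  "write_entry j =
     Cond (EArr (aT j) (EVar vI))
       (Write (EVar vO) (EArr aNew (EArr (aT j) (EVar vI) [-] ENum 1) [+] ENum 1))
       (Write (EVar vO) (ENum 0)) ;;
     Assign vO (EVar vO [+] ENum 1)"

definition write_rows :: "nat \<Rightarrow> com" where
  "write_rows k = For vI vN
     (Cond (eneq (EArr aRep (EVar vI)) (EVar vI)) Skip (seqs (map write_entry [0..<k])))"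

text \<open>The output overwrites the input area, which is not read any more after the main loop;
  the base vertex has been saved in \<open>vB\<close>.\<close>

definition saturate :: "nat \<Rightarrow> com" where
  "saturate k = init ;; Assign vGo (ENum 1) ;; While (EVar vGo) (merge_round k) ;;
     Assign vC (ENum 0) ;; renumber ;;
     (Write (ENum 0) (EVar vC) ;; Write (ENum 1) (EArr aNew (EArr aRep (EVar vB))) ;;
      Assign vO (ENum 2)) ;; write_rows k"

lemma wf_saturate: "wf_com (8 + 2 * k) (saturate k)"
  by (auto simp: saturate_def init_def init_reps_def init_pairs_def For_def merge_round_def clear_def
      build_def build_entry_def enter_def strip_def init_alive_def strip_loop_def strip_step_def
      scan_def advance_def find_alive_def merge_loop_def renumber_def write_rows_def write_entry_def)

lemma card_less_Suc_if:
  "card {x. x < Suc j \<and> Q x} = card {x. x < j \<and> Q x} + (if Q j then 1 else 0)"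
proof -
  have "{x. x < Suc j \<and> Q x} = (if Q j then insert j {x. x < j \<and> Q x} else {x. x < j \<and> Q x})"
    by (auto simp: less_Suc_eq)
  then show ?thesis by simp
qed

section \<open>Correctness and running time of the program\<close>

context stallings_input
begin

text \<open>Stated for components of the store and not for the store itself, so that updates of
  other variables and arrays vanish by simplification.\<close>

definition frame :: "nat \<Rightarrow> nat \<Rightarrow> nat \<Rightarrow> (nat \<Rightarrow> nat) \<Rightarrow> (nat \<Rightarrow> nat) \<Rightarrow> (nat \<Rightarrow> nat) \<Rightarrow> bool" where
  "frame N NN B R PP QQ \<longleftrightarrow> N = n \<and> NN = n * n \<and> B = base \<Gamma> \<and> (\<forall>p < n. R p = p * n) \<and>
     (\<forall>i < n * n. PP i = i div n \<and> QQ i = i mod n)"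

abbreviation framed :: "store \<Rightarrow> bool" where
  "framed s \<equiv> frame (var s vN) (var s vNN) (var s vB) (arr s aR) (arr s aPP) (arr s aQQ)"

definition inp_ok :: "(nat \<Rightarrow> nat) \<Rightarrow> bool" where
  "inp_ok f \<longleftrightarrow> (\<forall>p < n. \<forall>j < k. f (2 + k * p + j) = table_entry \<Gamma> p (as ! j))"

abbreviation tabs :: "store \<Rightarrow> nat \<Rightarrow> nat \<Rightarrow> nat" where
  "tabs s \<equiv> \<lambda>x. arr s (aT x)"

abbreviation M :: nat where "M \<equiv> 8 + 2 * k"
abbreviation L :: nat where "L \<equiv> 2 + k * n"

abbreviation ready :: "(nat \<Rightarrow> nat) \<Rightarrow> store \<Rightarrow> bool" where
  "ready rep s \<equiv> framed s \<and> inp_ok (inp s) \<and> arr s aRep = rep"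

lemma frameD:
  assumes "frame N NN B R PP QQ"
  shows "N = n" "NN = n * n" "B = base \<Gamma>" "p < n \<Longrightarrow> R p = p * n"
    "i < n * n \<Longrightarrow> PP i = i div n" "i < n * n \<Longrightarrow> QQ i = i mod n"
  using assms by (auto simp: frame_def)

lemma n_pos: "0 < n"
  using base_less by simp

lemma index_less: "p < n \<Longrightarrow> j < k \<Longrightarrow> 2 + k * p + j < L"
proof -
  assume "p < n" "j < k"
  then have "k * p + j < k * Suc p" by simp
  also have "\<dots> \<le> k * n" using \<open>p < n\<close> by (intro mult_le_mono2) simp
  finally show ?thesis by simp
qed

lemma rep_ok_init: "(\<And>p. p < n \<Longrightarrow> rep p = p) \<Longrightarrow> rep_ok rep"
  by (simp add: rep_ok_def forced_refl')

section \<open>Initialisation and construction of the quotient table\<close>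

lemma triple_init:
  "triple M L (\<lambda>s. s = initial_store (encode_graph as \<Gamma>)) init (Suc (n * n))
    (\<lambda>s. \<exists>rep. ready rep s \<and> rep_ok rep \<and> (\<forall>x P. tabs s x P = 0))"
proof -
  define Z where "Z s \<longleftrightarrow> var s vN = n \<and> var s vB = base \<Gamma> \<and> inp_ok (inp s) \<and> (\<forall>x P. tabs s x P = 0)" for s
  have card: "card (vertices \<Gamma>) = n" by (simp add: vertices)
  note enc = encode_graph_nth[where as = as, OF card, folded k_def]
  have 1: "triple M L (\<lambda>s. s = initial_store (encode_graph as \<Gamma>))
      (Read vN (ENum 0) ;; Read vB (ENum 1) ;; Assign vNN (ENum 0)) (Suc (n * n))
      (\<lambda>s. (Z s \<and> var s vNN = 0) \<and> var s vN = n)"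
    by (rule triple_wp) (use enc index_less in \<open>auto simp: Z_def initial_store_def inp_ok_def\<close>)
  define I1 where "I1 p s \<longleftrightarrow> Z s \<and> var s vNN = p * n \<and> (\<forall>i < p. arr s aRep i = i \<and> arr s aR i = i * n)" for p s
  have 2: "triple M L (\<lambda>s. I1 0 s \<and> var s vN = n) init_reps (Suc (n * n)) (\<lambda>s. I1 n s \<and> var s vN = n)"
    unfolding init_reps_def
    by (rule triple_for) (auto simp: I1_def Z_def less_Suc_eq)
  \<comment> \<open>Quotient and remainder of \<open>i\<close> by \<open>n\<close> are maintained by
    counting with carry.\<close>
  define I2 where "I2 i s \<longleftrightarrow> I1 n s \<and> var s vP = i div n \<and> var s vQ = i mod n \<and>
    (\<forall>i' < i. arr s aPP i' = i' div n \<and> arr s aQQ i' = i' mod n)" for i s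
  have 3: "triple M L (\<lambda>s. I2 0 s \<and> var s vNN = n * n) init_pairs (Suc (n * n)) (\<lambda>s. I2 (n * n) s \<and> var s vNN = n * n)"
    unfolding init_pairs_def
  proof (rule triple_for)
    fix i s assume *: "i < n * n" "I2 i s" "var s vI = i" "var s vNN = n * n"
    have "i mod n < n" using n_pos by simp
    then show "wp L (SetArr aPP (EVar vI) (EVar vP) ;;
      SetArr aQQ (EVar vI) (EVar vQ) ;;
      Assign vQ (EVar vQ [+] ENum 1) ;;
      Cond (EVar vN [-] EVar vQ) Skip (Assign vQ (ENum 0) ;; Assign vP (EVar vP [+] ENum 1)))
      (\<lambda>s. I2 (Suc i) s \<and> var s vI = i \<and> var s vNN = n * n) s"
      using * by (auto simp: I2_def I1_def Z_def less_Suc_eq mod_Suc div_Suc)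
  qed (auto simp: I2_def I1_def Z_def)
  have "triple M L (\<lambda>s. I1 n s \<and> var s vN = n) (Assign vP (ENum 0) ;; Assign vQ (ENum 0)) (Suc (n * n))
      (\<lambda>s. I2 0 s \<and> var s vNN = n * n)"
    by (rule triple_wp) (auto simp: I2_def I1_def Z_def)
  from triple_seq[OF this 3] have 4: "triple M L (\<lambda>s. I1 n s \<and> var s vN = n)
     ((Assign vP (ENum 0) ;; Assign vQ (ENum 0)) ;; init_pairs) (Suc (n * n)) (\<lambda>s. I2 (n * n) s \<and> var s vNN = n * n)" .
  have 5: "triple M L (\<lambda>s. (Z s \<and> var s vNN = 0) \<and> var s vN = n) init_reps (Suc (n * n)) (\<lambda>s. I1 n s \<and> var s vN = n)"
    by (rule triple_conseq[OF 2]) (auto simp: I1_def)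
  have post: "\<exists>rep. ready rep s \<and> rep_ok rep \<and> (\<forall>x P. tabs s x P = 0)"
    if "I2 (n * n) s \<and> var s vNN = n * n" for s
  proof (intro exI conjI)
    show "rep_ok (arr s aRep)" using that by (intro rep_ok_init) (simp add: I2_def I1_def)
  qed (use that in \<open>simp_all add: I2_def I1_def Z_def frame_def\<close>)
  show ?thesis unfolding init_def
    by (rule triple_conseq[OF triple_seq[OF 1 triple_seq[OF 5 4]] _ post]) simp_all
qed

text \<open>Only \<open>n\<close> cells per column are cleared. That the cells beyond are zero must
  already hold, which is why this property is carried through all rounds.\<close>

lemma triple_clear:
  "triple M L (\<lambda>s. ready rep s \<and> var s vU = 0 \<and> var s vW = 0 \<and> (\<forall>x < 2 * k. \<forall>P \<ge> n. tabs s x P = 0)) (clear k) (Suc n)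
    (\<lambda>s. ready rep s \<and> var s vU = 0 \<and> var s vW = 0 \<and> (\<forall>x < 2 * k. \<forall>P. tabs s x P = 0))"
proof -
  define I where "I p s \<longleftrightarrow> ready rep s \<and> var s vU = 0 \<and> var s vW = 0 \<and>
    (\<forall>x < 2 * k. \<forall>P. P < p \<or> n \<le> P \<longrightarrow> tabs s x P = 0)" for p s
  have "triple M L (\<lambda>s. I 0 s \<and> var s vN = n) (clear k) (Suc n) (\<lambda>s. I n s \<and> var s vN = n)"
    unfolding clear_def
  proof (rule triple_for)
    fix p s assume *: "p < n" "I p s" "var s vI = p" "var s vN = n"
    define J where "J j s \<longleftrightarrow> I p s \<and> (\<forall>x < j. tabs s x p = 0) \<and> var s vI = p" for j s
    have "wp L (seqs (map (\<lambda>x. SetArr (aT x) (EVar vI) (ENum 0)) [0..<2*k])) (J (2 * k)) s"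
      by (rule wp_seqs) (use * in \<open>auto simp: J_def I_def less_Suc_eq\<close>)
    then show "wp L (seqs (map (\<lambda>x. SetArr (aT x) (EVar vI) (ENum 0)) [0..<2*k]))
       (\<lambda>s. I (Suc p) s \<and> var s vI = p \<and> var s vN = n) s"
      by (rule wp_mono) (auto simp: J_def I_def less_Suc_eq dest: frameD(1))
  qed (auto simp: I_def)
  then show ?thesis
    by (rule triple_conseq) (auto simp: I_def dest: frameD(1), meson not_le)
qed

text \<open>Free cell, equal entry and clash correspond to the three \<open>tab_enter\<close>
  lemmas. Recording a clash must not destroy \<open>p\<close> and \<open>q\<close>, which are used
  again for the reverse direction of the edge.\<close>

lemma wp_enter:
  assumes "tab E (tabs s) (var s vU) (var s vW)" "var s p = P" "var s q = Q" "x < 2 * k"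
    "p \<noteq> vU" "q \<noteq> vU" "p \<noteq> vW" "q \<noteq> vW" "ready rep s"
  shows "wp L (enter x p q) (\<lambda>s'. ready rep s' \<and> tab (insert (P, x, Q) E) (tabs s') (var s' vU) (var s' vW) \<and>
    var s' p = P \<and> var s' q = Q \<and> var s' vI = var s vI) s"
proof (cases "arr s (aT x) P")
  case 0
  have "(\<lambda>y. ((arr s)(aT x := (arr s (aT x))(P := Suc Q))) (aT y)) = (tabs s)(x := (tabs s x)(P := Suc Q))"
    by (auto simp: fun_eq_iff)
  with tab_enter_new[OF assms(1), of x P Q] 0 show ?thesis
    using assms by (simp add: enter_def)
next
  case (Suc Q')
  then show ?thesis
    using assms tab_enter_old[OF assms(1), of x P Q] tab_enter_conflict[OF assms(1), of x P Q' Q]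
    by (cases "Q' = Q") (simp_all add: enter_def)
qed

lemma triple_build:
  assumes rep: "rep_ok rep"
  shows "triple M L (\<lambda>s. ready rep s \<and> var s vU = 0 \<and> var s vW = 0 \<and> (\<forall>x < 2 * k. \<forall>P. tabs s x P = 0)) (build k) (Suc n)
    (\<lambda>s. ready rep s \<and> tab (entered rep n 0) (tabs s) (var s vU) (var s vW))"
proof -
  define I where "I p s \<longleftrightarrow> ready rep s \<and> tab (entered rep p 0) (tabs s) (var s vU) (var s vW)" for p s
  have "triple M L (\<lambda>s. I 0 s \<and> var s vN = n) (build k) (Suc n) (\<lambda>s. I n s \<and> var s vN = n)"
    unfolding build_def
  proof (rule triple_for)
    fix p s assume *: "p < n" "I p s" "var s vI = p" "var s vN = n"
    define J where "J j s \<longleftrightarrow> ready rep s \<and> tab (entered rep p j) (tabs s) (var s vU) (var s vW) \<and> var s vI = p" for j s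
    have "wp L (seqs (map (build_entry k) [0..<k])) (J k) s"
    proof (rule wp_seqs)
      fix j s assume j: "j < k" and J: "J j s"
      have idx: "Suc (Suc (j + k * p)) < L" using index_less[OF *(1) j] by simp
      have inp: "inp s (Suc (Suc (j + k * p))) = table_entry \<Gamma> p (as ! j)"
        using J *(1) j by (auto simp: J_def inp_ok_def ac_simps)
      show "wp L (build_entry k j) (J (Suc j)) s"
      proof (cases "table_entry \<Gamma> p (as ! j)")
        case 0
        then have "\<not> traverses \<Gamma> p (letter j) q" for q using table_entry_eq[OF j, of p q] by simp
        then have "entered rep p (Suc j) = entered rep p j" by (rule entered_Suc_none)
        then show ?thesis using J 0 inp idx by (simp add: build_entry_def J_def)
      next
        case (Suc q)
        then have tr: "traverses \<Gamma> p (letter j) q" using table_entry_eq[OF j] by simp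
        let ?s = "s\<lparr>var := (var s)(vE := Suc q, vP := rep p, vQ := rep q)\<rparr>"
        let ?E = "insert (rep p, j, rep q) (entered rep p j)"
        have "wp L (enter j vP vQ) (\<lambda>s'. ready rep s' \<and> tab ?E (tabs s') (var s' vU) (var s' vW) \<and>
          var s' vP = rep p \<and> var s' vQ = rep q \<and> var s' vI = var ?s vI) ?s"
          by (rule wp_enter) (use J j in \<open>auto simp: J_def\<close>)
        then have "wp L (enter j vP vQ) (wp L (enter (k + j) vQ vP) (J (Suc j))) ?s"
        proof (rule wp_mono)
          fix s' assume s': "ready rep s' \<and> tab ?E (tabs s') (var s' vU) (var s' vW) \<and>
            var s' vP = rep p \<and> var s' vQ = rep q \<and> var s' vI = var ?s vI"
          have "wp L (enter (k + j) vQ vP) (\<lambda>s''. ready rep s'' \<and>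
              tab (insert (rep q, k + j, rep p) ?E) (tabs s'') (var s'' vU) (var s'' vW) \<and>
              var s'' vQ = rep q \<and> var s'' vP = rep p \<and> var s'' vI = var s' vI) s'"
            by (rule wp_enter) (use s' j in auto)
          then show "wp L (enter (k + j) vQ vP) (J (Suc j)) s'"
            by (rule wp_mono) (use s' J in \<open>auto simp: J_def entered_Suc[OF tr j]\<close>)
        qed
        then show ?thesis using J Suc inp idx by (simp add: build_entry_def J_def)
      qed
    qed (use * in \<open>simp add: I_def J_def\<close>)
    then show "wp L (seqs (map (build_entry k) [0..<k])) (\<lambda>s. I (Suc p) s \<and> var s vI = p \<and> var s vN = n) s"
      by (rule wp_mono) (auto simp: J_def I_def entered_row dest: frameD(1))
  qed (auto simp: I_def)
  then show ?thesis
    by (rule triple_conseq) (auto simp: I_def entered_0 tab_empty dest: frameD(1))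
qed


section \<open>The stripping phase of a round\<close>

definition alive :: "(nat \<Rightarrow> nat) \<Rightarrow> nat set" where
  "alive f = {i. i < n * n \<and> f i \<noteq> 0}"

definition mergeable :: "(nat \<Rightarrow> nat) \<Rightarrow> nat \<Rightarrow> nat \<Rightarrow> bool" where
  "mergeable rep u v \<longleftrightarrow> u < n \<and> v < n \<and> rep u = u \<and> rep v = v \<and> forced A \<Gamma> u v"

lemma alive_update: "i < n * n \<Longrightarrow> alive (f(i := 0)) = alive f - {i}"
  by (auto simp: alive_def)

context
  fixes rep T
  assumes rep: "rep_ok rep" and T: "table_ok rep T"
begin

definition stripping :: "store \<Rightarrow> bool" where
  "stripping s \<longleftrightarrow> ready rep s \<and> tabs s = T \<and> var s vU = var s vW"

lemma triple_init_alive: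
  "triple M L stripping init_alive (Suc (n * n)) (\<lambda>s. stripping s \<and> alive (arr s aAl) = offdiag)"
proof -
  define I where "I i s \<longleftrightarrow> stripping s \<and> (\<forall>i' < i. arr s aAl i' \<noteq> 0 \<longleftrightarrow> i' div n \<noteq> i' mod n)" for i s
  have "triple M L (\<lambda>s. I 0 s \<and> var s vNN = n * n) init_alive (Suc (n * n)) (\<lambda>s. I (n * n) s \<and> var s vNN = n * n)"
    unfolding init_alive_def
  proof (rule triple_for)
    fix i s assume *: "i < n * n" "I i s" "var s vI = i" "var s vNN = n * n"
    then have "framed s" by (simp add: I_def stripping_def)
    then have "arr s aPP i = i div n" "arr s aQQ i = i mod n" using frameD(5,6) *(1) by blast+
    then show "wp L (SetArr aAl (EVar vI) (eneq (EArr aPP (EVar vI)) (EArr aQQ (EVar vI))))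
        (\<lambda>s. I (Suc i) s \<and> var s vI = i \<and> var s vNN = n * n) s"
      using * by (simp add: I_def stripping_def less_Suc_eq)
  qed (simp_all add: I_def stripping_def)
  then show ?thesis
  proof (rule triple_conseq)
    show "stripping s \<Longrightarrow> I 0 s \<and> var s vNN = n * n" for s
      by (simp add: I_def stripping_def frame_def)
    show "I (n * n) s \<and> var s vNN = n * n \<Longrightarrow> stripping s \<and> alive (arr s aAl) = offdiag" for s
      by (auto simp: I_def alive_def offdiag_def)
  qed simp
qed

lemma wp_scan:
  assumes s: "stripping s" "var s vJ = J" "J < n * n" "x < 2 * k" and S: "S = alive (arr s aAl)"
  shows "wp L (scan x) (\<lambda>s'. stripping s' \<and> var s' vI = var s vI \<and> var s' vJ = J \<and> arr s' aAl = arr s aAl \<and>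
    (if \<exists>e \<in> S. nbr T x J e then var s' vD = Suc (var s vD) \<and> var s' vX \<in> S \<and> nbr T x J (var s' vX)
     else var s' vD = var s vD \<and> var s' vX = var s vX)) s"
proof -
  have fr: "framed s" and Tx: "arr s (aT x) = T x"
    using s(1) by (auto simp: stripping_def fun_eq_iff)
  have pp: "arr s aPP J = J div n" "arr s aQQ J = J mod n" using frameD(5,6)[OF fr s(3)] by blast+
  show ?thesis
  proof (cases "T x (J div n) = 0 \<or> T x (J mod n) = 0")
    case True
    then have "\<not> nbr T x J e" for e by (auto simp: nbr_def)
    then show ?thesis using True s pp Tx by (auto simp: scan_def)
  next
    case False
    then obtain P Q where PQ: "T x (J div n) = Suc P" "T x (J mod n) = Suc Q"
      by (metis not0_implies_Suc)
    then have less: "P < n" "Q < n" using table_entry_less[OF rep T s(4)] by blast+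
    define e where "e = P * n + Q"
    have R: "arr s aR P = P * n" using frameD(4)[OF fr less(1)] .
    have nbr: "nbr T x J e' \<longleftrightarrow> e' = e" for e' using PQ by (simp add: nbr_def e_def)
    have "e < n * n" using code_less[OF less] by (simp add: e_def)
    then have "e \<in> S \<longleftrightarrow> arr s aAl e \<noteq> 0" by (simp add: S alive_def)
    then show ?thesis using s pp Tx PQ R by (simp add: scan_def nbr e_def[symmetric] stripping_def)
  qed
qed

lemma wp_strip_step:
  assumes s: "stripping s" "strip_inv T (alive (arr s aAl)) (var s vI) (var s vJ)" "var s vI < n * n"
  shows "wp L (strip_step k) (\<lambda>s'. stripping s' \<and> strip_inv T (alive (arr s' aAl)) (var s' vI) (var s' vJ) \<and>
    card (alive (arr s' aAl)) + (n * n - var s' vI) < card (alive (arr s aAl)) + (n * n - var s vI)) s"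
    (is "wp _ _ ?Q _")
proof -
  define S where "S = alive (arr s aAl)"
  define I where "I = var s vI"
  define J where "J = var s vJ"
  have J: "J < n * n" using s(2,3) by (simp add: strip_inv_def J_def)
  have fin: "finite S" by (simp add: S_def alive_def)
  \<comment> \<open>After \<open>j\<close> letters, \<open>vD\<close> holds their share of the
    degree, and \<open>vX\<close> is an alive neighbour or still \<open>J\<close>, the default that
    \<open>strip_kill\<close> expects in degree 0.\<close>
  define K where "K j s' \<longleftrightarrow> stripping s' \<and> var s' vI = I \<and> var s' vJ = J \<and> arr s' aAl = arr s aAl \<and>
    var s' vD = card {x. x < j \<and> (\<exists>e \<in> S. nbr T x J e)} \<and> (var s' vD = 0 \<longrightarrow> var s' vX = J) \<and>
    (var s' vD \<noteq> 0 \<longrightarrow> var s' vX \<in> S \<and> (\<exists>y < j. nbr T y J (var s' vX)))" for j s'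
  let ?s = "s\<lparr>var := (var s)(vD := 0, vX := J)\<rparr>"
  have "wp L (seqs (map scan [0..<2*k])) (K (2 * k)) ?s"
  proof (rule wp_seqs)
    fix x s' assume x: "x < 2 * k" and K: "K x s'"
    have "wp L (scan x) (\<lambda>s''. stripping s'' \<and> var s'' vI = var s' vI \<and> var s'' vJ = J \<and> arr s'' aAl = arr s' aAl \<and>
      (if \<exists>e \<in> S. nbr T x J e then var s'' vD = Suc (var s' vD) \<and> var s'' vX \<in> S \<and> nbr T x J (var s'' vX)
       else var s'' vD = var s' vD \<and> var s'' vX = var s' vX)) s'"
      by (rule wp_scan[OF _ _ J x]) (use K in \<open>simp_all add: K_def S_def\<close>)
    then show "wp L (scan x) (K (Suc x)) s'"
    proof (rule wp_mono)
      fix s'' assume *: "stripping s'' \<and> var s'' vI = var s' vI \<and> var s'' vJ = J \<and> arr s'' aAl = arr s' aAl \<and>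
        (if \<exists>e \<in> S. nbr T x J e then var s'' vD = Suc (var s' vD) \<and> var s'' vX \<in> S \<and> nbr T x J (var s'' vX)
         else var s'' vD = var s' vD \<and> var s'' vX = var s' vX)"
      show "K (Suc x) s''"
      proof (cases "\<exists>e \<in> S. nbr T x J e")
        case True
        then show ?thesis using * K unfolding K_def card_less_Suc_if by auto
      next
        case False
        then show ?thesis using * K unfolding K_def card_less_Suc_if by (auto intro: less_SucI)
      qed
    qed
  qed (use s in \<open>simp add: K_def stripping_def I_def J_def\<close>)
  then have "wp L (seqs (map scan [0..<2*k])) (wp L (Cond (EArr aAl (EVar vJ))
       (Cond (EVar vD [-] ENum 1) advance (SetArr aAl (EVar vJ) (ENum 0) ;; Assign vJ (EVar vX))) advance) ?Q) ?s"
  proof (rule wp_mono)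
    fix s' assume K: "K (2 * k) s'"
    then have D: "var s' vD = deg T S J" by (simp add: K_def deg_def)
    have JS: "arr s' aAl J \<noteq> 0 \<longleftrightarrow> J \<in> S" using K J by (simp add: K_def S_def alive_def)
    have inv: "strip_inv T S I J" using s(2) by (simp add: S_def I_def J_def)
    have m: "n * n - Suc I < n * n - I" using s(3) by (simp add: I_def)
    have al: "alive (arr s' aAl) = S" using K by (simp add: K_def S_def)
    show "wp L (Cond (EArr aAl (EVar vJ))
       (Cond (EVar vD [-] ENum 1) advance (SetArr aAl (EVar vJ) (ENum 0) ;; Assign vJ (EVar vX))) advance) ?Q s'"
    proof (cases "J \<in> S \<and> deg T S J \<le> 1")
      case True
      have "strip_inv T (S - {J}) I (var s' vX)"
        by (rule strip_kill[OF rep T inv]) (use True K D s(3) in \<open>auto simp: K_def I_def\<close>)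
      moreover have "card (S - {J}) < card S" using True fin by (meson card_Diff1_less)
      ultimately show ?thesis using True K D JS J al
        by (simp add: K_def stripping_def alive_update S_def[symmetric] I_def[symmetric])
    next
      case False
      then have "strip_inv T S (Suc I) (Suc I)" by (intro strip_advance[OF rep T inv]) auto
      then show ?thesis using False K D JS al m
        by (simp add: K_def advance_def stripping_def S_def[symmetric] I_def[symmetric])
    qed
  qed
  then show ?thesis by (simp add: strip_step_def J_def)
qed

text \<open>The measure adds the number of alive pairs and the number of scan positions left, each
  at most \<open>n * n\<close>.\<close>

lemma triple_strip_loop:
  "triple M L (\<lambda>s. stripping s \<and> alive (arr s aAl) = offdiag \<and> var s vI = 0 \<and> var s vJ = 0) (strip_loop k) (Suc (2 * n * n))
    (\<lambda>s. stripping s \<and> (\<exists>I J. strip_inv T (alive (arr s aAl)) I J \<and> n * n \<le> I))"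
proof -
  define \<mu> :: "store \<Rightarrow> nat" where "\<mu> s = card (alive (arr s aAl)) + (n * n - var s vI)" for s
  define I where "I s \<longleftrightarrow> stripping s \<and> strip_inv T (alive (arr s aAl)) (var s vI) (var s vJ)" for s
  have "triple M L (\<lambda>s. I s \<and> val (EVar vNN [-] EVar vI) s \<noteq> 0 \<and> \<mu> s = m) (strip_step k) 1 (\<lambda>s. I s \<and> \<mu> s < m)" for m
  proof (rule triple_wp)
    fix s assume *: "I s \<and> val (EVar vNN [-] EVar vI) s \<noteq> 0 \<and> \<mu> s = m"
    then have "var s vNN = n * n" by (simp add: I_def stripping_def frame_def)
    then show "wp L (strip_step k) (\<lambda>s. I s \<and> \<mu> s < m) s"
      using wp_strip_step[of s] * by (auto simp: I_def \<mu>_def elim!: wp_mono)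
  qed simp
  from triple_while[OF this, of "2 * n * n"] show ?thesis
    unfolding strip_loop_def
  proof (rule triple_conseq)
    fix s assume *: "stripping s \<and> alive (arr s aAl) = offdiag \<and> var s vI = 0 \<and> var s vJ = 0"
    have "card offdiag \<le> card {..<n * n}" by (intro card_mono) (auto simp: offdiag_def)
    then show "I s \<and> \<mu> s \<le> 2 * n * n"
      using * strip_init by (simp add: I_def \<mu>_def)
  next
    fix s assume *: "I s \<and> val (EVar vNN [-] EVar vI) s = 0"
    then have "var s vNN = n * n" by (simp add: I_def stripping_def frame_def)
    then show "stripping s \<and> (\<exists>I J. strip_inv T (alive (arr s aAl)) I J \<and> n * n \<le> I)"
      using * by (auto simp: I_def)
  qed simp_all
qed

text \<open>Any surviving pair may be merged, so it does no harm that later ones overwrite earlier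
  ones. If none is found, the stripped set is empty and \<open>core_empty\<close> applies.\<close>

lemma triple_find_alive:
  "triple M L (\<lambda>s. stripping s \<and> (\<exists>I J. strip_inv T (alive (arr s aAl)) I J \<and> n * n \<le> I)) find_alive (Suc (n * n))
    (\<lambda>s. ready rep s \<and> tabs s = T \<and> (var s vU = var s vW \<longrightarrow> (\<forall>P Q. \<not> core_pair (quot rep) P Q)) \<and>
      (var s vU \<noteq> var s vW \<longrightarrow> mergeable rep (var s vU) (var s vW)))"
proof -
  define I where "I i s \<longleftrightarrow> ready rep s \<and> tabs s = T \<and> (\<exists>I J. strip_inv T (alive (arr s aAl)) I J \<and> n * n \<le> I) \<and>
    (var s vU = var s vW \<longrightarrow> (\<forall>i' < i. i' \<notin> alive (arr s aAl))) \<and>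
    (var s vU \<noteq> var s vW \<longrightarrow> mergeable rep (var s vU) (var s vW))" for i s
  have "triple M L (\<lambda>s. I 0 s \<and> var s vNN = n * n) find_alive (Suc (n * n)) (\<lambda>s. I (n * n) s \<and> var s vNN = n * n)"
    unfolding find_alive_def
  proof (rule triple_for)
    fix i s assume *: "i < n * n" "I i s" "var s vI = i" "var s vNN = n * n"
    then have "framed s" by (simp add: I_def)
    then have pp: "arr s aPP i = i div n" "arr s aQQ i = i mod n" using frameD(5,6) *(1) by blast+
    have *: "i div n \<noteq> i mod n \<and> mergeable rep (i div n) (i mod n)" if i: "i \<in> alive (arr s aAl)"
    proof -
      obtain I J where inv: "strip_inv T (alive (arr s aAl)) I J" "n * n \<le> I" using * by (auto simp: I_def)
      have "alive (arr s aAl) \<subseteq> offdiag" using inv by (simp add: strip_inv_def)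
      moreover have "finite (alive (arr s aAl))" by (simp add: alive_def)
      ultimately show ?thesis
        using core_forced[OF rep T _ strip_final[OF rep T inv] _ i] i by (auto simp: mergeable_def offdiag_def)
    qed
    have al: "arr s aAl i \<noteq> 0 \<longleftrightarrow> i \<in> alive (arr s aAl)" using \<open>i < n * n\<close> by (simp add: alive_def)
    show "wp L (Cond (EArr aAl (EVar vI)) (Assign vU (EArr aPP (EVar vI)) ;; Assign vW (EArr aQQ (EVar vI))) Skip)
        (\<lambda>s. I (Suc i) s \<and> var s vI = i \<and> var s vNN = n * n) s"
    proof (cases "i \<in> alive (arr s aAl)")
      case True
      then show ?thesis using * \<open>I i s\<close> \<open>var s vI = i\<close> \<open>var s vNN = n * n\<close> al pp by (simp add: I_def)
    next
      case False
      then show ?thesis using \<open>I i s\<close> \<open>var s vI = i\<close> \<open>var s vNN = n * n\<close> al by (auto simp: I_def less_Suc_eq)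
    qed
  qed (simp_all add: I_def)
  then show ?thesis
  proof (rule triple_conseq)
    show "stripping s \<and> (\<exists>I J. strip_inv T (alive (arr s aAl)) I J \<and> n * n \<le> I) \<Longrightarrow> I 0 s \<and> var s vNN = n * n" for s
      by (simp add: I_def stripping_def frame_def)
  next
    fix s assume *: "I (n * n) s \<and> var s vNN = n * n"
    obtain I J where inv: "strip_inv T (alive (arr s aAl)) I J" using * by (auto simp: I_def)
    have "\<not> core_pair (quot rep) P Q" if "var s vU = var s vW" for P Q
    proof -
      have "alive (arr s aAl) = {}" using * that by (auto simp: I_def alive_def)
      then show ?thesis using core_empty[OF rep T, of I J] inv by simp
    qed
    then show "ready rep s \<and> tabs s = T \<and> (var s vU = var s vW \<longrightarrow> (\<forall>P Q. \<not> core_pair (quot rep) P Q)) \<and>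
      (var s vU \<noteq> var s vW \<longrightarrow> mergeable rep (var s vU) (var s vW))"
      using * unfolding I_def by blast
  qed simp
qed

lemma triple_strip:
  "triple M L stripping (strip k) (Suc (2 * n * n))
    (\<lambda>s. ready rep s \<and> tabs s = T \<and> (var s vU = var s vW \<longrightarrow> (\<forall>P Q. \<not> core_pair (quot rep) P Q)) \<and>
      (var s vU \<noteq> var s vW \<longrightarrow> mergeable rep (var s vU) (var s vW)))"
  unfolding strip_def
proof (intro triple_seq)
  show "triple M L stripping init_alive (Suc (2 * n * n)) (\<lambda>s. stripping s \<and> alive (arr s aAl) = offdiag)"
    by (rule triple_conseq[OF triple_init_alive]) simp_all
  show "triple M L (\<lambda>s. stripping s \<and> alive (arr s aAl) = offdiag) (Assign vI (ENum 0)) (Suc (2 * n * n))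
      (\<lambda>s. (stripping s \<and> alive (arr s aAl) = offdiag) \<and> var s vI = 0)"
    by (rule triple_wp) (simp_all add: stripping_def)
  show "triple M L (\<lambda>s. (stripping s \<and> alive (arr s aAl) = offdiag) \<and> var s vI = 0) (Assign vJ (ENum 0)) (Suc (2 * n * n))
      (\<lambda>s. stripping s \<and> alive (arr s aAl) = offdiag \<and> var s vI = 0 \<and> var s vJ = 0)"
    by (rule triple_wp) (simp_all add: stripping_def)
qed (rule triple_strip_loop triple_conseq[OF triple_find_alive]; simp)+

end

section \<open>Rounds and the main loop\<close>

abbreviation zero_outside :: "store \<Rightarrow> bool" where
  "zero_outside s \<equiv> \<forall>x < 2 * k. \<forall>P \<ge> n. tabs s x P = 0"

lemma tab_zero_outside:
  assumes "rep_ok rep" "tab (entered rep n 0) T u v" "x < 2 * k" "n \<le> P"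
  shows "T x P = 0"
proof (rule ccontr)
  assume "T x P \<noteq> 0"
  then obtain Q where "T x P = Suc Q" by (metis not0_implies_Suc)
  then have "traverses (quot rep) P (letter x) Q"
    using assms(2,3) unfolding tab_def entered_all by blast
  then show False using quot_traverses_rep(1)[OF assms(1)] assms(4) by fastforce
qed

lemma triple_merge_loop:
  "triple M L (\<lambda>s. ready rep s \<and> zero_outside s \<and> var s vU = u \<and> var s vW = v) merge_loop (Suc n)
    (\<lambda>s. ready (merge rep u v) s \<and> zero_outside s)"
proof -
  define I where "I p s \<longleftrightarrow> framed s \<and> inp_ok (inp s) \<and> zero_outside s \<and> var s vU = u \<and> var s vW = v \<and>
    arr s aRep = (\<lambda>i. if i < p \<and> rep i = v then u else rep i)" for p s
  have "triple M L (\<lambda>s. I 0 s \<and> var s vN = n) merge_loop (Suc n) (\<lambda>s. I n s \<and> var s vN = n)"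
    unfolding merge_loop_def
    by (rule triple_for) (auto simp: I_def less_Suc_eq fun_eq_iff)
  then show ?thesis
  proof (rule triple_conseq)
    show "ready rep s \<and> zero_outside s \<and> var s vU = u \<and> var s vW = v \<Longrightarrow> I 0 s \<and> var s vN = n" for s
      by (simp add: I_def frame_def)
    show "I n s \<and> var s vN = n \<Longrightarrow> ready (merge rep u v) s \<and> zero_outside s" for s
      unfolding I_def merge_def[abs_def] by blast
  qed simp
qed

definition finished :: "(nat \<Rightarrow> nat) \<Rightarrow> store \<Rightarrow> bool" where
  "finished rep s \<longleftrightarrow> ready rep s \<and> rep_ok rep \<and> table_ok rep (tabs s) \<and> (\<forall>P Q. \<not> core_pair (quot rep) P Q)"

definition working :: "(nat \<Rightarrow> nat) \<Rightarrow> store \<Rightarrow> bool" where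
  "working rep s \<longleftrightarrow> ready rep s \<and> rep_ok rep \<and> zero_outside s"

definition searched :: "(nat \<Rightarrow> nat) \<Rightarrow> store \<Rightarrow> bool" where
  "searched rep s \<longleftrightarrow> ready rep s \<and> zero_outside s \<and>
     (var s vU = var s vW \<longrightarrow> table_ok rep (tabs s) \<and> (\<forall>P Q. \<not> core_pair (quot rep) P Q)) \<and>
     (var s vU \<noteq> var s vW \<longrightarrow> mergeable rep (var s vU) (var s vW))"

lemma n_le_square: "n \<le> n * n"
  using n_pos by simp

lemma triple_search:
  assumes rep: "rep_ok rep"
  shows "triple M L (\<lambda>s. ready rep s \<and> tab (entered rep n 0) (tabs s) (var s vU) (var s vW))
    (Cond (eneq (EVar vU) (EVar vW)) Skip (strip k)) (Suc (2 * n * n)) (searched rep)"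
proof (rule triple_cond)
  show "triple M L (\<lambda>s. (ready rep s \<and> tab (entered rep n 0) (tabs s) (var s vU) (var s vW)) \<and>
      val (eneq (EVar vU) (EVar vW)) s \<noteq> 0) Skip (Suc (2 * n * n)) (searched rep)"
  proof (rule triple_wp)
    fix s assume *: "(ready rep s \<and> tab (entered rep n 0) (tabs s) (var s vU) (var s vW)) \<and>
      val (eneq (EVar vU) (EVar vW)) s \<noteq> 0"
    then have uv: "var s vU \<noteq> var s vW" and t: "tab (entered rep n 0) (tabs s) (var s vU) (var s vW)"
      by simp_all
    show "wp L Skip (searched rep) s"
      using * uv tab_conflict[OF rep t uv] tab_zero_outside[OF rep t]
      by (simp add: searched_def mergeable_def)
  qed simp
next
  \<comment> \<open>The stripping triples hold for a fixed correct table. The current table is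
    therefore named \<open>T\<close>, an incorrect one making the precondition unsatisfiable, and
    \<open>T\<close> is then quantified in the precondition.\<close>
  have "triple M L (\<lambda>s. table_ok rep T \<and> stripping rep T s) (strip k) (Suc (2 * n * n)) (searched rep)" for T
  proof (cases "table_ok rep T")
    case True
    have zero: "T x P = 0" if "x < 2 * k" "n \<le> P" for x P
      using table_entry_less[OF rep True that(1)] that(2) by (cases "T x P") fastforce+
    show ?thesis
    proof (rule triple_conseq[OF triple_strip[OF rep True]])
      fix s assume s: "ready rep s \<and> tabs s = T \<and> (var s vU = var s vW \<longrightarrow> (\<forall>P Q. \<not> core_pair (quot rep) P Q)) \<and>
        (var s vU \<noteq> var s vW \<longrightarrow> mergeable rep (var s vU) (var s vW))"
      then have "tabs s x = T x" for x by (simp add: fun_eq_iff)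
      then have "zero_outside s" using zero by simp
      then show "searched rep s" using s True by (simp add: searched_def)
    qed simp_all
  qed (simp add: triple_def)
  then have "triple M L (\<lambda>s. \<exists>T. table_ok rep T \<and> stripping rep T s) (strip k) (Suc (2 * n * n)) (searched rep)"
    by (rule triple_Ex)
  then show "triple M L (\<lambda>s. (ready rep s \<and> tab (entered rep n 0) (tabs s) (var s vU) (var s vW)) \<and>
      val (eneq (EVar vU) (EVar vW)) s = 0) (strip k) (Suc (2 * n * n)) (searched rep)"
  proof (rule triple_conseq)
    fix s assume *: "(ready rep s \<and> tab (entered rep n 0) (tabs s) (var s vU) (var s vW)) \<and>
      val (eneq (EVar vU) (EVar vW)) s = 0"
    then have "var s vU = var s vW" by simp
    moreover from this * have "table_ok rep (tabs s)" by (intro tab_ok[of _ _ "var s vW"]) simp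
    ultimately show "\<exists>T. table_ok rep T \<and> stripping rep T s"
      using * by (intro exI[of _ "tabs s"]) (simp add: stripping_def[OF rep])
  qed simp_all
qed simp

lemma triple_round:
  assumes rep: "rep_ok rep"
  shows "triple M L (working rep) (merge_round k) (Suc (2 * n * n))
    (\<lambda>s. var s vGo \<noteq> 0 \<and> (\<exists>rep'. working rep' s \<and> card (rep' ` {..<n}) < card (rep ` {..<n})) \<or>
      var s vGo = 0 \<and> finished rep s)" (is "triple _ _ _ _ ?B ?Q")
  unfolding merge_round_def
proof (rule triple_seq, rule_tac [2] triple_seq, rule_tac [3] triple_seq, rule_tac [4] triple_seq)
  have B: "Suc n \<le> ?B" using n_le_square by simp
  show "triple M L (working rep) (Assign vU (ENum 0) ;; Assign vW (ENum 0)) ?B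
      (\<lambda>s. ready rep s \<and> var s vU = 0 \<and> var s vW = 0 \<and> zero_outside s)"
    by (rule triple_wp) (simp_all add: working_def)
  show "triple M L (\<lambda>s. ready rep s \<and> var s vU = 0 \<and> var s vW = 0 \<and> zero_outside s) (clear k) ?B
      (\<lambda>s. ready rep s \<and> var s vU = 0 \<and> var s vW = 0 \<and> (\<forall>x < 2 * k. \<forall>P. tabs s x P = 0))"
    by (rule triple_conseq[OF triple_clear]) (use B in simp_all)
  show "triple M L (\<lambda>s. ready rep s \<and> var s vU = 0 \<and> var s vW = 0 \<and> (\<forall>x < 2 * k. \<forall>P. tabs s x P = 0)) (build k) ?B
      (\<lambda>s. ready rep s \<and> tab (entered rep n 0) (tabs s) (var s vU) (var s vW))"
    by (rule triple_conseq[OF triple_build[OF rep]]) (use B in simp_all)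
  show "triple M L (\<lambda>s. ready rep s \<and> tab (entered rep n 0) (tabs s) (var s vU) (var s vW))
      (Cond (eneq (EVar vU) (EVar vW)) Skip (strip k)) ?B (searched rep)"
    by (rule triple_search[OF rep])
  show "triple M L (searched rep)
      (Cond (eneq (EVar vU) (EVar vW)) (merge_loop ;; Assign vGo (ENum 1)) (Assign vGo (ENum 0))) ?B ?Q"
  proof (rule triple_cond)
    have "triple M L (\<lambda>s. searched rep s \<and> var s vU = u \<and> var s vW = v \<and> u \<noteq> v)
        (merge_loop ;; Assign vGo (ENum 1)) ?B ?Q" for u v
    proof (cases "u \<noteq> v \<and> mergeable rep u v")
      case True
      note m = merge[OF rep, of u v]
      have "triple M L (\<lambda>s. searched rep s \<and> var s vU = u \<and> var s vW = v \<and> u \<noteq> v) merge_loop ?B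
          (\<lambda>s. ready (merge rep u v) s \<and> zero_outside s)"
        by (rule triple_conseq[OF triple_merge_loop]) (use B in \<open>simp_all add: searched_def\<close>)
      moreover have "triple M L (\<lambda>s. ready (merge rep u v) s \<and> zero_outside s) (Assign vGo (ENum 1)) ?B ?Q"
      proof (rule triple_wp)
        fix s assume "ready (merge rep u v) s \<and> zero_outside s"
        then have "working (merge rep u v) (s\<lparr>var := (var s)(vGo := 1)\<rparr>)"
          using m(1) True by (simp add: working_def mergeable_def)
        then show "wp L (Assign vGo (ENum 1)) ?Q s"
          using m(2) True unfolding mergeable_def wp.simps by (intro disjI1 conjI exI[of _ "merge rep u v"]) auto
      qed simp
      ultimately show ?thesis by (rule triple_seq)
    qed (auto simp: triple_def searched_def)
    then have "triple M L (\<lambda>s. \<exists>u v. searched rep s \<and> var s vU = u \<and> var s vW = v \<and> u \<noteq> v)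
        (merge_loop ;; Assign vGo (ENum 1)) ?B ?Q"
      by (intro triple_Ex)
    then show "triple M L (\<lambda>s. searched rep s \<and> val (eneq (EVar vU) (EVar vW)) s \<noteq> 0)
        (merge_loop ;; Assign vGo (ENum 1)) ?B ?Q"
      by (rule triple_conseq) auto
    show "triple M L (\<lambda>s. searched rep s \<and> val (eneq (EVar vU) (EVar vW)) s = 0) (Assign vGo (ENum 0)) ?B ?Q"
      by (rule triple_wp) (use rep in \<open>simp_all add: searched_def finished_def\<close>)
  qed simp
qed

text \<open>The measure is one more than the number of classes while the flag is set and 0
  afterwards, so the last round, which merges nothing, also decreases it. It starts with at most
  \<open>n + 1\<close>; the final test makes this \<open>n + 2\<close>.\<close>

lemma triple_main:
  "triple M L (\<lambda>s. \<exists>rep. working rep s \<and> var s vGo \<noteq> 0) (While (EVar vGo) (merge_round k)) ((n + 2) * Suc (2 * n * n))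
    (\<lambda>s. \<exists>rep. finished rep s)"
proof -
  define I where "I s \<longleftrightarrow> (\<exists>rep. var s vGo \<noteq> 0 \<and> working rep s \<or> var s vGo = 0 \<and> finished rep s)" for s
  define \<mu> :: "store \<Rightarrow> nat" where
    "\<mu> s = (if var s vGo = 0 then 0 else Suc (card (arr s aRep ` {..<n})))" for s
  have "triple M L (\<lambda>s. I s \<and> val (EVar vGo) s \<noteq> 0 \<and> \<mu> s = m) (merge_round k) (Suc (2 * n * n)) (\<lambda>s. I s \<and> \<mu> s < m)" for m
  proof -
    have "triple M L (\<lambda>s. working rep s \<and> Suc (card (rep ` {..<n})) = m) (merge_round k) (Suc (2 * n * n)) (\<lambda>s. I s \<and> \<mu> s < m)" for rep
    proof (cases "rep_ok rep \<and> Suc (card (rep ` {..<n})) = m")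
      case True
      show ?thesis
        by (rule triple_conseq[OF triple_round]) (use True in \<open>auto simp: I_def \<mu>_def working_def\<close>)
    qed (auto simp: triple_def working_def)
    then have "triple M L (\<lambda>s. \<exists>rep. working rep s \<and> Suc (card (rep ` {..<n})) = m) (merge_round k) (Suc (2 * n * n)) (\<lambda>s. I s \<and> \<mu> s < m)"
      by (rule triple_Ex)
    then show ?thesis
      by (rule triple_conseq) (auto simp: I_def \<mu>_def working_def)
  qed
  from triple_while[OF this, of "Suc n"] show ?thesis
  proof (rule triple_conseq)
    fix s assume *: "\<exists>rep. working rep s \<and> var s vGo \<noteq> 0"
    have "card (arr s aRep ` {..<n}) \<le> n" using card_image_le[of "{..<n}" "arr s aRep"] by simp
    then show "I s \<and> \<mu> s \<le> Suc n" using * by (auto simp: I_def \<mu>_def)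
  qed (auto simp: I_def)
qed

section \<open>Renumbering and output\<close>

context
  fixes rep T
  assumes rep: "rep_ok rep" and T: "table_ok rep T" and core: "\<And>P Q. \<not> core_pair (quot rep) P Q"
begin

definition numbered :: "store \<Rightarrow> bool" where
  "numbered s \<longleftrightarrow> framed s \<and> arr s aRep = rep \<and> tabs s = T \<and> (\<forall>i < n. rep i = i \<longrightarrow> arr s aNew i = num rep i)"

lemma triple_renumber:
  "triple M L (\<lambda>s. ready rep s \<and> tabs s = T \<and> var s vC = 0) renumber (Suc n) (\<lambda>s. numbered s \<and> var s vC = num rep n)"
proof -
  define I where "I p s \<longleftrightarrow> framed s \<and> arr s aRep = rep \<and> tabs s = T \<and> var s vC = num rep p \<and>
    (\<forall>i < p. rep i = i \<longrightarrow> arr s aNew i = num rep i)" for p s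
  have "triple M L (\<lambda>s. I 0 s \<and> var s vN = n) renumber (Suc n) (\<lambda>s. I n s \<and> var s vN = n)"
    unfolding renumber_def
    by (rule triple_for) (auto simp: I_def less_Suc_eq num_Suc)
  then show ?thesis
    by (rule triple_conseq) (simp_all add: I_def numbered_def num_0 frame_def)
qed

definition entry :: "nat \<Rightarrow> nat \<Rightarrow> nat" where
  "entry P j = (case T j P of 0 \<Rightarrow> 0 | Suc Q \<Rightarrow> Suc (num rep Q))"

text \<open>Only representatives have rows, placed by their rank; \<open>p\<close> and
  \<open>j\<close> mark the progress as in \<open>entered\<close>.\<close>

definition written :: "nat \<Rightarrow> nat \<Rightarrow> (nat \<Rightarrow> nat) \<Rightarrow> bool" where
  "written p j f \<longleftrightarrow> f 0 = num rep n \<and> f 1 = num rep (rep (base \<Gamma>)) \<and>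
     (\<forall>P j'. j' < k \<longrightarrow> rep P = P \<longrightarrow> P < p \<or> P = p \<and> j' < j \<longrightarrow> f (2 + k * num rep P + j') = entry P j')"

text \<open>Ranks increase strictly along representatives, so the new cell differs from all those
  written before.\<close>

lemma written_update:
  assumes "written p j f" "j < k" "rep p = p"
  shows "written p (Suc j) (f(2 + k * num rep p + j := entry p j))"
proof -
  have "2 + k * num rep P + j' \<noteq> 2 + k * num rep p + j" if "P < p \<or> P = p \<and> j' < j" "j' < k" "rep P = P" for P j'
  proof (cases "P = p")
    case False
    then have "num rep P < num rep p" using that num_less by blast
    then have "k * Suc (num rep P) \<le> k * num rep p" by (intro mult_le_mono2) simp
    then show ?thesis using that(2) by simp
  qed (use that in simp)
  then show ?thesis using assms unfolding written_def by (auto simp: less_Suc_eq)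
qed

lemma written_row: "rep p = p \<Longrightarrow> written p k f = written (Suc p) 0 f"
  by (auto simp: written_def less_Suc_eq)

lemma written_skip: "rep p \<noteq> p \<Longrightarrow> written p 0 f = written (Suc p) 0 f"
  by (auto simp: written_def less_Suc_eq)

lemma triple_write_rows:
  "triple M L (\<lambda>s. numbered s \<and> written 0 0 (inp s) \<and> var s vO = 2) (write_rows k) (Suc n)
    (\<lambda>s. written n 0 (inp s))"
proof -
  define I where "I p s \<longleftrightarrow> numbered s \<and> written p 0 (inp s) \<and> var s vO = 2 + k * num rep p" for p s
  have "triple M L (\<lambda>s. I 0 s \<and> var s vN = n) (write_rows k) (Suc n) (\<lambda>s. I n s \<and> var s vN = n)"
    unfolding write_rows_def
  proof (rule triple_for)
    fix p s assume *: "p < n" "I p s" "var s vI = p" "var s vN = n"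
    show "wp L (Cond (eneq (EArr aRep (EVar vI)) (EVar vI)) Skip (seqs (map write_entry [0..<k])))
        (\<lambda>s. I (Suc p) s \<and> var s vI = p \<and> var s vN = n) s"
    proof (cases "rep p = p")
      case False
      then show ?thesis using * by (simp add: I_def numbered_def num_Suc written_skip)
    next
      case True
      define J where "J j s \<longleftrightarrow> numbered s \<and> written p j (inp s) \<and> var s vO = 2 + k * num rep p + j \<and> var s vI = p" for j s
      have "wp L (seqs (map write_entry [0..<k])) (J k) s"
      proof (rule wp_seqs)
        fix j s assume j: "j < k" and J: "J j s"
        have "num rep p < n" using num_le[of rep p] *(1) by simp
        then have less: "2 + k * num rep p + j < L" using index_less j by blast
        have Tj: "arr s (aT j) p = T j p" using J by (auto simp: J_def numbered_def fun_eq_iff)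
        have w: "written p (Suc j) ((inp s)(2 + k * num rep p + j := entry p j))"
          using J j True by (intro written_update) (simp_all add: J_def)
        show "wp L (write_entry j) (J (Suc j)) s"
        proof (cases "T j p")
          case 0
          then have "entry p j = 0" by (simp add: entry_def)
          then show ?thesis using J w less Tj 0 by (simp add: write_entry_def J_def numbered_def)
        next
          case (Suc Q)
          then have "Q < n \<and> rep Q = Q" using table_entry_less[OF rep T, of j p Q] j by simp
          then have "arr s aNew Q = num rep Q" using J by (simp add: J_def numbered_def)
          moreover have "entry p j = Suc (num rep Q)" using Suc by (simp add: entry_def)
          ultimately show ?thesis using J w less Tj Suc by (simp add: write_entry_def J_def numbered_def)
        qed
      qed (use * in \<open>simp add: I_def J_def\<close>)
      then have "wp L (seqs (map write_entry [0..<k])) (\<lambda>s. I (Suc p) s \<and> var s vI = p \<and> var s vN = n) s"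
        by (rule wp_mono) (use True in \<open>auto simp: I_def J_def written_row num_Suc numbered_def dest: frameD(1)\<close>)
      then show ?thesis using True * by (simp add: I_def numbered_def)
    qed
  qed (simp_all add: I_def numbered_def)
  then show ?thesis
    by (rule triple_conseq) (auto simp: I_def num_0 numbered_def dest: frameD(1))
qed

lemma written_encode:
  assumes "written n 0 f" "i < length (encode_graph as (result rep))"
  shows "f i = encode_graph as (result rep) ! i"
proof -
  note res = rep T core
  have card: "card (vertices (result rep)) = num rep n" by (simp add: vertices_result[OF res])
  note enc = encode_graph_nth[where as = as, OF card]
  show ?thesis using card assms(2)
  proof (cases rule: encode_graph_index)
    case 1
    then show ?thesis using assms(1) enc(2) by (simp add: written_def)
  next
    case 2
    then show ?thesis using assms(1) enc(3) by (simp add: written_def base_result[OF res])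
  next
    case (3 p j)
    then obtain P where P: "P < n" "rep P = P" "p = num rep P"
      using num_image[of rep n] by (auto simp: image_iff set_eq_iff)
    have "f i = entry P j"
      using assms(1) 3 P by (simp add: written_def k_def)
    also have "\<dots> = table_entry (result rep) p (as ! j)"
      using table_entry_result[OF res P(1,2)] 3 P(3) by (simp add: entry_def k_def)
    finally show ?thesis using enc(4) 3 by simp
  qed
qed

end

lemma triple_output:
  "triple M L (finished rep) (Assign vC (ENum 0) ;; renumber ;;
     (Write (ENum 0) (EVar vC) ;; Write (ENum 1) (EArr aNew (EArr aRep (EVar vB))) ;; Assign vO (ENum 2)) ;;
     write_rows k) (Suc n)
    (\<lambda>s. rep_ok rep \<and> (\<exists>T. table_ok rep T \<and> (\<forall>P Q. \<not> core_pair (quot rep) P Q) \<and> written rep T n 0 (inp s)))"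
  (is "triple _ _ _ ?c _ ?Q")
proof -
  have "triple M L (\<lambda>s. finished rep s \<and> tabs s = T) ?c (Suc n) ?Q" for T
  proof (cases "rep_ok rep \<and> table_ok rep T \<and> (\<forall>P Q. \<not> core_pair (quot rep) P Q)")
    case True
    then have res: "rep_ok rep" "table_ok rep T" "\<And>P Q. \<not> core_pair (quot rep) P Q" by auto
    have "triple M L (\<lambda>s. finished rep s \<and> tabs s = T) (Assign vC (ENum 0)) (Suc n)
        (\<lambda>s. ready rep s \<and> tabs s = T \<and> var s vC = 0)"
      by (rule triple_wp) (simp_all add: finished_def)
    moreover have "triple M L (\<lambda>s. numbered rep T s \<and> var s vC = num rep n)
        (Write (ENum 0) (EVar vC) ;; Write (ENum 1) (EArr aNew (EArr aRep (EVar vB))) ;; Assign vO (ENum 2)) (Suc n)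
        (\<lambda>s. numbered rep T s \<and> written rep T 0 0 (inp s) \<and> var s vO = 2)"
    proof (rule triple_wp)
      fix s assume *: "numbered rep T s \<and> var s vC = num rep n"
      then have "framed s" by (simp add: numbered_def[OF res])
      then have "var s vB = base \<Gamma>" by (rule frameD(3))
      moreover have "rep (base \<Gamma>) < n" "rep (rep (base \<Gamma>)) = rep (base \<Gamma>)"
        using rep_ok_less[OF res(1) base_less] rep_ok_idem[OF res(1) base_less] by blast+
      ultimately show "wp L (Write (ENum 0) (EVar vC) ;; Write (ENum 1) (EArr aNew (EArr aRep (EVar vB))) ;;
          Assign vO (ENum 2)) (\<lambda>s. numbered rep T s \<and> written rep T 0 0 (inp s) \<and> var s vO = 2) s"
        using * by (simp add: numbered_def[OF res] written_def[OF res])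
    qed simp
    moreover have "triple M L (\<lambda>s. numbered rep T s \<and> written rep T 0 0 (inp s) \<and> var s vO = 2)
        (write_rows k) (Suc n) ?Q"
      by (rule triple_conseq[OF triple_write_rows[OF res]]) (use True in auto)
    ultimately show ?thesis
      using triple_renumber[OF res] by (blast intro: triple_seq)
  qed (auto simp: triple_def finished_def)
  then have "triple M L (\<lambda>s. \<exists>T. finished rep s \<and> tabs s = T) ?c (Suc n) ?Q"
    by (rule triple_Ex)
  then show ?thesis by (rule triple_conseq) auto
qed

lemma saturate_correct:
  "\<exists>\<Gamma>' m t s'. big M L (saturate k) (initial_store (encode_graph as \<Gamma>)) t s' \<and>
    t \<le> clen M (saturate k) * ((n + 2) * Suc (2 * n * n)) \<and>
    stallings_graph A (malnormal_closure (free_group A) H) \<Gamma>' \<and> vertices \<Gamma>' = {..<m} \<and> m \<le> n \<and>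
    (\<forall>i < length (encode_graph as \<Gamma>'). inp s' i = encode_graph as \<Gamma>' ! i)"
proof -
  let ?B = "(n + 2) * Suc (2 * n * n)"
  let ?Q = "\<lambda>s. \<exists>rep. rep_ok rep \<and> (\<exists>T. table_ok rep T \<and> (\<forall>P Q. \<not> core_pair (quot rep) P Q) \<and> written rep T n 0 (inp s))"
  have B1: "1 \<le> ?B" by simp
  have B2: "Suc n \<le> ?B" by simp
  have B3: "Suc (n * n) \<le> ?B" by simp
  have "triple M L (\<lambda>s. s = initial_store (encode_graph as \<Gamma>)) init ?B
      (\<lambda>s. \<exists>rep. ready rep s \<and> rep_ok rep \<and> (\<forall>x P. tabs s x P = 0))"
    by (rule triple_conseq[OF triple_init]) (use B3 in simp_all)
  moreover have "triple M L (\<lambda>s. \<exists>rep. ready rep s \<and> rep_ok rep \<and> (\<forall>x P. tabs s x P = 0)) (Assign vGo (ENum 1)) ?B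
      (\<lambda>s. \<exists>rep. working rep s \<and> var s vGo \<noteq> 0)"
    by (rule triple_wp) (auto simp: working_def)
  moreover note triple_main
  moreover have "triple M L (\<lambda>s. \<exists>rep. finished rep s) (Assign vC (ENum 0) ;; renumber ;;
     (Write (ENum 0) (EVar vC) ;; Write (ENum 1) (EArr aNew (EArr aRep (EVar vB))) ;; Assign vO (ENum 2)) ;;
     write_rows k) ?B ?Q"
    by (rule triple_Ex, rule triple_conseq[OF triple_output]) (use B2 in auto)
  ultimately have "triple M L (\<lambda>s. s = initial_store (encode_graph as \<Gamma>)) (saturate k) ?B ?Q"
    unfolding saturate_def by (blast intro: triple_seq)
  then obtain t s' rep T where run: "big M L (saturate k) (initial_store (encode_graph as \<Gamma>)) t s'"
    "t \<le> clen M (saturate k) * ?B" and res: "rep_ok rep" "table_ok rep T" "\<And>P Q. \<not> core_pair (quot rep) P Q"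
    and w: "written rep T n 0 (inp s')"
    unfolding triple_def by blast
  show ?thesis
    using run stallings_result[OF res] vertices_result[OF res] written_encode[OF res w] num_le
    by (intro exI[of _ "result rep"] exI[of _ "num rep n"] exI[of _ t] exI[of _ s']) simp
qed

text \<open>The simulation describes memory only on the input area. This covers the output, since
  the result has \<open>m \<le> n\<close> vertices and so no longer an encoding.\<close>

lemma computes_closure:
  "\<exists>\<Gamma>' m. stallings_graph A (malnormal_closure (free_group A) H) \<Gamma>' \<and> vertices \<Gamma>' = {..<m} \<and>
    computes_within (program k M (saturate k))
      (k + 3 + clen M (saturate k) * ((n + 2) * Suc (2 * n * n))) (encode_graph as \<Gamma>) (encode_graph as \<Gamma>')"
proof -
  obtain \<Gamma>' m t s' where run: "big M L (saturate k) (initial_store (encode_graph as \<Gamma>)) t s'"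
    "t \<le> clen M (saturate k) * ((n + 2) * Suc (2 * n * n))"
    and \<Gamma>': "stallings_graph A (malnormal_closure (free_group A) H) \<Gamma>'" "vertices \<Gamma>' = {..<m}" "m \<le> n"
    and out: "\<forall>i < length (encode_graph as \<Gamma>'). inp s' i = encode_graph as \<Gamma>' ! i"
    using saturate_correct by blast
  have "card (vertices \<Gamma>) = n" "card (vertices \<Gamma>') = m" by (simp_all add: vertices \<Gamma>')
  note enc = encode_graph_nth(1,2)[where as = as, OF this(1), folded k_def]
    encode_graph_nth(1)[where as = as, OF this(2), folded k_def]
  have "length (encode_graph as \<Gamma>') \<le> length (encode_graph as \<Gamma>)" using enc \<Gamma>'(3) by simp
  moreover obtain \<sigma> where "(step (program k M (saturate k)) ^^ (k + 3 + t)) (initial (encode_graph as \<Gamma>)) = \<sigma>"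
    "halted (program k M (saturate k)) \<sigma>" "\<forall>i < length (encode_graph as \<Gamma>). mem \<sigma> i = inp s' i"
    using program_correct[of M "encode_graph as \<Gamma>" "saturate k" t s' k] run(1) enc wf_saturate by auto
  ultimately have "computes_within (program k M (saturate k))
      (k + 3 + clen M (saturate k) * ((n + 2) * Suc (2 * n * n))) (encode_graph as \<Gamma>) (encode_graph as \<Gamma>')"
    unfolding computes_within_def Let_def using run(2) out
    by (intro exI[of _ "k + 3 + t"]) simp
  then show ?thesis using \<Gamma>' by blast
qed

end

section \<open>The time bound\<close>

text \<open>The factor 9 comes from \<open>n + 2 \<le> 3 * n\<close> and
  \<open>Suc (2 * n * n) \<le> 3 * (n * n)\<close>. The threshold 3 exceeds Euler's number, so that
  \<open>ln n \<ge> 1\<close> and the cubic bound is absorbed.\<close>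

lemma cubic_bigo:
  fixes c d :: nat
  shows "(\<lambda>n. real (c + d * ((n + 2) * Suc (2 * n * n)))) \<in> O(\<lambda>n. real n ^ 3 * ln (real n))"
proof (rule bigoI[of _ "real (c + 9 * d)"])
  show "\<forall>\<^sub>F n in sequentially. norm (real (c + d * ((n + 2) * Suc (2 * n * n))))
      \<le> real (c + 9 * d) * norm (real n ^ 3 * ln (real n))"
    using eventually_ge_at_top[of 3]
  proof eventually_elim
    case (elim n)
    have "(n + 2) * Suc (2 * n * n) \<le> (3 * n) * (3 * (n * n))"
      using elim by (intro mult_le_mono) simp_all
    then have "d * ((n + 2) * Suc (2 * n * n)) \<le> d * (9 * n ^ 3)"
      by (intro mult_le_mono2) (simp add: power3_eq_cube)
    moreover have "c \<le> c * n ^ 3" using elim by simp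
    ultimately have "c + d * ((n + 2) * Suc (2 * n * n)) \<le> c * n ^ 3 + d * (9 * n ^ 3)"
      by (intro add_mono)
    also have "\<dots> = (c + 9 * d) * n ^ 3" by (simp add: algebra_simps)
    finally have "c + d * ((n + 2) * Suc (2 * n * n)) \<le> (c + 9 * d) * n ^ 3" .
    then have "real (c + d * ((n + 2) * Suc (2 * n * n))) \<le> real ((c + 9 * d) * n ^ 3)"
      by (rule of_nat_mono)
    also have "\<dots> = real (c + 9 * d) * (real n ^ 3 * 1)" by simp
    also have "\<dots> \<le> real (c + 9 * d) * (real n ^ 3 * ln (real n))"
    proof (intro mult_left_mono)
      have "exp 1 \<le> real n" using exp_le elim by linarith
      then show "1 \<le> ln (real n)" using elim by (simp add: ln_ge_iff)
    qed simp_all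
    also have "\<dots> \<le> real (c + 9 * d) * \<bar>real n ^ 3 * ln (real n)\<bar>"
      by (intro mult_left_mono) simp_all
    finally show ?case unfolding real_norm_def abs_of_nat .
  qed
qed

theorem corollary3p4:
  fixes A :: "'a set" and as :: "'a list"
  assumes "finite A" and "distinct as" and "set as = A"
  shows "\<exists>(P :: instr list) (T :: nat \<Rightarrow> nat).
           (\<lambda>n. real (T n)) \<in> O(\<lambda>n. real n ^ 3 * ln (real n)) \<and>
           (\<forall>(H :: 'a word set) (\<Gamma> :: (nat, 'a) pointed_graph) (n :: nat).
              subgroup H (free_group A) \<and>
              finitely_generated_subgroup (free_group A) H \<and>
              stallings_graph A H \<Gamma> \<and> vertices \<Gamma> = {..<n} \<longrightarrow>
              (\<exists>(\<Gamma>' :: (nat, 'a) pointed_graph) (m :: nat).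
                 stallings_graph A (malnormal_closure (free_group A) H) \<Gamma>' \<and>
                 vertices \<Gamma>' = {..<m} \<and>
                 computes_within P (T n) (encode_graph as \<Gamma>) (encode_graph as \<Gamma>')))"
proof -
  let ?k = "length as"
  let ?M = "8 + 2 * ?k"
  let ?T = "\<lambda>n. ?k + 3 + clen ?M (saturate ?k) * ((n + 2) * Suc (2 * n * n))"
  have main: "\<exists>\<Gamma>' m. stallings_graph A (malnormal_closure (free_group A) H) \<Gamma>' \<and> vertices \<Gamma>' = {..<m} \<and>
      computes_within (program ?k ?M (saturate ?k)) (?T n) (encode_graph as \<Gamma>) (encode_graph as \<Gamma>')"
    if *: "subgroup H (free_group A) \<and> finitely_generated_subgroup (free_group A) H \<and>
      stallings_graph A H \<Gamma> \<and> vertices \<Gamma> = {..<n}"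
    for H :: "'a word set" and \<Gamma> :: "(nat, 'a) pointed_graph" and n :: nat
  proof -
    interpret stallings_input A as \<Gamma> n H
      using assms * by (intro stallings_input.intro) simp_all
    show ?thesis using computes_closure unfolding k_def .
  qed
  show ?thesis
    by (rule exI[of _ "program ?k ?M (saturate ?k)"], rule exI[of _ ?T],
        rule conjI, rule cubic_bigo, intro allI impI, erule main)
qed

end
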